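(* Let $\varphi:\mathbb{R}\to\mathbb{R}$ be a strictly increasing diffeomorphism and let $\Sigma\subset\mathbb{R}^3$ be a complete (connected) flat $[\varphi,\vec e_3]$-minimal surface. Then $\Sigma$ is either a vertical plane or a $[\varphi,\vec e_3]$-catenary cylinder (maybe tilted).
   Context: All objects are smooth; a dot is the derivative of $\varphi$. A surface $\Sigma$ in $\mathbb{R}^3$ is $[\varphi,\vec e_3]$-minimal if its mean curvature vector (trace of the vector-valued second fundamental form) satisfies $\mathbf{H}=\dot\varphi\,\vec e_3^{\,\perp}$, where $\dot\varphi$ is evaluated at the height of the point, $\vec e_3=(0,0,1)$ and $\perp$ is the projection onto the normal bundle. Flat means zero Gauss curvature. A $[\varphi,\vec e_3]$-catenary cylinder is a surface $\{(x,y,u(x)) : x\in I,\ y\in\mathbb{R}\}$, where $u$ is the maximal solution, on the interval $I$, of $u''=\dot\varphi(u)(1+u'^2)$ with $u(0)=u_0$, $u'(0)=0$ for some $u_0$. A tilted $[\varphi,\vec e_3]$-catenary cylinder is the surface obtained from a $[\varphi,\vec e_3]$-catenary cylinder by rotating it by an angle $\theta\in\,]0,\pi/2[$ about the $x$-axis and dilating by $1/\cos\theta$, i.e. the surface parametrized by $\left(\frac{x}{\cos\theta},\,y-u(x)\tan\theta,\,u(x)+y\tan\theta\right)$. Both notions are understood up to rotations about vertical axes and horizontal translations of $\mathbb{R}^3$. *)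

theory Defs
  imports "HOL-Analysis.Analysis"
begin

section \<open>Smooth maps\<close>

primrec Ck_on :: "nat \<Rightarrow> ('a::euclidean_space) set \<Rightarrow> ('a \<Rightarrow> 'b::real_normed_vector) \<Rightarrow> bool"
  where
    "Ck_on 0 S f \<longleftrightarrow> continuous_on S f"
  | "Ck_on (Suc k) S f \<longleftrightarrow>
       (\<forall>x\<in>S. f differentiable (at x)) \<and> (\<forall>v. Ck_on k S (\<lambda>x. frechet_derivative f (at x) v))"

text \<open>This is \<open>C\<^sup>\<infinity>\<close> only for open \<open>S\<close>, the derivatives being taken in the full space.\<close>

definition smooth_on :: "('a::euclidean_space) set \<Rightarrow> ('a \<Rightarrow> 'b::real_normed_vector) \<Rightarrow> bool"
  where "smooth_on S f \<longleftrightarrow> (\<forall>k. Ck_on k S f)"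

definition diffeomorphism_real :: "(real \<Rightarrow> real) \<Rightarrow> bool"
  where "diffeomorphism_real \<phi> \<longleftrightarrow> bij \<phi> \<and> smooth_on UNIV \<phi> \<and> smooth_on UNIV (inv \<phi>)"

section \<open>Immersed surfaces\<close>

text \<open>
  A surface is a topological surface \<open>M\<close> (Hausdorff and second countable through the type
  class constraints used below) with a map \<open>X\<close> into \<open>\<real>\<^sup>3\<close> that is a smooth immersion.
  The smooth structure of \<open>M\<close> need not be given separately: it is the one whose local
  parametrizations are the homeomorphisms \<open>f\<close> onto open subsets of \<open>M\<close> such that
  \<open>X \<circ> f\<close> is a smooth immersion. Any two of these differ by a smooth change
  of parameters. An embedded surface is the case \<open>X = id\<close>, \<open>M\<close> a subset of \<open>\<real>\<^sup>3\<close>.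
\<close>

definition regular_param ::
    "('a::topological_space) set \<Rightarrow> ('a \<Rightarrow> real^3) \<Rightarrow> (real^2) set \<Rightarrow> (real^2 \<Rightarrow> 'a) \<Rightarrow> bool"
  where
    "regular_param M X V f \<longleftrightarrow>
       open V \<and> openin (top_of_set M) (f ` V) \<and> (\<exists>g. homeomorphism V (f ` V) f g) \<and>
       smooth_on V (X \<circ> f) \<and> (\<forall>q\<in>V. inj (frechet_derivative (X \<circ> f) (at q)))"

definition immersed_surface ::
    "('a::{t2_space, second_countable_topology}) set \<Rightarrow> ('a \<Rightarrow> real^3) \<Rightarrow> bool"
  where
    "immersed_surface M X \<longleftrightarrow> (\<forall>p\<in>M. \<exists>V f. regular_param M X V f \<and> p \<in> f ` V)"

section \<open>Completeness\<close>

text \<open>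
  The Riemannian distance of the induced metric: the infimum of the lengths of piecewise
  \<open>C\<^sup>1\<close> curves in \<open>M\<close>. \<^const>\<open>valid_path\<close> allows an unbounded derivative near the finitely
  many exceptional parameters; \<open>has_integral\<close> restricts to curves of finite length.
\<close>

definition surface_dist ::
    "('a::topological_space) set \<Rightarrow> ('a \<Rightarrow> real^3) \<Rightarrow> 'a \<Rightarrow> 'a \<Rightarrow> real"
  where
    "surface_dist M X p q =
       Inf {L. \<exists>\<gamma>. path \<gamma> \<and> path_image \<gamma> \<subseteq> M \<and> pathstart \<gamma> = p \<and> pathfinish \<gamma> = q \<and>
                   valid_path (X \<circ> \<gamma>) \<and>
                   ((\<lambda>t. norm (vector_derivative (X \<circ> \<gamma>) (at t))) has_integral L) {0..1}}"

text \<open>Meaningful for connected \<open>M\<close> only: otherwise the infimum may be over the empty set.\<close>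

definition complete_surface :: "('a::topological_space) set \<Rightarrow> ('a \<Rightarrow> real^3) \<Rightarrow> bool"
  where
    "complete_surface M X \<longleftrightarrow>
       (\<forall>\<sigma> :: nat \<Rightarrow> 'a.
          range \<sigma> \<subseteq> M \<and>
          (\<forall>\<epsilon>>0. \<exists>N. \<forall>m\<ge>N. \<forall>n\<ge>N. surface_dist M X (\<sigma> m) (\<sigma> n) < \<epsilon>) \<longrightarrow>
          (\<exists>p\<in>M. (\<lambda>n. surface_dist M X (\<sigma> n) p) \<longlonglongrightarrow> 0))"

section \<open>Curvature of a parametrized surface\<close>

definition partial :: "2 \<Rightarrow> (real^2 \<Rightarrow> real^3) \<Rightarrow> real^2 \<Rightarrow> real^3"
  where "partial i F q = frechet_derivative F (at q) (axis i 1)"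

definition unit_normal :: "(real^2 \<Rightarrow> real^3) \<Rightarrow> real^2 \<Rightarrow> real^3"
  where "unit_normal F q = sgn (cross3 (partial 1 F q) (partial 2 F q))"

definition normal_part :: "(real^2 \<Rightarrow> real^3) \<Rightarrow> real^2 \<Rightarrow> real^3 \<Rightarrow> real^3"
  where "normal_part F q w = (w \<bullet> unit_normal F q) *\<^sub>R unit_normal F q"

definition first_ff :: "(real^2 \<Rightarrow> real^3) \<Rightarrow> real^2 \<Rightarrow> real^2^2"
  where "first_ff F q = (\<chi> i j. partial i F q \<bullet> partial j F q)"

definition vector_second_ff :: "(real^2 \<Rightarrow> real^3) \<Rightarrow> real^2 \<Rightarrow> 2 \<Rightarrow> 2 \<Rightarrow> real^3"
  where "vector_second_ff F q i j = normal_part F q (partial j (partial i F) q)"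

definition second_ff :: "(real^2 \<Rightarrow> real^3) \<Rightarrow> real^2 \<Rightarrow> real^2^2"
  where "second_ff F q = (\<chi> i j. partial j (partial i F) q \<bullet> unit_normal F q)"

definition mean_curvature_vector :: "(real^2 \<Rightarrow> real^3) \<Rightarrow> real^2 \<Rightarrow> real^3"
  where
    "mean_curvature_vector F q =
       (\<Sum>i\<in>UNIV. \<Sum>j\<in>UNIV. (matrix_inv (first_ff F q) $ i $ j) *\<^sub>R vector_second_ff F q i j)"

definition gauss_curvature :: "(real^2 \<Rightarrow> real^3) \<Rightarrow> real^2 \<Rightarrow> real"
  where "gauss_curvature F q = det (second_ff F q) / det (first_ff F q)"

definition e3 :: "real^3"
  where "e3 = axis 3 1"

definition phi_minimal ::
    "(real \<Rightarrow> real) \<Rightarrow> ('a::topological_space) set \<Rightarrow> ('a \<Rightarrow> real^3) \<Rightarrow> bool"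
  where
    "phi_minimal \<phi> M X \<longleftrightarrow>
       (\<forall>V f. regular_param M X V f \<longrightarrow>
          (\<forall>q\<in>V. mean_curvature_vector (X \<circ> f) q
                  = deriv \<phi> (X (f q) $ 3) *\<^sub>R normal_part (X \<circ> f) q e3))"

definition flat_surface :: "('a::topological_space) set \<Rightarrow> ('a \<Rightarrow> real^3) \<Rightarrow> bool"
  where
    "flat_surface M X \<longleftrightarrow>
       (\<forall>V f. regular_param M X V f \<longrightarrow> (\<forall>q\<in>V. gauss_curvature (X \<circ> f) q = 0))"

section \<open>The model surfaces\<close>

definition vertical_plane :: "(real^3) set \<Rightarrow> bool"
  where "vertical_plane S \<longleftrightarrow> (\<exists>n c. n \<noteq> 0 \<and> n \<bullet> e3 = 0 \<and> S = {p. n \<bullet> p = c})"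

definition catenary_solution ::
    "(real \<Rightarrow> real) \<Rightarrow> real \<Rightarrow> real set \<Rightarrow> (real \<Rightarrow> real) \<Rightarrow> bool"
  where
    "catenary_solution \<phi> u0 I u \<longleftrightarrow>
       open I \<and> is_interval I \<and> 0 \<in> I \<and> u 0 = u0 \<and> deriv u 0 = 0 \<and>
       (\<forall>x\<in>I. (u has_real_derivative deriv u x) (at x) \<and>
              (deriv u has_real_derivative deriv \<phi> (u x) * (1 + (deriv u x)\<^sup>2)) (at x))"

definition maximal_catenary_solution ::
    "(real \<Rightarrow> real) \<Rightarrow> real \<Rightarrow> real set \<Rightarrow> (real \<Rightarrow> real) \<Rightarrow> bool"
  where
    "maximal_catenary_solution \<phi> u0 I u \<longleftrightarrow>
       catenary_solution \<phi> u0 I u \<and>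
       (\<forall>J v. catenary_solution \<phi> u0 J v \<and> I \<subseteq> J \<and> (\<forall>x\<in>I. v x = u x) \<longrightarrow> J = I)"

definition rotate_z :: "real \<Rightarrow> real^3 \<Rightarrow> real^3"
  where
    "rotate_z \<alpha> p = vector [cos \<alpha> * p $ 1 - sin \<alpha> * p $ 2, sin \<alpha> * p $ 1 + cos \<alpha> * p $ 2, p $ 3]"

definition horizontally_congruent :: "(real^3) set \<Rightarrow> (real^3) set \<Rightarrow> bool"
  where
    "horizontally_congruent S C \<longleftrightarrow> (\<exists>\<alpha> b. b \<bullet> e3 = 0 \<and> S = (\<lambda>p. b + rotate_z \<alpha> p) ` C)"

definition catenary_cylinder :: "(real \<Rightarrow> real) \<Rightarrow> (real^3) set \<Rightarrow> bool"
  where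
    "catenary_cylinder \<phi> S \<longleftrightarrow>
       (\<exists>u0 I u. maximal_catenary_solution \<phi> u0 I u \<and>
          horizontally_congruent S {vector [x, y, u x] | x y. x \<in> I})"

definition tilted_catenary_cylinder :: "(real \<Rightarrow> real) \<Rightarrow> (real^3) set \<Rightarrow> bool"
  where
    "tilted_catenary_cylinder \<phi> S \<longleftrightarrow>
       (\<exists>u0 I u \<theta>. maximal_catenary_solution \<phi> u0 I u \<and> 0 < \<theta> \<and> \<theta> < pi / 2 \<and>
          horizontally_congruent S
            {vector [x / cos \<theta>, y - u x * tan \<theta>, u x + y * tan \<theta>] | x y. x \<in> I})"

end

theory Submission
  imports Defs
begin

text \<open>
  Write the surface locally as a graph \<open>w\<close> over one of its tangent planes. If every tangent plane is
  vertical, flatness and minimality force the gradient of \<open>w\<close> to be locally constant, so the surface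
  is planar. Otherwise, where the tangent plane is not vertical, the Hessian of \<open>w\<close> has rank one and
  its trace is positive. Its null direction is that of the ruling; the slope \<open>m\<close> of the ruling satisfies
  Burgers' equation, and the equation of minimality turns \<open>\<partial>m\<close> into \<open>- \<kappa> \<phi>''(w) / \<phi>'(w)\<close>, where \<open>\<kappa>\<close> is the
  inclination of the ruling. Moreover \<open>1 / \<phi>'\<close> is affine along a ruling with \<open>\<kappa> \<noteq> 0\<close>. By completeness
  such a ruling is a whole line and reaches all heights, so \<open>1 / \<phi>'\<close> is affine and positive on the real
  line, hence constant. In all cases \<open>m\<close> is locally constant. This makes the surface locally
  a cylinder over a curve of which a first integral is explicit; having contact with a given model
  cylinder is therefore an open and closed condition.
  Finally a complete surface which is developed onto a graph over a convex domain covers it, by lifting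
  segments, and is thus the whole graph.
\<close>

section \<open>Differential calculus of maps of class \<open>C\<^sup>k\<close>\<close>

text \<open>Nothing says that \<open>X\<close> is injective, so all local work takes place in charts
  with values in \<open>M\<close>; injectivity appears only with the developing argument. The
  obstacle is the boundary of the non-vertical part, where the gradient of a graph could blow up.
  Two facts exclude this: the gradient is constant along a ruling, and on a model cylinder steepness
  is tied to height by the first integral \<phi>(u) + ln cos s = \<phi>(u0), s being the inclination
  angle, so that a point at finite height has finite slope. For this reason the connectedness
  argument compares the surface with one fixed model, whose parameters are read off at a single
  point. Parametrizing the generating curve by s also makes it explicit up to one integration, so
  that no existence theorem for differential equations is called upon. Completeness enters through
  \<open>lift_exists\<close> alone, once for rulings and once for segments of the parameter domain.
  That domain may be a strip of finite width: for \<phi> the identity, solutions of the catenary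
  equation live on bounded intervals.\<close>

lemma frechet_derivative_transform_open:
  assumes "open S" "x \<in> S" "\<And>y. y \<in> S \<Longrightarrow> f y = g y"
  shows "frechet_derivative f (at x) = frechet_derivative g (at x)"
    and "f differentiable (at x) \<longleftrightarrow> g differentiable (at x)"
proof -
  have *: "(f has_derivative d) (at x) \<longleftrightarrow> (g has_derivative d) (at x)" for d
    using assms by (metis has_derivative_transform_within_open)
  show "frechet_derivative f (at x) = frechet_derivative g (at x)"
    unfolding frechet_derivative_def * ..
  show "f differentiable (at x) \<longleftrightarrow> g differentiable (at x)"
    unfolding differentiable_def * ..
qed

lemma Ck_on_cong:
  assumes "open S" "\<And>y. y \<in> S \<Longrightarrow> f y = g y"
  shows "Ck_on k S f \<longleftrightarrow> Ck_on k S g"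
  using assms(2)
proof (induction k arbitrary: f g)
  case 0
  then show ?case by (simp cong: continuous_on_cong)
next
  case (Suc k)
  have "Ck_on k S (\<lambda>x. frechet_derivative f (at x) v) \<longleftrightarrow> Ck_on k S (\<lambda>x. frechet_derivative g (at x) v)" for v
    by (rule Suc.IH) (use Suc.prems assms(1) in \<open>metis frechet_derivative_transform_open(1)\<close>)
  moreover have "f differentiable (at x) \<longleftrightarrow> g differentiable (at x)" if "x \<in> S" for x
    using Suc.prems assms(1) that by (metis frechet_derivative_transform_open(2))
  ultimately show ?case by simp
qed

text \<open>The form in which the closure properties below are proved: a derivative is exhibited by
  the calculus rules and identified with \<open>frechet_derivative\<close> only here, where openness
  of \<open>S\<close> carries the equality through the recursion.\<close>

lemma Ck_on_SucI:
  assumes "open S" "\<And>x. x \<in> S \<Longrightarrow> (f has_derivative f' x) (at x)"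
    and "\<And>v. Ck_on k S (\<lambda>x. f' x v)"
  shows "Ck_on (Suc k) S f"
proof -
  have "frechet_derivative f (at x) = f' x" if "x \<in> S" for x
    using assms(2)[OF that] frechet_derivative_at by metis
  then have "Ck_on k S (\<lambda>x. frechet_derivative f (at x) v)" for v
    using assms(3)[of v] Ck_on_cong[OF assms(1), of "\<lambda>x. frechet_derivative f (at x) v" "\<lambda>x. f' x v"]
    by simp
  then show ?thesis
    using assms(2) by (auto simp: differentiable_def)
qed

lemma Ck_on_SucD:
  "Ck_on (Suc k) S f \<Longrightarrow> Ck_on k S f"
proof (induction k arbitrary: f)
  case 0
  then show ?case
    by (auto intro!: continuous_at_imp_continuous_on differentiable_imp_continuous_within)
next
  case (Suc k)
  have "Ck_on k S (\<lambda>x. frechet_derivative f (at x) v)" for v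
    by (rule Suc.IH) (use Suc.prems in simp)
  with Suc.prems show ?case by simp
qed

lemma Ck_on_has_derivative:
  assumes "Ck_on (Suc k) S f" "x \<in> S"
  shows "(f has_derivative frechet_derivative f (at x)) (at x)"
  using assms by (simp add: frechet_derivative_works)

lemma Ck_on_subset:
  assumes "Ck_on k S f" "T \<subseteq> S"
  shows "Ck_on k T f"
  using assms by (induction k arbitrary: f) (auto intro: continuous_on_subset)

lemma Ck_on_const: "Ck_on k S (\<lambda>x. c)"
proof (induction k arbitrary: c)
  case (Suc k)
  have "frechet_derivative (\<lambda>x. c) (at y) v = 0" for y v :: 'a
    by (simp add: frechet_derivative_const)
  then show ?case using Suc[of 0] by simp
qed simp

lemma Ck_on_add:
  assumes "open S" "Ck_on k S f" "Ck_on k S g"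
  shows "Ck_on k S (\<lambda>x. f x + g x)"
  using assms(2,3)
proof (induction k arbitrary: f g)
  case 0
  then show ?case by (auto intro: continuous_intros)
next
  case (Suc k)
  show ?case
    by (rule Ck_on_SucI[OF assms(1)])
      (use Suc in \<open>auto intro!: derivative_eq_intros Ck_on_has_derivative[where S=S and k=k] Suc.IH\<close>)
qed

lemma Ck_on_sum:
  assumes "open S" "\<And>i. i \<in> A \<Longrightarrow> Ck_on k S (f i)"
  shows "Ck_on k S (\<lambda>x. \<Sum>i\<in>A. f i x)"
  using assms(2)
  by (induction A rule: infinite_finite_induct) (auto intro!: Ck_on_add assms(1) Ck_on_const)

lemma Ck_on_bilinear:
  assumes "bounded_bilinear pr" "open S" "Ck_on k S f" "Ck_on k S g"
  shows "Ck_on k S (\<lambda>x. pr (f x) (g x))"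
  using assms(3,4)
proof (induction k arbitrary: f g)
  case 0
  then show ?case using bounded_bilinear.continuous_on[OF assms(1)] by auto
next
  case (Suc k)
  interpret bounded_bilinear pr by fact
  show ?case
  proof (rule Ck_on_SucI[OF assms(2)])
    fix x assume "x \<in> S"
    then show "((\<lambda>x. pr (f x) (g x)) has_derivative
        (\<lambda>v. pr (f x) (frechet_derivative g (at x) v) + pr (frechet_derivative f (at x) v) (g x))) (at x)"
      using Suc.prems by (intro FDERIV) (auto intro: Ck_on_has_derivative)
  next
    fix v
    show "Ck_on k S (\<lambda>x. pr (f x) (frechet_derivative g (at x) v) + pr (frechet_derivative f (at x) v) (g x))"
      using Suc.prems Ck_on_SucD[OF Suc.prems(1)] Ck_on_SucD[OF Suc.prems(2)]
      by (intro Ck_on_add assms Suc.IH) auto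
  qed
qed

lemmas Ck_on_scaleR = Ck_on_bilinear[OF bounded_bilinear_scaleR]
lemmas Ck_on_mult = Ck_on_bilinear[OF bounded_bilinear_mult]
lemmas Ck_on_inner = Ck_on_bilinear[OF bounded_bilinear_inner]

lemma Ck_on_minus:
  assumes "open S" "Ck_on k S f"
  shows "Ck_on k S (\<lambda>x. - f x)"
  using Ck_on_scaleR[OF assms(1) Ck_on_const assms(2), of "-1"] by simp

lemma Ck_on_diff:
  assumes "open S" "Ck_on k S f" "Ck_on k S g"
  shows "Ck_on k S (\<lambda>x. f x - g x)"
  using Ck_on_add[OF assms(1,2) Ck_on_minus[OF assms(1,3)]] by simp

lemma Ck_on_inverse:
  fixes f :: "'a::euclidean_space \<Rightarrow> real"
  assumes "open S" "Ck_on k S f" "\<And>x. x \<in> S \<Longrightarrow> f x \<noteq> 0"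
  shows "Ck_on k S (\<lambda>x. inverse (f x))"
  using assms(2)
proof (induction k)
  case 0
  then show ?case using assms(3) by (auto intro: continuous_intros)
next
  case (Suc k)
  show ?case
  proof (rule Ck_on_SucI[OF assms(1)])
    fix x assume "x \<in> S"
    then show "((\<lambda>x. inverse (f x)) has_derivative
       (\<lambda>v. - (inverse (f x) * frechet_derivative f (at x) v * inverse (f x)))) (at x)"
      using assms(3) Ck_on_has_derivative[OF Suc.prems] by (intro Deriv.has_derivative_inverse) auto
  next
    fix v
    show "Ck_on k S (\<lambda>x. - (inverse (f x) * frechet_derivative f (at x) v * inverse (f x)))"
      using Suc.prems by (intro Ck_on_minus Ck_on_mult assms Suc.IH Ck_on_SucD[OF Suc.prems]) auto
  qed
qed

lemma Ck_on_compose: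
  fixes g :: "'a::euclidean_space \<Rightarrow> 'b::euclidean_space" and f :: "'b \<Rightarrow> 'c::real_normed_vector"
  assumes "open S" "open T" "g ` S \<subseteq> T" "Ck_on k S g" "Ck_on k T f"
  shows "Ck_on k S (\<lambda>x. f (g x))"
  using assms(4,5)
proof (induction k arbitrary: f)
  case 0
  then show ?case using assms(3) continuous_on_compose2 by auto
next
  case (Suc k)
  show ?case
  proof (rule Ck_on_SucI[OF assms(1)])
    fix x assume x: "x \<in> S"
    have gx: "g x \<in> T" using x assms(3) by auto
    have df: "(f has_derivative frechet_derivative f (at (g x))) (at (g x))"
      using Suc.prems gx by (intro Ck_on_has_derivative)
    then have lin: "linear (frechet_derivative f (at (g x)))" by (rule has_derivative_linear)
    \<comment> \<open>The inner direction depends on \<open>x\<close>, whereas \<open>Ck_on\<close>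
      controls derivatives of \<open>f\<close> in fixed directions only. Expanding in a basis turns
      the chain rule into a finite sum of products to which the induction hypothesis
      applies.\<close>
    have "(\<lambda>v. frechet_derivative f (at (g x)) (frechet_derivative g (at x) v))
      = (\<lambda>v. \<Sum>b\<in>Basis. (frechet_derivative g (at x) v \<bullet> b) *\<^sub>R frechet_derivative f (at (g x)) b)"
    proof
      fix v
      have "frechet_derivative f (at (g x)) (frechet_derivative g (at x) v)
        = frechet_derivative f (at (g x)) (\<Sum>b\<in>Basis. (frechet_derivative g (at x) v \<bullet> b) *\<^sub>R b)"
        by (simp add: euclidean_representation)
      also have "\<dots> = (\<Sum>b\<in>Basis. (frechet_derivative g (at x) v \<bullet> b) *\<^sub>R frechet_derivative f (at (g x)) b)"
        by (simp only: linear_sum[OF lin] linear_scale[OF lin])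
      finally show "frechet_derivative f (at (g x)) (frechet_derivative g (at x) v) = \<dots>" .
    qed
    moreover have "((\<lambda>x. f (g x)) has_derivative (\<lambda>v. frechet_derivative f (at (g x)) (frechet_derivative g (at x) v))) (at x)"
      using has_derivative_compose[OF Ck_on_has_derivative[OF Suc.prems(1) x]] df by blast
    ultimately show "((\<lambda>x. f (g x)) has_derivative
       (\<lambda>v. \<Sum>b\<in>Basis. (frechet_derivative g (at x) v \<bullet> b) *\<^sub>R frechet_derivative f (at (g x)) b)) (at x)"
      by simp
  next
    fix v
    show "Ck_on k S (\<lambda>x. \<Sum>b\<in>Basis. (frechet_derivative g (at x) v \<bullet> b) *\<^sub>R frechet_derivative f (at (g x)) b)"
      using Suc.prems Ck_on_SucD[OF Suc.prems(1)]
      by (intro Ck_on_sum Ck_on_scaleR Ck_on_inner Ck_on_const Suc.IH assms) auto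
  qed
qed

lemma smooth_on_Ck: "smooth_on S f \<Longrightarrow> Ck_on k S f"
  by (simp add: smooth_on_def)

lemma smooth_on_has_derivative:
  "smooth_on S f \<Longrightarrow> x \<in> S \<Longrightarrow> (f has_derivative frechet_derivative f (at x)) (at x)"
  using Ck_on_has_derivative smooth_on_Ck by blast

lemma smooth_on_imp_continuous_on: "smooth_on S f \<Longrightarrow> continuous_on S f"
  using smooth_on_Ck[of S f 0] by simp

lemma smooth_on_derivative: "smooth_on S f \<Longrightarrow> smooth_on S (\<lambda>x. frechet_derivative f (at x) v)"
  unfolding smooth_on_def using Ck_on.simps(2)[of _ S f] by blast

lemma smooth_on_subset: "smooth_on S f \<Longrightarrow> T \<subseteq> S \<Longrightarrow> smooth_on T f"
  unfolding smooth_on_def by (metis Ck_on_subset)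

lemma smooth_on_compose:
  fixes g :: "'a::euclidean_space \<Rightarrow> 'b::euclidean_space" and f :: "'b \<Rightarrow> 'c::real_normed_vector"
  shows "open S \<Longrightarrow> open T \<Longrightarrow> g ` S \<subseteq> T \<Longrightarrow> smooth_on S g \<Longrightarrow> smooth_on T f
    \<Longrightarrow> smooth_on S (\<lambda>x. f (g x))"
  by (simp add: smooth_on_def Ck_on_compose)

section \<open>Symmetry of second derivatives\<close>

lemma MVT_line:
  fixes g :: "'a::real_normed_vector \<Rightarrow> real"
  assumes "h > 0" "\<And>t. 0 \<le> t \<Longrightarrow> t \<le> h \<Longrightarrow> (g has_derivative g' (x + t *\<^sub>R v)) (at (x + t *\<^sub>R v))"
  obtains t where "0 < t" "t < h" "g (x + h *\<^sub>R v) - g x = h * g' (x + t *\<^sub>R v) v"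
proof -
  have "((\<lambda>t. g (x + t *\<^sub>R v)) has_real_derivative g' (x + t *\<^sub>R v) v) (at t)" if "0 \<le> t" "t \<le> h" for t
  proof -
    have "((\<lambda>t. g (x + t *\<^sub>R v)) has_derivative (\<lambda>s. g' (x + t *\<^sub>R v) (s *\<^sub>R v))) (at t)"
      by (rule has_derivative_compose[where g=g and f="\<lambda>t. x + t *\<^sub>R v", OF _ assms(2)[OF that]])
        (auto intro!: derivative_eq_intros)
    moreover have "linear (g' (x + t *\<^sub>R v))"
      using assms(2)[OF that] has_derivative_linear by blast
    ultimately show ?thesis
      by (simp add: has_field_derivative_def linear_scale mult_commute_abs)
  qed
  then have "\<exists>z>0. z < h \<and> g (x + h *\<^sub>R v) - g (x + 0 *\<^sub>R v) = (h - 0) * g' (x + z *\<^sub>R v) v"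
    by (intro MVT2) (use assms(1) in auto)
  then show ?thesis using that by auto
qed

text \<open>Two applications of the mean value theorem: the first difference in direction
  \<open>u\<close> is a function that is moved along \<open>v\<close>, and the resulting difference
  of derivatives is then moved along \<open>u\<close>. The left side is symmetric in
  \<open>u\<close> and \<open>v\<close>, the right side is not yet known to be.\<close>

lemma second_difference_quotient:
  fixes w :: "'a::euclidean_space \<Rightarrow> real"
  assumes "Ck_on 2 S w" "h > 0" "\<And>s t. 0 \<le> s \<Longrightarrow> s \<le> h \<Longrightarrow> 0 \<le> t \<Longrightarrow> t \<le> h \<Longrightarrow> x + s *\<^sub>R u + t *\<^sub>R v \<in> S"
  obtains s t where "0 < s" "s < h" "0 < t" "t < h"
    "w (x + h *\<^sub>R u + h *\<^sub>R v) - w (x + h *\<^sub>R u) - w (x + h *\<^sub>R v) + w x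
      = h * h * frechet_derivative (\<lambda>y. frechet_derivative w (at y) v) (at (x + s *\<^sub>R u + t *\<^sub>R v)) u"
proof -
  have C: "Ck_on (Suc (Suc 0)) S w" using assms(1) by (simp add: numeral_2_eq_2)
  have d1: "(w has_derivative frechet_derivative w (at y)) (at y)" if "y \<in> S" for y
    using Ck_on_has_derivative[OF C that] .
  have "Ck_on (Suc 0) S (\<lambda>y. frechet_derivative w (at y) v)"
    using C by (subst (asm) Ck_on.simps(2)) auto
  then have d2: "((\<lambda>y. frechet_derivative w (at y) v) has_derivative
      frechet_derivative (\<lambda>y. frechet_derivative w (at y) v) (at y)) (at y)" if "y \<in> S" for y
    using Ck_on_has_derivative that by blast
  have "\<exists>t>0. t < h \<and> (\<lambda>y. w (y + h *\<^sub>R u) - w y) (x + h *\<^sub>R v) - (\<lambda>y. w (y + h *\<^sub>R u) - w y) x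
     = h * (\<lambda>z a. frechet_derivative w (at (z + h *\<^sub>R u)) a - frechet_derivative w (at z) a) (x + t *\<^sub>R v) v"
  proof (rule MVT_line[OF assms(2), of "(\<lambda>y. w (y + h *\<^sub>R u) - w y)"
        "(\<lambda>z a. frechet_derivative w (at (z + h *\<^sub>R u)) a - frechet_derivative w (at z) a)" x v])
    fix t assume t: "0 \<le> t" "t \<le> h"
    have 1: "x + t *\<^sub>R v \<in> S" using assms(3)[of 0 t] t assms(2) by simp
    have 2: "x + t *\<^sub>R v + h *\<^sub>R u \<in> S" using assms(3)[of h t] t assms(2) by (simp add: algebra_simps)
    show "((\<lambda>y. w (y + h *\<^sub>R u) - w y) has_derivative
      (\<lambda>a. frechet_derivative w (at (x + t *\<^sub>R v + h *\<^sub>R u)) a - frechet_derivative w (at (x + t *\<^sub>R v)) a)) (at (x + t *\<^sub>R v))"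
      by (intro has_derivative_diff d1[OF 1] has_derivative_compose[where g=w and f="\<lambda>y. y + h *\<^sub>R u", OF _ d1[OF 2]])
        (auto intro!: derivative_eq_intros)
  qed blast
  then obtain t where t: "0 < t" "t < h" "w (x + h *\<^sub>R v + h *\<^sub>R u) - w (x + h *\<^sub>R v) - (w (x + h *\<^sub>R u) - w x)
     = h * (frechet_derivative w (at (x + t *\<^sub>R v + h *\<^sub>R u)) v - frechet_derivative w (at (x + t *\<^sub>R v)) v)" by auto
  obtain s where s: "0 < s" "s < h" "frechet_derivative w (at (x + t *\<^sub>R v + h *\<^sub>R u)) v - frechet_derivative w (at (x + t *\<^sub>R v)) v
    = h * frechet_derivative (\<lambda>y. frechet_derivative w (at y) v) (at (x + t *\<^sub>R v + s *\<^sub>R u)) u"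
  proof (rule MVT_line[OF assms(2), of "(\<lambda>y. frechet_derivative w (at y) v)"
        "\<lambda>y. frechet_derivative (\<lambda>y. frechet_derivative w (at y) v) (at y)" "x + t *\<^sub>R v" u])
    fix s assume s: "0 \<le> s" "s \<le> h"
    have "x + t *\<^sub>R v + s *\<^sub>R u \<in> S" using assms(3)[of s t] t s by (simp add: algebra_simps)
    then show "((\<lambda>y. frechet_derivative w (at y) v) has_derivative
     frechet_derivative (\<lambda>y. frechet_derivative w (at y) v) (at (x + t *\<^sub>R v + s *\<^sub>R u)))
          (at (x + t *\<^sub>R v + s *\<^sub>R u))"
      by (rule d2)
  qed blast
  show ?thesis
    by (rule that[OF s(1,2) t(1,2)]) (use t(3) s(3) in \<open>simp add: algebra_simps\<close>)
qed

text \<open>Both mixed derivatives, taken at points of a small parallelogram, equal the same second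
  difference divided by h^2; by continuity they agree at the corner.\<close>

lemma second_derivative_symmetric:
  fixes w :: "'a::euclidean_space \<Rightarrow> real"
  assumes "open S" "Ck_on 2 S w" "x \<in> S"
  shows "frechet_derivative (\<lambda>y. frechet_derivative w (at y) v) (at x) u
       = frechet_derivative (\<lambda>y. frechet_derivative w (at y) u) (at x) v"
proof -
  define F where "F u v y = frechet_derivative (\<lambda>y. frechet_derivative w (at y) v) (at y) u" for u v y
  have C: "Ck_on (Suc (Suc 0)) S w" using assms(2) by (simp add: numeral_2_eq_2)
  have contF: "isCont (F u v) x" for u v
  proof -
    have "continuous_on S (F u v)" using C unfolding F_def by simp
    then show ?thesis using assms continuous_on_eq_continuous_at by blast
  qed
  obtain r where r: "r > 0" "ball x r \<subseteq> S" using assms openE by blast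
  define K where "K = 1 + norm u + norm v"
  have K: "K > 0" unfolding K_def by (simp add: add_pos_nonneg)
  have close: "norm ((s *\<^sub>R u + t *\<^sub>R v)) \<le> h * K" if "0 \<le> s" "s \<le> h" "0 \<le> t" "t \<le> h" for s t h
  proof -
    have "norm (s *\<^sub>R u + t *\<^sub>R v) \<le> s * norm u + t * norm v"
      using norm_triangle_ineq[of "s *\<^sub>R u" "t *\<^sub>R v"] that by simp
    also have "\<dots> \<le> h * norm u + h * norm v"
      using that by (intro add_mono mult_right_mono) auto
    also have "\<dots> \<le> h * K" using that unfolding K_def by (simp add: algebra_simps)
    finally show ?thesis .
  qed
  have "F u v x - F v u x = 0"
  proof (rule ccontr)
    assume n: "F u v x - F v u x \<noteq> 0"
    \<comment> \<open>Half the supposed gap: two values within \<open>e\<close> of distinct limits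
      cannot coincide. Below, \<open>h\<close> is so small that the whole parallelogram, of diameter
      at most \<open>h * K\<close> seen from \<open>x\<close>, lies where both continuity estimates
      hold.\<close>
    define e where "e = \<bar>F u v x - F v u x\<bar> / 2"
    have e: "e > 0" using n unfolding e_def by simp
    obtain d1 where d1: "d1 > 0" "\<And>y. dist y x < d1 \<Longrightarrow> dist (F u v y) (F u v x) < e"
      using contF[of u v] e unfolding continuous_at_eps_delta by (metis dist_commute)
    obtain d2 where d2: "d2 > 0" "\<And>y. dist y x < d2 \<Longrightarrow> dist (F v u y) (F v u x) < e"
      using contF[of v u] e unfolding continuous_at_eps_delta by (metis dist_commute)
    define h where "h = Min {r, d1, d2} / (2 * K)"
    have h: "h > 0" using r d1 d2 K unfolding h_def by simp
    have hK: "h * K < r" "h * K < d1" "h * K < d2"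
      using r d1 d2 K unfolding h_def by (auto simp: min_def)
    have near: "dist (x + s *\<^sub>R u + t *\<^sub>R v) x \<le> h * K" if "0 \<le> s" "s \<le> h" "0 \<le> t" "t \<le> h" for s t
      using close[OF that] by (simp add: dist_norm add.assoc)
    have inS: "x + s *\<^sub>R u + t *\<^sub>R v \<in> S" if "0 \<le> s" "s \<le> h" "0 \<le> t" "t \<le> h" for s t
      using near[OF that] r hK by (auto simp: dist_commute)
    have inS': "x + s *\<^sub>R v + t *\<^sub>R u \<in> S" if "0 \<le> s" "s \<le> h" "0 \<le> t" "t \<le> h" for s t
      using inS[of t s] that by (simp add: algebra_simps)
    obtain s t where st: "0 < s" "s < h" "0 < t" "t < h"
      "w (x + h *\<^sub>R u + h *\<^sub>R v) - w (x + h *\<^sub>R u) - w (x + h *\<^sub>R v) + w x = h * h * F u v (x + s *\<^sub>R u + t *\<^sub>R v)"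
      using second_difference_quotient[OF assms(2) h inS] unfolding F_def by blast
    obtain s' t' where st': "0 < s'" "s' < h" "0 < t'" "t' < h"
      "w (x + h *\<^sub>R v + h *\<^sub>R u) - w (x + h *\<^sub>R v) - w (x + h *\<^sub>R u) + w x = h * h * F v u (x + s' *\<^sub>R v + t' *\<^sub>R u)"
      using second_difference_quotient[OF assms(2) h inS'] unfolding F_def by blast
    have "h * h * F u v (x + s *\<^sub>R u + t *\<^sub>R v) = h * h * F v u (x + s' *\<^sub>R v + t' *\<^sub>R u)"
      using st(5) st'(5) by (simp add: algebra_simps)
    then have eq: "F u v (x + s *\<^sub>R u + t *\<^sub>R v) = F v u (x + s' *\<^sub>R v + t' *\<^sub>R u)" using h by simp
    have "dist (F u v (x + s *\<^sub>R u + t *\<^sub>R v)) (F u v x) < e"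
      using near[of s t] st hK by (intro d1) auto
    moreover have "dist (F v u (x + s' *\<^sub>R v + t' *\<^sub>R u)) (F v u x) < e"
      using near[of t' s'] st' hK by (intro d2) (auto simp: algebra_simps)
    ultimately show False using eq unfolding e_def dist_real_def by (simp add: abs_if split: if_splits)
  qed
  then show ?thesis unfolding F_def by simp
qed

text \<open>Multiplication by the integrating factor exp(-C), with C an antiderivative of
  \<open>c\<close>, makes the solution constant. It serves to show that the null direction does not
  turn along a ruling.\<close>

lemma linear_ODE_zero:
  fixes f c :: "real \<Rightarrow> real"
  assumes "\<And>t. t \<in> {a..b} \<Longrightarrow> (f has_real_derivative f t * c t) (at t within {a..b})"
    and "continuous_on {a..b} c" "t0 \<in> {a..b}" "f t0 = 0" "t \<in> {a..b}"
  shows "f t = 0"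
proof -
  define C where "C t = integral {a..t} c" for t
  have C: "(C has_real_derivative c t) (at t within {a..b})" if "t \<in> {a..b}" for t
    using integral_has_vector_derivative[OF assms(2) that] unfolding C_def
    by (simp add: has_real_derivative_iff_has_vector_derivative)
  have "((\<lambda>t. f t * exp (- C t)) has_real_derivative 0) (at t within {a..b})" if "t \<in> {a..b}" for t
    using DERIV_mult[OF assms(1)[OF that] DERIV_chain2[OF DERIV_exp DERIV_minus[OF C[OF that]]]]
    by (simp add: algebra_simps)
  then have "\<exists>k. \<forall>t\<in>{a..b}. f t * exp (- C t) = k"
    by (intro has_field_derivative_zero_constant) auto
  then have "f t * exp (- C t) = f t0 * exp (- C t0)" using assms by metis
  then show ?thesis using assms(4) by simp
qed

section \<open>Surfaces as graphs\<close>

lemma vec2_expand: "(v::real^2) = v$1 *\<^sub>R axis 1 1 + v$2 *\<^sub>R axis 2 1"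
  by (simp add: vec_eq_iff forall_2 axis_def)

lemma frechet_derivative_eqI:
  assumes "(f has_derivative f') (at x)"
  shows "frechet_derivative f (at x) = f'"
  using frechet_derivative_at[OF assms] by simp

lemma linear_vec2:
  assumes "linear (L :: real^2 \<Rightarrow> 'b::real_vector)"
  shows "L v = v$1 *\<^sub>R L (axis 1 1) + v$2 *\<^sub>R L (axis 2 1)"
  by (subst vec2_expand) (simp only: linear_add[OF assms] linear_scale[OF assms])

lemma Ck_on_nth:
  fixes f :: "'a::euclidean_space \<Rightarrow> real^'n"
  assumes "open S" "Ck_on k S f"
  shows "Ck_on k S (\<lambda>x. f x $ i)"
  using Ck_on_inner[OF assms Ck_on_const[of k S "axis i 1"]] by (simp add: inner_axis)

text \<open>Bootstrapping: Cramer's rule writes g' through the first derivatives of \<open>h\<close>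
  evaluated at \<open>g\<close>, so if \<open>g\<close> is of class \<open>Ck_on k\<close>, so is
  g', and \<open>g\<close> gains one order.\<close>

lemma smooth_on_inverse_2d:
  fixes h g :: "real^2 \<Rightarrow> real^2"
  assumes V: "open V" and D: "open D" and h: "smooth_on V h" and gV: "g ` D \<subseteq> V"
    and g: "\<And>y. y \<in> D \<Longrightarrow> (g has_derivative g' y) (at y)"
    and inv: "\<And>y v. y \<in> D \<Longrightarrow> frechet_derivative h (at (g y)) (g' y v) = v"
  shows "smooth_on D g"
proof -
  define H where "H i x = frechet_derivative h (at x) (axis i 1)" for i :: 2 and x
  define J where "J y = H 1 (g y)$1 * H 2 (g y)$2 - H 2 (g y)$1 * H 1 (g y)$2" for y
  have lin: "linear (frechet_derivative h (at x))" if "x \<in> V" for x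
    using smooth_on_has_derivative[OF h that] has_derivative_linear by blast
  have eqs: "v$1 = g' y v $ 1 * H 1 (g y)$1 + g' y v $ 2 * H 2 (g y)$1"
    "v$2 = g' y v $ 1 * H 1 (g y)$2 + g' y v $ 2 * H 2 (g y)$2" if "y \<in> D" for y v
  proof -
    have "v = g' y v $ 1 *\<^sub>R H 1 (g y) + g' y v $ 2 *\<^sub>R H 2 (g y)"
      using inv[OF that, of v] linear_vec2[OF lin, of "g y" "g' y v"] that gV unfolding H_def by auto
    from arg_cong[OF this, of "\<lambda>z. z$1"] arg_cong[OF this, of "\<lambda>z. z$2"]
    show "v$1 = g' y v $ 1 * H 1 (g y)$1 + g' y v $ 2 * H 2 (g y)$1"
      "v$2 = g' y v $ 1 * H 1 (g y)$2 + g' y v $ 2 * H 2 (g y)$2"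
      by simp_all
  qed
  have J: "J y \<noteq> 0" if y: "y \<in> D" for y
  proof -
    let ?u = "g' y (axis 1 1)" and ?v = "g' y (axis 2 1)"
    \<comment> \<open>Multiplicativity of the determinant for the product of the two Jacobian
      matrices; the vectors \<open>H 1\<close> and \<open>H 2\<close> are the columns of the
      Jacobian of \<open>h\<close>.\<close>
    have "J y * (?u$1 * ?v$2 - ?v$1 * ?u$2)
      = (?u$1 * H 1 (g y)$1 + ?u$2 * H 2 (g y)$1) * (?v$1 * H 1 (g y)$2 + ?v$2 * H 2 (g y)$2)
      - (?v$1 * H 1 (g y)$1 + ?v$2 * H 2 (g y)$1) * (?u$1 * H 1 (g y)$2 + ?u$2 * H 2 (g y)$2)"
      unfolding J_def by (simp add: algebra_simps)
    also have "\<dots> = 1"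
      unfolding eqs[OF y, symmetric] by (simp add: axis_def)
    finally have "J y * (?u$1 * ?v$2 - ?v$1 * ?u$2) = 1" .
    then show ?thesis by auto
  qed
  have g'eq: "g' y v = ((H 2 (g y)$2 * v$1 - H 2 (g y)$1 * v$2) * inverse (J y)) *\<^sub>R axis 1 1
      + ((H 1 (g y)$1 * v$2 - H 1 (g y)$2 * v$1) * inverse (J y)) *\<^sub>R axis 2 1" if y: "y \<in> D" for y v
  proof -
    have "H 2 (g y)$2 * v$1 - H 2 (g y)$1 * v$2 = J y * g' y v $ 1"
      "H 1 (g y)$1 * v$2 - H 1 (g y)$2 * v$1 = J y * g' y v $ 2"
      unfolding eqs[OF y, of v] J_def by (simp_all add: algebra_simps)
    then show ?thesis
      using J[OF y] by (subst vec2_expand) (simp add: field_simps)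
  qed
  have "Ck_on k D g" for k
  proof (induction k)
    case 0
    then show ?case
      using g by (auto intro!: continuous_at_imp_continuous_on has_derivative_continuous)
  next
    case (Suc k)
    have cH: "Ck_on k D (\<lambda>y. H i (g y))" for i
      unfolding H_def by (rule Ck_on_compose[OF D V gV Suc smooth_on_Ck[OF smooth_on_derivative[OF h]]])
    have cHn: "Ck_on k D (\<lambda>y. H i (g y) $ j)" for i j
      using Ck_on_nth[OF D cH] .
    have cJ: "Ck_on k D (\<lambda>y. inverse (J y))"
      by (rule Ck_on_inverse[OF D _ J]) (auto simp: J_def intro!: Ck_on_diff Ck_on_mult D cHn)
    show ?case
    proof (rule Ck_on_SucI[OF D g])
      fix v
      show "Ck_on k D (\<lambda>y. g' y v)"
        by (subst Ck_on_cong[OF D g'eq])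
          (auto intro!: Ck_on_add Ck_on_diff Ck_on_mult Ck_on_scaleR Ck_on_const D cHn cJ)
    qed
  qed
  then show ?thesis by (simp add: smooth_on_def)
qed

text \<open>The inverse function theorem wants the derivative as a continuous map into bounded
  operators, hence \<open>Blinfun\<close>. It gives a differentiable inverse, which
  \<open>smooth_on_inverse_2d\<close> then improves.\<close>

lemma inverse_function_2d:
  fixes h :: "real^2 \<Rightarrow> real^2"
  assumes V: "open V" and h: "smooth_on V h" and x: "x \<in> V"
    and J: "\<And>v. frechet_derivative h (at x) v = 0 \<Longrightarrow> v = 0"
  obtains U D g where "open U" "U \<subseteq> V" "x \<in> U" "open D" "h x \<in> D" "homeomorphism U D h g" "smooth_on D g"
proof -
  define h' where "h' x = Blinfun (frechet_derivative h (at x))" for x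
  have app: "blinfun_apply (h' y) = frechet_derivative h (at y)" if "y \<in> V" for y
    unfolding h'_def using smooth_on_has_derivative[OF h that]
    by (intro bounded_linear_Blinfun_apply) (rule has_derivative_bounded_linear)
  have d: "(h has_derivative blinfun_apply (h' y)) (at y)" if "y \<in> V" for y
    using smooth_on_has_derivative[OF h that] app[OF that] by simp
  have cont: "continuous_on V h'"
  proof (rule continuous_on_blinfun_componentwise)
    fix i :: "real^2"
    have "continuous_on V (\<lambda>x. frechet_derivative h (at x) i)"
      by (rule smooth_on_imp_continuous_on[OF smooth_on_derivative[OF h]])
    then show "continuous_on V (\<lambda>x. blinfun_apply (h' x) i)"
      using app by (simp cong: continuous_on_cong)
  qed
  have lin: "linear (frechet_derivative h (at x))"
    using smooth_on_has_derivative[OF h x] has_derivative_linear by blast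
  then have "inj (frechet_derivative h (at x))"
    using J by (simp add: linear_injective_0)
  then obtain L where L: "linear L" "L \<circ> frechet_derivative h (at x) = id"
    using linear_injective_left_inverse[OF lin] by auto
  have "Blinfun L o\<^sub>L h' x = id_blinfun"
  proof (rule blinfun_eqI)
    fix v
    have "blinfun_apply (Blinfun L) = L"
      using L(1) linear_conv_bounded_linear bounded_linear_Blinfun_apply by blast
    then show "blinfun_apply (Blinfun L o\<^sub>L h' x) v = blinfun_apply id_blinfun v"
      using L(2) app[OF x] by (simp add: fun_eq_iff)
  qed
  from inverse_function_theorem[OF V d cont x this] obtain U D g g' where
    U: "open U" "U \<subseteq> V" "x \<in> U" "open D" "h x \<in> D" "homeomorphism U D h g"
    and g: "\<And>y. y \<in> D \<Longrightarrow> (g has_derivative (g' y)) (at y)"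
    and g': "\<And>y. y \<in> D \<Longrightarrow> g' y = inv (blinfun_apply (h' (g y)))"
    and bij: "\<And>y. y \<in> D \<Longrightarrow> bij (blinfun_apply (h' (g y)))" by blast
  have gU: "g ` D \<subseteq> V" using U(2,6) by (auto simp: homeomorphism_def)
  have "smooth_on D g"
  proof (rule smooth_on_inverse_2d[OF V U(4) h gU g])
    fix y v assume "y \<in> D"
    then show "frechet_derivative h (at (g y)) (g' y v) = v"
      using g'[of y] bij[of y] app[of "g y"] gU by (auto simp: bij_is_surj surj_f_inv_f)
  qed
  then show ?thesis using U that by blast
qed

section \<open>Orthonormal frames and graph charts\<close>

definition frame :: "real^3 \<Rightarrow> real^3 \<Rightarrow> real^3 \<Rightarrow> bool"
  where "frame t1 t2 t3 \<longleftrightarrow> t1 \<bullet> t1 = 1 \<and> t2 \<bullet> t2 = 1 \<and> t1 \<bullet> t2 = 0 \<and> t3 = cross3 t1 t2"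

lemma frame_inner:
  assumes "frame t1 t2 t3"
  shows "t1 \<bullet> t1 = 1" "t2 \<bullet> t2 = 1" "t3 \<bullet> t3 = 1" "t1 \<bullet> t2 = 0" "t1 \<bullet> t3 = 0" "t2 \<bullet> t3 = 0"
    "t2 \<bullet> t1 = 0" "t3 \<bullet> t1 = 0" "t3 \<bullet> t2 = 0"
  using assms norm_cross_dot[of t1 t2]
  by (auto simp: frame_def dot_cross_self inner_commute norm_eq_sqrt_inner)

lemma frame_cross:
  assumes "frame t1 t2 t3"
  shows "cross3 t1 t2 = t3" "cross3 t1 t3 = - t2" "cross3 t3 t2 = - t1"
  using assms Lagrange[of t1 t1 t2] Lagrange[of t2 t1 t2] cross_skew[of "cross3 t1 t2" t2]
  by (auto simp: frame_def inner_commute)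

lemma frame_expand:
  assumes "frame t1 t2 t3"
  shows "p = (p \<bullet> t1) *\<^sub>R t1 + (p \<bullet> t2) *\<^sub>R t2 + (p \<bullet> t3) *\<^sub>R t3"
proof -
  define d where "d = p - ((p \<bullet> t1) *\<^sub>R t1 + (p \<bullet> t2) *\<^sub>R t2 + (p \<bullet> t3) *\<^sub>R t3)"
  have d: "d \<bullet> t1 = 0" "d \<bullet> t2 = 0" "d \<bullet> t3 = 0"
    unfolding d_def by (simp_all add: inner_diff_left inner_add_left frame_inner[OF assms])
  \<comment> \<open>The remainder \<open>d\<close> is orthogonal to t1 and t2, so Lagrange's formula
    kills its product with t3 = t1 x t2; being orthogonal to t3 as well, it has norm zero.\<close>
  have "cross3 d t3 = 0"
    using Lagrange[of d t1 t2] d assms by (simp add: frame_def)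
  then have "norm d = 0"
    using norm_cross_dot[of d t3] d frame_inner(3)[OF assms] by (auto simp: norm_eq_sqrt_inner[of t3])
  then show ?thesis unfolding d_def by simp
qed

definition pd :: "2 \<Rightarrow> (real^2 \<Rightarrow> real) \<Rightarrow> real^2 \<Rightarrow> real"
  where "pd i w y = frechet_derivative w (at y) (axis i 1)"

lemma pd_has_derivative:
  assumes "smooth_on D w" "y \<in> D"
  shows "(w has_derivative (\<lambda>v. v$1 * pd 1 w y + v$2 * pd 2 w y)) (at y)"
proof -
  have "(\<lambda>v. v$1 * pd 1 w y + v$2 * pd 2 w y) = frechet_derivative w (at y)"
  proof
    fix v show "v$1 * pd 1 w y + v$2 * pd 2 w y = frechet_derivative w (at y) v"
      using linear_vec2[OF has_derivative_linear[OF smooth_on_has_derivative[OF assms]], of v]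
      unfolding pd_def by simp
  qed
  then show ?thesis using smooth_on_has_derivative[OF assms] by simp
qed

lemma smooth_on_pd: "smooth_on D w \<Longrightarrow> smooth_on D (pd i w)"
  using smooth_on_derivative[of D w "axis i 1"] unfolding pd_def[abs_def] .

lemma pd_commute:
  assumes "open D" "smooth_on D w" "y \<in> D"
  shows "pd i (pd j w) y = pd j (pd i w) y"
  using second_derivative_symmetric[OF assms(1) smooth_on_Ck[OF assms(2)] assms(3)]
  unfolding pd_def[abs_def] .

lemma pd_cong:
  assumes "open D" "y \<in> D" "\<And>z. z \<in> D \<Longrightarrow> w z = w' z"
  shows "pd i w y = pd i w' y"
  unfolding pd_def using frechet_derivative_transform_open(1)[OF assms] by simp

lemma pd_eqI:
  assumes "(w has_derivative w') (at y)"
  shows "pd i w y = w' (axis i 1)"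
  unfolding pd_def using frechet_derivative_at[OF assms] by simp

text \<open>The parametrization goes into \<open>M\<close> and not into space: different sheets of
  the immersion may have the same image, and a chart has to remember on which sheet it lies.\<close>

definition graph_chart ::
  "real^3 \<Rightarrow> real^3 \<Rightarrow> real^3 \<Rightarrow> ('a::topological_space) set \<Rightarrow> ('a \<Rightarrow> real^3) \<Rightarrow> (real^2) set
     \<Rightarrow> (real^2 \<Rightarrow> 'a) \<Rightarrow> (real^2 \<Rightarrow> real) \<Rightarrow> bool"
  where
    "graph_chart t1 t2 t3 M X D f w \<longleftrightarrow>
       regular_param M X D f \<and> smooth_on D w \<and>
       (\<forall>y\<in>D. X (f y) = y$1 *\<^sub>R t1 + y$2 *\<^sub>R t2 + w y *\<^sub>R t3)"

lemma smooth_on_inner_const: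
  assumes "open S" "smooth_on S f"
  shows "smooth_on S (\<lambda>x. f x \<bullet> a)"
  using assms by (auto simp: smooth_on_def intro!: Ck_on_inner Ck_on_const)

text \<open>If the normal is not orthogonal to t3, the tangent plane projects isomorphically to the
  plane of t1 and t2. The projection \<open>h\<close> is then a local diffeomorphism, and
  reparametrizing by its inverse gives the graph.\<close>

lemma graph_chart_exists:
  assumes fr: "frame t1 t2 t3" and f: "regular_param M X V f" and x: "x \<in> V"
    and nz: "cross3 (partial 1 (X \<circ> f) x) (partial 2 (X \<circ> f) x) \<bullet> t3 \<noteq> 0"
  obtains y0 r F w where "r > 0" "graph_chart t1 t2 t3 M X (ball y0 r) F w" "F y0 = f x" "F ` ball y0 r \<subseteq> f ` V"
proof -
  define P where "P = X \<circ> f"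
  have V: "open V" and sP: "smooth_on V P" and opn: "openin (top_of_set M) (f ` V)"
    and inj: "\<And>q. q \<in> V \<Longrightarrow> inj (frechet_derivative P (at q))"
    using f unfolding regular_param_def P_def by auto
  obtain fi where fi: "homeomorphism V (f ` V) f fi" using f unfolding regular_param_def by auto
  define h where "h x = (P x \<bullet> t1) *\<^sub>R axis 1 1 + (P x \<bullet> t2) *\<^sub>R (axis 2 1 :: real^2)" for x
  have h1: "h z $ 1 = P z \<bullet> t1" and h2: "h z $ 2 = P z \<bullet> t2" for z
    unfolding h_def by (simp_all add: axis_def)
  have sh: "smooth_on V h"
    unfolding h_def smooth_on_def
    by (intro allI Ck_on_add Ck_on_scaleR Ck_on_inner Ck_on_const V smooth_on_Ck[OF sP])
  have dP: "(P has_derivative frechet_derivative P (at z)) (at z)" if "z \<in> V" for z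
    using smooth_on_has_derivative[OF sP that] .
  have dh: "frechet_derivative h (at z) v = (frechet_derivative P (at z) v \<bullet> t1) *\<^sub>R axis 1 1
      + (frechet_derivative P (at z) v \<bullet> t2) *\<^sub>R axis 2 1" if "z \<in> V" for z v
  proof -
    have "(h has_derivative (\<lambda>v. (frechet_derivative P (at z) v \<bullet> t1) *\<^sub>R axis 1 1
      + (frechet_derivative P (at z) v \<bullet> t2) *\<^sub>R axis 2 1)) (at z)"
      unfolding h_def[abs_def] by (auto intro!: derivative_eq_intros dP[OF that])
    from frechet_derivative_eqI[OF this] show ?thesis by simp
  qed
  \<comment> \<open>A tangent vector killed by the projection is a multiple of t3; being orthogonal
    to the normal, which is not orthogonal to t3, it vanishes, and so does \<open>v\<close> as
    \<open>X \<circ> f\<close> is an immersion.\<close>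
  have inj0: "v = 0" if v: "frechet_derivative h (at x) v = 0" for v
  proof -
    have lin: "linear (frechet_derivative P (at x))" using dP[OF x] has_derivative_linear by blast
    define Q where "Q = frechet_derivative P (at x) v"
    have "(\<forall>i. ((Q \<bullet> t1) *\<^sub>R axis 1 1 + (Q \<bullet> t2) *\<^sub>R (axis 2 1::real^2)) $ i = 0)"
      using v dh[OF x, of v] unfolding Q_def by simp
    then have "Q \<bullet> t1 = 0" "Q \<bullet> t2 = 0" by (simp_all add: forall_2 axis_def)
    then have Q: "Q = (Q \<bullet> t3) *\<^sub>R t3" using frame_expand[OF fr, of Q] by (metis add_0 scale_zero_left)
    have "Q = v$1 *\<^sub>R partial 1 P x + v$2 *\<^sub>R partial 2 P x"
      unfolding Q_def partial_def by (rule linear_vec2[OF lin])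
    then have "Q \<bullet> cross3 (partial 1 P x) (partial 2 P x) = 0"
      by (simp add: inner_add_left dot_cross_self)
    then have "(Q \<bullet> t3) * (cross3 (partial 1 P x) (partial 2 P x) \<bullet> t3) = 0"
      by (subst (asm) Q) (simp add: inner_commute)
    then have "Q \<bullet> t3 = 0" using nz unfolding P_def by simp
    then have "Q = 0" using Q by simp
    then show "v = 0" using inj[OF x] linear_injective_0[OF lin] unfolding Q_def by blast
  qed
  obtain U D g where U: "open U" "U \<subseteq> V" "x \<in> U" "open D" "h x \<in> D" "homeomorphism U D h g" "smooth_on D g"
    using inverse_function_2d[OF V sh x inj0] by blast
  obtain r where r: "r > 0" "ball (h x) r \<subseteq> D" using U(4,5) openE by blast
  define B where "B = ball (h x) r"
  have B: "open B" "B \<subseteq> D" "h x \<in> B" using r unfolding B_def by auto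
  have hg: "h (g y) = y" if "y \<in> D" for y using U(6) that by (auto simp: homeomorphism_def)
  have gU: "g y \<in> U" if "y \<in> D" for y using U(6) that by (auto simp: homeomorphism_def)
  have gh: "g (h z) = z" if "z \<in> U" for z using U(6) that by (auto simp: homeomorphism_def)
  define F where "F = f \<circ> g"
  define w where "w y = P (g y) \<bullet> t3" for y
  have sPg: "smooth_on B (\<lambda>y. P (g y))"
    by (rule smooth_on_compose[OF B(1) V _ smooth_on_subset[OF U(7) B(2)] sP]) (use gU U(2) B(2) in auto)
  have sw: "smooth_on B w" unfolding w_def by (rule smooth_on_inner_const[OF B(1) sPg])
  have XF: "X (F y) = y$1 *\<^sub>R t1 + y$2 *\<^sub>R t2 + w y *\<^sub>R t3" if "y \<in> B" for y
  proof -
    have "P (g y) \<bullet> t1 = y$1" "P (g y) \<bullet> t2 = y$2" using h1[of "g y"] h2[of "g y"] hg[of y] that B(2) by auto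
    then show ?thesis using frame_expand[OF fr, of "P (g y)"] unfolding F_def w_def P_def by simp
  qed
  have reg: "regular_param M X B F"
    unfolding regular_param_def
  proof (intro conjI ballI)
    show "open B" by fact
    have ogB: "open (g ` B)"
    proof -
      have "openin (top_of_set U) (g ` B)"
        using homeomorphism_imp_open_map[OF homeomorphism_symD[OF U(6)], of B] B(1,2)
        by (simp add: openin_open_eq U(4))
      then show ?thesis using U(1) openin_open_trans by blast
    qed
    have gBV: "g ` B \<subseteq> V" using gU B(2) U(2) by auto
    have "openin (top_of_set (f ` V)) (f ` (g ` B))"
      using homeomorphism_imp_open_map[OF fi, of "g ` B"] ogB gBV by (simp add: openin_open_eq V)
    then show "openin (top_of_set M) (F ` B)"
      using openin_trans[OF _ opn] unfolding F_def by (simp add: image_comp)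
    have hB: "homeomorphism B (g ` B) g h"
      by (rule homeomorphism_of_subsets[OF homeomorphism_symD[OF U(6)] B(2) _ refl]) (use gU B(2) in auto)
    have "homeomorphism (g ` B) (f ` (g ` B)) f fi"
      by (rule homeomorphism_of_subsets[OF fi gBV _ refl]) (use gBV in auto)
    then show "\<exists>g. homeomorphism B (F ` B) F g"
      using homeomorphism_compose[OF hB] unfolding F_def by (metis image_comp)
    show "smooth_on B (X \<circ> F)" using sPg unfolding P_def F_def by (simp add: o_def)
    fix y assume y: "y \<in> B"
    have dF: "((X \<circ> F) has_derivative frechet_derivative (X \<circ> F) (at y)) (at y)"
      using smooth_on_has_derivative[OF \<open>smooth_on B (X \<circ> F)\<close> y] .
    have lin: "linear (frechet_derivative (X \<circ> F) (at y))" using dF has_derivative_linear by blast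
    \<comment> \<open>The t1 and t2 components of a graph are its parameters, so their derivatives
      return the direction itself; this alone makes the reparametrization an immersion.\<close>
    have comp: "frechet_derivative (X \<circ> F) (at y) v \<bullet> t = v $ i"
      if "\<And>y. y \<in> B \<Longrightarrow> X (F y) \<bullet> t = y $ i" for t i v
    proof -
      have 1: "((\<lambda>y. (X \<circ> F) y \<bullet> t) has_derivative (\<lambda>v. frechet_derivative (X \<circ> F) (at y) v \<bullet> t)) (at y)"
        by (rule has_derivative_inner_left[OF dF])
      have "((\<lambda>y. y $ i) has_derivative (\<lambda>v. v $ i)) (at y)"
        by (intro bounded_linear_imp_has_derivative bounded_linear_vec_nth)
      then have "((\<lambda>y. (X \<circ> F) y \<bullet> t) has_derivative (\<lambda>v. v $ i)) (at y)"
        by (rule has_derivative_transform_within_open[OF _ B(1) y]) (use that in simp)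
      from has_derivative_unique[OF 1 this] show ?thesis by meson
    qed
    have c1: "frechet_derivative (X \<circ> F) (at y) v \<bullet> t1 = v $ 1" for v
      by (rule comp) (simp add: XF inner_add_left frame_inner[OF fr])
    have c2: "frechet_derivative (X \<circ> F) (at y) v \<bullet> t2 = v $ 2" for v
      by (rule comp) (simp add: XF inner_add_left frame_inner[OF fr])
    show "inj (frechet_derivative (X \<circ> F) (at y))"
      unfolding linear_injective_0[OF lin]
    proof (intro allI impI)
      fix v assume v: "frechet_derivative (X \<circ> F) (at y) v = 0"
      then have "v $ 1 = 0" "v $ 2 = 0" using c1[of v] c2[of v] by simp_all
      then show "v = 0" by (simp add: vec_eq_iff forall_2)
    qed
  qed
  have "graph_chart t1 t2 t3 M X B F w" unfolding graph_chart_def using reg sw XF by auto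
  moreover have "F (h x) = f x" unfolding F_def using gh[OF U(3)] by simp
  moreover have "F ` B \<subseteq> f ` V" using gU B(2) U(2) unfolding F_def by auto
  ultimately show ?thesis using that[OF r(1)] unfolding B_def by blast
qed

section \<open>Flatness and minimality as equations for a graph\<close>

lemma matrix_inv_eqI:
  assumes "A ** B = mat 1" "B ** A = mat 1"
  shows "matrix_inv A = (B :: real^'n^'n)"
proof -
  have "A ** matrix_inv A = mat 1 \<and> matrix_inv A ** A = mat 1"
    unfolding matrix_inv_def by (rule someI[of _ B]) (use assms in auto)
  then show ?thesis
    by (metis assms(2) matrix_mul_assoc matrix_mul_lid matrix_mul_rid)
qed

lemma graph_chart_partial:
  assumes gc: "graph_chart t1 t2 t3 M X D f w" and y: "y \<in> D"
  shows "partial 1 (X \<circ> f) y = t1 + pd 1 w y *\<^sub>R t3" "partial 2 (X \<circ> f) y = t2 + pd 2 w y *\<^sub>R t3"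
    "partial j (partial i (X \<circ> f)) y = pd j (pd i w) y *\<^sub>R t3"
proof -
  have D: "open D" and sw: "smooth_on D w" and XF: "\<And>y. y \<in> D \<Longrightarrow> X (f y) = y$1 *\<^sub>R t1 + y$2 *\<^sub>R t2 + w y *\<^sub>R t3"
    using gc unfolding graph_chart_def regular_param_def by auto
  have par: "partial i (X \<circ> f) y = (if i = 1 then t1 else t2) + pd i w y *\<^sub>R t3" if y: "y \<in> D" for i y
  proof -
    have dw: "(w has_derivative frechet_derivative w (at y)) (at y)"
      using smooth_on_has_derivative[OF sw y] .
    have n: "((\<lambda>y. y $ i) has_derivative (\<lambda>v. v $ i)) (at y)" for i :: 2
      by (intro bounded_linear_imp_has_derivative bounded_linear_vec_nth)
    have "((\<lambda>y. y$1 *\<^sub>R t1 + y$2 *\<^sub>R t2 + w y *\<^sub>R t3) has_derivative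
      (\<lambda>v. v$1 *\<^sub>R t1 + v$2 *\<^sub>R t2 + frechet_derivative w (at y) v *\<^sub>R t3)) (at y)"
      by (auto intro!: derivative_eq_intros dw n)
    then have "((X \<circ> f) has_derivative (\<lambda>v. v$1 *\<^sub>R t1 + v$2 *\<^sub>R t2 + frechet_derivative w (at y) v *\<^sub>R t3)) (at y)"
      by (rule has_derivative_transform_within_open[OF _ D y]) (simp add: XF)
    from frechet_derivative_eqI[OF this] show ?thesis
      using exhaust_2[of i] unfolding partial_def pd_def by (auto simp: axis_def)
  qed
  show "partial 1 (X \<circ> f) y = t1 + pd 1 w y *\<^sub>R t3" "partial 2 (X \<circ> f) y = t2 + pd 2 w y *\<^sub>R t3"
    using par[OF y, of 1] par[OF y, of 2] by auto
  have "((\<lambda>y. (if i = 1 then t1 else t2) + pd i w y *\<^sub>R t3) has_derivative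
     (\<lambda>v. frechet_derivative (pd i w) (at y) v *\<^sub>R t3)) (at y)"
    by (auto intro!: derivative_eq_intros smooth_on_has_derivative[OF smooth_on_pd[OF sw] y])
  then have "(partial i (X \<circ> f) has_derivative (\<lambda>v. frechet_derivative (pd i w) (at y) v *\<^sub>R t3)) (at y)"
    by (rule has_derivative_transform_within_open[OF _ D y]) (simp add: par)
  from frechet_derivative_eqI[OF this] show "partial j (partial i (X \<circ> f)) y = pd j (pd i w) y *\<^sub>R t3"
    unfolding partial_def[of j] pd_def[of j] by simp
qed

text \<open>With W2 = 1 + p^2 + q^2 the first fundamental form has determinant W2 and the unit
  normal is \<nu> / sqrt W2. The frame is arbitrary, since vertical planes have to be graphs too;
  the inner product of e3 with \<nu> therefore remains on the right-hand side.\<close>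

lemma graph_chart_pde:
  assumes fr: "frame t1 t2 t3" and gc: "graph_chart t1 t2 t3 M X D f w" and y: "y \<in> D"
    and flat: "flat_surface M X" and mini: "phi_minimal \<phi> M X"
  defines "p \<equiv> pd 1 w y" and "q \<equiv> pd 2 w y"
  shows "pd 1 (pd 1 w) y * pd 2 (pd 2 w) y = (pd 1 (pd 2 w) y)\<^sup>2"
    and "(1 + q\<^sup>2) * pd 1 (pd 1 w) y - 2 * p * q * pd 1 (pd 2 w) y + (1 + p\<^sup>2) * pd 2 (pd 2 w) y
      = deriv \<phi> (X (f y) $ 3) * (e3 \<bullet> (t3 - p *\<^sub>R t1 - q *\<^sub>R t2)) * (1 + p\<^sup>2 + q\<^sup>2)"
proof -
  have D: "open D" and sw: "smooth_on D w" and reg: "regular_param M X D f"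
    using gc unfolding graph_chart_def regular_param_def by auto
  note fi = frame_inner[OF fr] and fc = frame_cross[OF fr]
  define \<nu> where "\<nu> = t3 - p *\<^sub>R t1 - q *\<^sub>R t2"
  define A where "A = pd 1 (pd 1 w) y"
  define B where "B = pd 1 (pd 2 w) y"
  define C where "C = pd 2 (pd 2 w) y"
  define W2 where "W2 = 1 + p\<^sup>2 + q\<^sup>2"
  have W2: "W2 > 0" unfolding W2_def by (simp add: add_pos_nonneg)
  have BB: "pd 2 (pd 1 w) y = B" unfolding B_def using pd_commute[OF D sw y] by metis
  note par = graph_chart_partial[OF gc y, folded p_def q_def]
  have cr: "cross3 (partial 1 (X \<circ> f) y) (partial 2 (X \<circ> f) y) = \<nu>"
    unfolding par \<nu>_def
    by (simp add: cross_add_left cross_add_right cross_mult_left cross_mult_right fc)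
  have nn: "\<nu> \<bullet> \<nu> = W2" unfolding \<nu>_def W2_def
    by (simp add: inner_diff_left inner_diff_right fi power2_eq_square)
  define n where "n = unit_normal (X \<circ> f) y"
  have n: "n = (1 / sqrt W2) *\<^sub>R \<nu>"
    unfolding n_def unit_normal_def cr sgn_div_norm by (simp add: norm_eq_sqrt_inner nn inverse_eq_divide)
  have n1: "n \<bullet> n = 1" unfolding n using nn W2 by simp
  have t3n: "t3 \<bullet> n = 1 / sqrt W2" unfolding n \<nu>_def by (simp add: inner_diff_right fi)
  define I where "I = first_ff (X \<circ> f) y"
  have I: "I $ 1 $ 1 = 1 + p\<^sup>2" "I $ 1 $ 2 = p * q" "I $ 2 $ 1 = p * q" "I $ 2 $ 2 = 1 + q\<^sup>2"
    unfolding I_def first_ff_def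
    by (simp_all add: par inner_add_left inner_add_right fi power2_eq_square)
  have detI: "det I = W2" unfolding det_2 I W2_def by (simp add: power2_eq_square algebra_simps)
  \<comment> \<open>The adjugate of the first fundamental form divided by its determinant
    W2.\<close>
  define K where "K = (vector [vector [(1 + q\<^sup>2) / W2, - p * q / W2], vector [- p * q / W2, (1 + p\<^sup>2) / W2]] :: real^2^2)"
  have K: "K $ 1 $ 1 = (1 + q\<^sup>2) / W2" "K $ 1 $ 2 = - p * q / W2" "K $ 2 $ 1 = - p * q / W2" "K $ 2 $ 2 = (1 + p\<^sup>2) / W2"
    unfolding K_def by simp_all
  have id1: "(1 + p\<^sup>2) * (1 + q\<^sup>2) = W2 + p * q * (p * q)"
    unfolding W2_def by (simp add: algebra_simps power2_eq_square)
  have e: "(1 + p\<^sup>2) * ((1 + q\<^sup>2) / W2) + p * q * (- p * q / W2) = 1"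
    "p * q * (- p * q / W2) + (1 + q\<^sup>2) * ((1 + p\<^sup>2) / W2) = 1"
    "(1 + q\<^sup>2) / W2 * (1 + p\<^sup>2) + - p * q / W2 * (p * q) = 1"
    "- p * q / W2 * (p * q) + (1 + p\<^sup>2) / W2 * (1 + q\<^sup>2) = 1"
    "(1 + p\<^sup>2) * (- p * q / W2) + p * q * ((1 + p\<^sup>2) / W2) = 0"
    "p * q * ((1 + q\<^sup>2) / W2) + (1 + q\<^sup>2) * (- p * q / W2) = 0"
    "(1 + q\<^sup>2) / W2 * (p * q) + - p * q / W2 * (1 + q\<^sup>2) = 0"
    "- p * q / W2 * (1 + p\<^sup>2) + (1 + p\<^sup>2) / W2 * (p * q) = 0"
  proof -
    have *: "((1 + p\<^sup>2) * (1 + q\<^sup>2) - p * q * (p * q)) / W2 = 1" using id1 W2 by simp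
    show "(1 + p\<^sup>2) * ((1 + q\<^sup>2) / W2) + p * q * (- p * q / W2) = 1"
      "p * q * (- p * q / W2) + (1 + q\<^sup>2) * ((1 + p\<^sup>2) / W2) = 1"
      "(1 + q\<^sup>2) / W2 * (1 + p\<^sup>2) + - p * q / W2 * (p * q) = 1"
      "- p * q / W2 * (p * q) + (1 + p\<^sup>2) / W2 * (1 + q\<^sup>2) = 1"
      by (subst *[symmetric], simp add: divide_inverse algebra_simps)+
  qed (simp_all add: divide_inverse algebra_simps)
  have "I ** K = mat 1" "K ** I = mat 1"
    unfolding vec_eq_iff forall_2 matrix_matrix_mult_def mat_def using e by (simp_all add: sum_2 I K)
  then have inv: "matrix_inv I = K" by (rule matrix_inv_eqI)
  have vff: "vector_second_ff (X \<circ> f) y i j = (pd j (pd i w) y / sqrt W2) *\<^sub>R n" for i j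
    unfolding vector_second_ff_def normal_part_def par n_def[symmetric] by (simp add: t3n)
  have H: "mean_curvature_vector (X \<circ> f) y = (((1 + q\<^sup>2) * A - 2 * p * q * B + (1 + p\<^sup>2) * C) / W2 / sqrt W2) *\<^sub>R n"
    unfolding mean_curvature_vector_def I_def[symmetric] inv vff
    by (simp add: sum_2 K A_def[symmetric] C_def[symmetric] BB B_def[symmetric] divide_inverse algebra_simps
        flip: scaleR_add_left scaleR_diff_left)
  have "mean_curvature_vector (X \<circ> f) y = deriv \<phi> (X (f y) $ 3) *\<^sub>R normal_part (X \<circ> f) y e3"
    using mini reg y unfolding phi_minimal_def by blast
  \<comment> \<open>Both sides are multiples of the unit normal, so pairing with \<open>n\<close>
    loses nothing. The same factor 1 / sqrt W2 then occurs on both sides and cancels.\<close>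
  then have "mean_curvature_vector (X \<circ> f) y \<bullet> n = deriv \<phi> (X (f y) $ 3) * (e3 \<bullet> n)"
    unfolding normal_part_def n_def[symmetric] by (simp add: n1)
  moreover have "e3 \<bullet> n = (e3 \<bullet> \<nu>) / sqrt W2" unfolding n by simp
  ultimately have "((1 + q\<^sup>2) * A - 2 * p * q * B + (1 + p\<^sup>2) * C) / W2 / sqrt W2 = deriv \<phi> (X (f y) $ 3) * ((e3 \<bullet> \<nu>) / sqrt W2)"
    unfolding H by (simp add: n1)
  then have "((1 + q\<^sup>2) * A - 2 * p * q * B + (1 + p\<^sup>2) * C) / W2 = deriv \<phi> (X (f y) $ 3) * (e3 \<bullet> \<nu>)"
    unfolding times_divide_eq_right divide_cancel_right using W2 by auto
  then have "(1 + q\<^sup>2) * A - 2 * p * q * B + (1 + p\<^sup>2) * C = deriv \<phi> (X (f y) $ 3) * (e3 \<bullet> \<nu>) * W2"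
    using W2 by (simp add: field_simps)
  then show "(1 + q\<^sup>2) * pd 1 (pd 1 w) y - 2 * p * q * pd 1 (pd 2 w) y + (1 + p\<^sup>2) * pd 2 (pd 2 w) y
      = deriv \<phi> (X (f y) $ 3) * (e3 \<bullet> (t3 - p *\<^sub>R t1 - q *\<^sub>R t2)) * (1 + p\<^sup>2 + q\<^sup>2)"
    unfolding A_def B_def C_def \<nu>_def W2_def .
  have "gauss_curvature (X \<circ> f) y = 0" using flat reg y unfolding flat_surface_def by blast
  then have "det (second_ff (X \<circ> f) y) = 0"
    unfolding gauss_curvature_def I_def[symmetric] detI using W2 by simp
  moreover have "second_ff (X \<circ> f) y $ i $ j = pd j (pd i w) y / sqrt W2" for i j
    unfolding second_ff_def by (simp add: par n_def[symmetric] t3n)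
  ultimately have "A / sqrt W2 * (C / sqrt W2) = B / sqrt W2 * (B / sqrt W2)"
    unfolding det_2 A_def[symmetric] by (simp add: BB A_def B_def C_def)
  then have "A * C = B * B" using W2 by (simp add: field_simps)
  then show "pd 1 (pd 1 w) y * pd 2 (pd 2 w) y = (pd 1 (pd 2 w) y)\<^sup>2"
    unfolding A_def B_def C_def by (simp add: power2_eq_square)
qed

section \<open>Lengths of curves and the topology of the surface\<close>

definition surface_curve ::
  "('a::topological_space) set \<Rightarrow> ('a \<Rightarrow> real^3) \<Rightarrow> 'a \<Rightarrow> 'a \<Rightarrow> (real \<Rightarrow> 'a) \<Rightarrow> real \<Rightarrow> bool"
  where
    "surface_curve M X p q \<gamma> L \<longleftrightarrow>
       path \<gamma> \<and> path_image \<gamma> \<subseteq> M \<and> pathstart \<gamma> = p \<and> pathfinish \<gamma> = q \<and> valid_path (X \<circ> \<gamma>) \<and>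
       ((\<lambda>t. norm (vector_derivative (X \<circ> \<gamma>) (at t))) has_integral L) {0..1}"

lemma surface_dist_eq: "surface_dist M X p q = Inf {L. \<exists>\<gamma>. surface_curve M X p q \<gamma> L}"
  unfolding surface_dist_def surface_curve_def ..

lemma surface_curve_nonneg: "surface_curve M X p q \<gamma> L \<Longrightarrow> 0 \<le> L"
  unfolding surface_curve_def by (metis has_integral_nonneg norm_ge_zero)

lemma surface_dist_le:
  assumes "surface_curve M X p q \<gamma> L"
  shows "surface_dist M X p q \<le> L"
  unfolding surface_dist_eq
  by (rule cInf_lower) (use assms in \<open>auto simp: bdd_below_def intro: surface_curve_nonneg\<close>)

lemma valid_path_derivative:
  assumes "valid_path g"
  obtains S where "finite S" "\<And>t. t \<in> {0..1} - S \<Longrightarrow> (g has_vector_derivative vector_derivative g (at t)) (at t)"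
  using assms unfolding valid_path_def piecewise_C1_differentiable_on_def C1_differentiable_on_eq
  by (metis vector_derivative_works)

text \<open>The derivative may be unbounded near the exceptional parameters, so the fundamental
  theorem is used in the form that asks only for continuity and for a derivative off a finite set;
  integrability of the speed is part of the hypothesis on \<open>L\<close>.\<close>

lemma displacement_le_length:
  fixes g :: "real \<Rightarrow> 'a::euclidean_space"
  assumes "valid_path g" "((\<lambda>t. norm (vector_derivative g (at t))) has_integral L) {0..1}" "t \<in> {0..1}"
  shows "norm (g 1 - g t) \<le> L"
proof -
  obtain S where S: "finite S" "\<And>t. t \<in> {0..1} - S \<Longrightarrow> (g has_vector_derivative vector_derivative g (at t)) (at t)"
    using valid_path_derivative[OF assms(1)] by blast
  have cont: "continuous_on {0..1} g"
    using assms(1) unfolding valid_path_def piecewise_C1_differentiable_on_def by auto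
  have FTC: "((\<lambda>t. vector_derivative g (at t)) has_integral (g 1 - g t)) {t..1}"
    by (rule fundamental_theorem_of_calculus_interior_strong[OF S(1)])
      (use assms(3) S(2) in \<open>auto intro: continuous_on_subset[OF cont]\<close>)
  have int: "(\<lambda>t. norm (vector_derivative g (at t))) integrable_on {t..1}"
    using integrable_on_subinterval[OF has_integral_integrable[OF assms(2)], of t 1] assms(3) by auto
  have "norm (integral {t..1} (\<lambda>t. vector_derivative g (at t))) \<le> integral {t..1} (\<lambda>t. norm (vector_derivative g (at t)))"
    by (rule Henstock_Kurzweil_Integration.integral_norm_bound_integral) (use FTC int in auto)
  also have "\<dots> \<le> integral {0..1} (\<lambda>t. norm (vector_derivative g (at t)))"
    by (rule integral_subset_le) (use assms(2,3) int in auto)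
  also have "\<dots> = L" using assms(2) by (rule integral_unique)
  finally show ?thesis using integral_unique[OF FTC] by simp
qed

text \<open>The values d = 0 and d = 1 give the first and the second half of a joined path.\<close>

lemma length_rescale:
  fixes g h :: "real \<Rightarrow> 'a::euclidean_space"
  assumes g: "valid_path g" and int: "((\<lambda>t. norm (vector_derivative g (at t))) has_integral i) {0..1}"
    and h: "\<And>t. t \<in> {d/2<..<(d + 1)/2} \<Longrightarrow> h t = g (2 * t - d)"
  shows "((\<lambda>t. norm (vector_derivative h (at t))) has_integral i) {d/2..(d + 1)/2}"
proof -
  obtain S where S: "finite S" "\<And>t. t \<in> {0..1} - S \<Longrightarrow> (g has_vector_derivative vector_derivative g (at t)) (at t)"
    using valid_path_derivative[OF g] by blast
  have ivl: "cbox ((0 - - d) /\<^sub>R 2) ((1 - - d) /\<^sub>R 2) = {d/2..(d + 1)/2}" by (simp add: field_simps)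
  have "((\<lambda>t. norm (vector_derivative g (at (2 *\<^sub>R t + - d)))) has_integral i /\<^sub>R 2 ^ DIM(real)) {d/2..(d + 1)/2}"
    unfolding ivl[symmetric] by (rule has_integral_affinity') (use int in simp_all)
  moreover have "i /\<^sub>R 2 ^ DIM(real) = i / 2" by simp
  ultimately have "((\<lambda>t. norm (vector_derivative g (at (2 * t - d)))) has_integral i / 2) {d/2..(d + 1)/2}"
    by simp
  from has_integral_mult_right[OF this, of 2]
  have scaled: "((\<lambda>t. 2 * norm (vector_derivative g (at (2 * t - d)))) has_integral i) {d/2..(d + 1)/2}"
    by simp
  \<comment> \<open>Off \<open>E\<close> the chain rule is valid: the end points go because
    \<open>h\<close> is known only in the open interval, the preimages of \<open>S\<close> because
    \<open>g\<close> need not be differentiable there.\<close>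
  define E where "E = {d/2, (d + 1)/2} \<union> (\<lambda>t. 2 * t - d) -` S"
  have "finite E"
    unfolding E_def using finite_vimageI[OF S(1), of "\<lambda>t. 2 * t - d"] by (simp add: inj_on_def)
  moreover have "norm (vector_derivative h (at t)) = 2 * norm (vector_derivative g (at (2 * t - d)))"
    if t: "t \<in> {d/2..(d + 1)/2} - E" for t
  proof -
    have t': "t \<in> {d/2<..<(d + 1)/2}" "2 * t - d \<in> {0..1} - S" using t unfolding E_def by (auto simp: field_simps)
    have "((\<lambda>t. 2 * t - d) has_vector_derivative 2) (at t)" by (auto intro!: derivative_eq_intros)
    from vector_diff_chain_at[OF this S(2)[OF t'(2)]]
    have "(h has_vector_derivative 2 *\<^sub>R vector_derivative g (at (2 * t - d))) (at t)"
      by (rule has_vector_derivative_transform_within_open[OF _ open_greaterThanLessThan t'(1)]) (simp add: h)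
    then show ?thesis by (simp add: vector_derivative_at)
  qed
  ultimately show ?thesis by (rule has_integral_spike_finite[OF _ _ scaled])
qed

lemma length_join:
  fixes g1 g2 :: "real \<Rightarrow> 'a::euclidean_space"
  assumes "valid_path g1" "valid_path g2"
    and "((\<lambda>t. norm (vector_derivative g1 (at t))) has_integral i1) {0..1}"
    and "((\<lambda>t. norm (vector_derivative g2 (at t))) has_integral i2) {0..1}"
  shows "((\<lambda>t. norm (vector_derivative (g1 +++ g2) (at t))) has_integral (i1 + i2)) {0..1}"
proof (rule has_integral_combine)
  show "((\<lambda>t. norm (vector_derivative (g1 +++ g2) (at t))) has_integral i1) {0..1/2}"
    using length_rescale[OF assms(1,3), of 0 "g1 +++ g2"] by (simp add: joinpaths_def)
  show "((\<lambda>t. norm (vector_derivative (g1 +++ g2) (at t))) has_integral i2) {1/2..1}"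
    using length_rescale[OF assms(2,4), of 1 "g1 +++ g2"] by (simp add: joinpaths_def)
qed auto

lemma surface_curve_join:
  assumes "surface_curve M X p q \<gamma> L" "surface_curve M X q r \<delta> K"
  shows "surface_curve M X p r (\<gamma> +++ \<delta>) (L + K)"
proof -
  have e: "X \<circ> (\<gamma> +++ \<delta>) = (X \<circ> \<gamma>) +++ (X \<circ> \<delta>)" by (rule path_compose_join)
  show ?thesis
    using assms unfolding surface_curve_def e
    by (auto intro!: length_join valid_path_join path_image_subset_reversepath
        simp: path_image_join pathstart_compose pathfinish_compose)
qed

lemma affine_closed_segment:
  "0 \<le> t \<Longrightarrow> t \<le> 1 \<Longrightarrow> a + (b - a) * t \<in> closed_segment a (b::real)"
  unfolding closed_segment_def by (auto intro!: exI[of _ t] simp: algebra_simps)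

text \<open>A lift to \<open>M\<close> of a curve in space is admissible for the surface distance as
  soon as the curve below is C1, and speed bounds below become length bounds above. The segment may
  run backwards, so that \<open>a\<close> and \<open>b\<close> need not be ordered.\<close>

lemma surface_curve_of_lift:
  fixes l :: "real \<Rightarrow> 'a::topological_space"
  assumes l: "continuous_on (closed_segment a b) l" "\<And>t. t \<in> closed_segment a b \<Longrightarrow> l t \<in> M \<and> X (l t) = c t"
    and c: "\<And>t. t \<in> closed_segment a b \<Longrightarrow> (c has_vector_derivative c' t) (at t)"
    and c': "continuous_on (closed_segment a b) c'"
    and K: "\<And>t. t \<in> closed_segment a b \<Longrightarrow> norm (c' t) \<le> K"
  obtains \<gamma> L where "surface_curve M X (l a) (l b) \<gamma> L" "L \<le> K * \<bar>b - a\<bar>"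
proof -
  define s where "s t = a + (b - a) * t" for t
  have seg: "s t \<in> closed_segment a b" if "t \<in> {0..1}" for t
    unfolding s_def using that by (auto intro: affine_closed_segment)
  have conts: "continuous_on {0..1} s" unfolding s_def by (intro continuous_intros)
  define \<gamma> where "\<gamma> = l \<circ> s"
  define d where "d t = (b - a) *\<^sub>R c' (s t)" for t
  have p: "path \<gamma>" unfolding path_def \<gamma>_def
    using continuous_on_compose[OF conts] continuous_on_subset[OF l(1)] seg by (metis image_subsetI)
  have XG: "(X \<circ> \<gamma>) t = c (s t)" if "t \<in> {0..1}" for t
    using l(2) seg[OF that] unfolding \<gamma>_def by simp
  have cd: "continuous_on {0..1} d"
    unfolding d_def by (intro continuous_intros continuous_on_compose2[OF c' conts]) (use seg in auto)
  have vds: "((\<lambda>t. c (s t)) has_vector_derivative d t) (at t)" if "t \<in> {0..1}" for t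
  proof -
    have "(s has_vector_derivative (b - a)) (at t)"
      unfolding s_def by (auto intro!: derivative_eq_intros)
    then show ?thesis
      using vector_diff_chain_at[of s "b - a" t c "c' (s t)"] c[OF seg[OF that]] by (simp add: d_def o_def)
  qed
  have vd: "((X \<circ> \<gamma>) has_vector_derivative d t) (at t)" if "t \<in> {0<..<1}" for t
    by (rule has_vector_derivative_transform_within_open[OF vds, of t "{0<..<1}"]) (use that XG in auto)
  have cX: "continuous_on {0..1} (X \<circ> \<gamma>)"
  proof -
    have "continuous_on {0..1} (\<lambda>t. c (s t))"
      using vds has_vector_derivative_continuous by (fastforce intro: continuous_at_imp_continuous_on)
    then show ?thesis by (rule continuous_on_eq) (use XG in auto)
  qed
  have vp: "valid_path (X \<circ> \<gamma>)"
    unfolding valid_path_def piecewise_C1_differentiable_on_def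
  \<comment> \<open>The end points are exceptional because \<open>X \<circ> \<gamma>\<close> is
    known to agree with the smooth curve on the unit interval only, which says nothing about
    two-sided derivatives there.\<close>
  proof (intro conjI exI[of _ "{0,1}"] cX)
    show "X \<circ> \<gamma> C1_differentiable_on {0..1} - {0, 1}"
      unfolding C1_differentiable_on_def
      by (intro exI[of _ d] conjI ballI vd continuous_on_subset[OF cd]) auto
  qed simp
  define L where "L = integral {0..1} (\<lambda>t. norm (d t))"
  have int: "((\<lambda>t. norm (d t)) has_integral L) {0..1}"
    unfolding L_def using integrable_continuous_real[OF continuous_on_norm[OF cd]] by (rule integrable_integral)
  have "((\<lambda>t. norm (vector_derivative (X \<circ> \<gamma>) (at t))) has_integral L) {0..1}"
    by (rule has_integral_spike_finite[OF _ _ int, of "{0,1}"]) (use vector_derivative_at[OF vd] in auto)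
  moreover have "path_image \<gamma> \<subseteq> M" using l(2) seg unfolding path_image_def \<gamma>_def by auto
  moreover have "pathstart \<gamma> = l a" "pathfinish \<gamma> = l b" unfolding pathstart_def pathfinish_def \<gamma>_def s_def by auto
  ultimately have "surface_curve M X (l a) (l b) \<gamma> L" unfolding surface_curve_def using p vp by auto
  moreover have "L \<le> K * \<bar>b - a\<bar>"
  proof -
    have "((\<lambda>t. K * \<bar>b - a\<bar>) has_integral K * \<bar>b - a\<bar>) {0..1::real}"
      using has_integral_const_real[of "K * \<bar>b - a\<bar>" 0 1] by simp
    then show ?thesis
      by (rule has_integral_le[OF int])
        (use K seg in \<open>auto simp: d_def mult.commute[of K] intro!: mult_left_mono\<close>)
  qed
  ultimately show ?thesis by (rule that)
qed

section \<open>Frame coordinates and charts at a given point\<close>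

definition coords :: "real^3 \<Rightarrow> real^3 \<Rightarrow> real^3 \<Rightarrow> real^2"
  where "coords t1 t2 p = (p \<bullet> t1) *\<^sub>R axis 1 1 + (p \<bullet> t2) *\<^sub>R axis 2 1"

lemma coords_nth [simp]: "coords t1 t2 p $ 1 = p \<bullet> t1" "coords t1 t2 p $ 2 = p \<bullet> t2"
  unfolding coords_def by (simp_all add: axis_def)

lemma coords_eqI: "p \<bullet> t1 = y $ 1 \<Longrightarrow> p \<bullet> t2 = y $ 2 \<Longrightarrow> coords t1 t2 p = y"
  by (simp add: vec_eq_iff forall_2)

lemma bounded_linear_coords: "bounded_linear (coords t1 t2)"
  unfolding coords_def[abs_def]
  by (intro bounded_linear_add bounded_linear_scaleR_const bounded_linear_inner_left)

lemma coords_diff: "coords t1 t2 p - coords t1 t2 q = coords t1 t2 (p - q)"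
  by (simp add: vec_eq_iff forall_2 inner_diff_left)

lemma norm_coords_le:
  assumes "frame t1 t2 t3"
  shows "norm (coords t1 t2 p) \<le> norm p"
proof -
  have "(norm p)\<^sup>2 = (p \<bullet> t1)\<^sup>2 + (p \<bullet> t2)\<^sup>2 + (p \<bullet> t3)\<^sup>2"
    unfolding power2_norm_eq_inner
    apply (subst (1 2) frame_expand[OF assms, of p])
    by (simp add: inner_add_left inner_add_right frame_inner[OF assms] power2_eq_square)
  moreover have "(norm (coords t1 t2 p))\<^sup>2 = (p \<bullet> t1)\<^sup>2 + (p \<bullet> t2)\<^sup>2"
    unfolding norm_vec_def L2_set_def sum_2 by simp
  ultimately have "(norm (coords t1 t2 p))\<^sup>2 \<le> (norm p)\<^sup>2" by simp
  then show ?thesis by (rule power2_le_imp_le) simp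
qed

lemma graph_chartD:
  assumes "graph_chart t1 t2 t3 M X D f w"
  shows "open D" "smooth_on D w" "continuous_on D f" "f ` D \<subseteq> M" "regular_param M X D f"
    and "y \<in> D \<Longrightarrow> X (f y) = y$1 *\<^sub>R t1 + y$2 *\<^sub>R t2 + w y *\<^sub>R t3"
    and "open D' \<Longrightarrow> D' \<subseteq> D \<Longrightarrow> openin (top_of_set M) (f ` D')"
proof -
  have r: "regular_param M X D f" using assms unfolding graph_chart_def by auto
  then obtain g where g: "homeomorphism D (f ` D) f g" unfolding regular_param_def by auto
  have o: "openin (top_of_set M) (f ` D)" and D: "open D" using r unfolding regular_param_def by auto
  show "open D" "smooth_on D w" "regular_param M X D f" "y \<in> D \<Longrightarrow> X (f y) = y$1 *\<^sub>R t1 + y$2 *\<^sub>R t2 + w y *\<^sub>R t3"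
    using assms unfolding graph_chart_def regular_param_def by auto
  show "continuous_on D f" using g by (simp add: homeomorphism_def)
  show "f ` D \<subseteq> M" using o openin_imp_subset by blast
  show "openin (top_of_set M) (f ` D')" if "open D'" "D' \<subseteq> D"
    using homeomorphism_imp_open_map[OF g, of D'] that D o
    by (meson openin_open_eq openin_trans)
qed

lemma graph_chart_coords:
  assumes "frame t1 t2 t3" "graph_chart t1 t2 t3 M X D f w" "y \<in> D"
  shows "coords t1 t2 (X (f y)) = y" "X (f y) \<bullet> t3 = w y"
  using graph_chartD(6)[OF assms(2,3)] frame_inner[OF assms(1)]
  by (auto intro!: coords_eqI simp: inner_add_left)

lemma chart_normal_nonzero:
  assumes "regular_param M X V f" "x \<in> V"
  shows "cross3 (partial 1 (X \<circ> f) x) (partial 2 (X \<circ> f) x) \<noteq> 0" "partial 1 (X \<circ> f) x \<noteq> 0"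
proof -
  define P where "P = X \<circ> f"
  define a where "a = partial 1 P x"
  define b where "b = partial 2 P x"
  have inj: "inj (frechet_derivative P (at x))" and sm: "smooth_on V P"
    using assms unfolding regular_param_def P_def by auto
  have lin: "linear (frechet_derivative P (at x))"
    using smooth_on_has_derivative[OF sm assms(2)] has_derivative_linear by blast
  have 0: "v = 0" if "v$1 *\<^sub>R a + v$2 *\<^sub>R b = 0" for v :: "real^2"
    using that linear_vec2[OF lin, of v] inj linear_injective_0[OF lin] unfolding a_def b_def partial_def by auto
  have a: "a \<noteq> 0"
  proof
    assume "a = 0"
    then have "(axis 1 1 :: real^2) = 0" by (intro 0) (simp add: axis_def)
    then show False by (simp add: axis_eq_0_iff)
  qed
  then show "partial 1 (X \<circ> f) x \<noteq> 0" unfolding a_def P_def .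
  have "cross3 a b \<noteq> 0"
  proof
    assume "cross3 a b = 0"
    \<comment> \<open>A vanishing cross product yields a linear relation between the partial
      derivatives by Lagrange's formula; injectivity of the differential makes its coefficients
      zero, among them the square of the norm of \<open>a\<close>.\<close>
    then have "(a \<bullet> b) *\<^sub>R a - (a \<bullet> a) *\<^sub>R b = 0" using Lagrange[of a a b] by simp
    then have "vector [a \<bullet> b, - (a \<bullet> a)] = (0 :: real^2)" by (intro 0) simp
    then have "a \<bullet> a = 0" by (simp add: vec_eq_iff forall_2)
    then show False using a by simp
  qed
  then show "cross3 (partial 1 (X \<circ> f) x) (partial 2 (X \<circ> f) x) \<noteq> 0" unfolding a_def b_def P_def .
qed

lemma frame_of_normal:
  assumes "t \<bullet> t = 1" "n \<bullet> n = 1" "t \<bullet> n = 0"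
  shows "frame t (cross3 n t) n"
  unfolding frame_def
proof (intro conjI)
  show "cross3 n t \<bullet> cross3 n t = 1"
    using norm_cross_dot[of n t] assms by (simp add: power2_norm_eq_inner norm_eq_sqrt_inner inner_commute)
  show "n = cross3 t (cross3 n t)" using Lagrange[of t n t] assms by (simp add: inner_commute)
qed (use assms in \<open>simp_all add: dot_cross_self\<close>)

text \<open>The frame is adapted to the tangent plane, with t3 the unit normal at \<open>p\<close>,
  so that transversality holds automatically, also where the tangent plane is vertical.\<close>

lemma graph_chart_at:
  assumes "immersed_surface M X" "p \<in> M"
  obtains t1 t2 t3 y0 r f w where "frame t1 t2 t3" "r > 0" "graph_chart t1 t2 t3 M X (ball y0 r) f w" "f y0 = p"
proof -
  obtain V f x where f: "regular_param M X V f" "x \<in> V" "f x = p"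
    using assms unfolding immersed_surface_def by (metis imageE)
  define a where "a = partial 1 (X \<circ> f) x"
  define \<nu> where "\<nu> = cross3 a (partial 2 (X \<circ> f) x)"
  have nz: "\<nu> \<noteq> 0" "a \<noteq> 0" using chart_normal_nonzero[OF f(1,2)] unfolding \<nu>_def a_def by auto
  have sg: "sgn v \<bullet> sgn v = 1" if "v \<noteq> 0" for v :: "real^3"
    using that by (metis norm_eq_1 norm_sgn)
  have orth: "sgn a \<bullet> sgn \<nu> = 0" unfolding sgn_div_norm \<nu>_def by (simp add: dot_cross_self)
  have fr: "frame (sgn a) (cross3 (sgn \<nu>) (sgn a)) (sgn \<nu>)"
    by (rule frame_of_normal) (use nz sg orth in auto)
  have "cross3 (partial 1 (X \<circ> f) x) (partial 2 (X \<circ> f) x) \<bullet> sgn \<nu> \<noteq> 0"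
    unfolding a_def[symmetric] \<nu>_def[symmetric] using nz(1) by (simp add: sgn_div_norm)
  from graph_chart_exists[OF fr f(1,2) this] f(3) fr that show ?thesis by metis
qed

text \<open>Continuity of \<open>X\<close> is not part of the definition; on a chart it is that of
  the composite of \<open>X \<circ> f\<close> with the inverse homeomorphism.\<close>

lemma continuous_on_immersion:
  assumes "immersed_surface M X"
  shows "continuous_on M X"
  unfolding continuous_on_eq_continuous_within
proof
  fix p assume p: "p \<in> M"
  then obtain V f where f: "regular_param M X V f" "p \<in> f ` V" using assms unfolding immersed_surface_def by blast
  obtain g where g: "homeomorphism V (f ` V) f g" using f unfolding regular_param_def by auto
  have "continuous_on V (X \<circ> f)" using f unfolding regular_param_def by (blast intro: smooth_on_imp_continuous_on)
  then have "continuous_on (f ` V) (\<lambda>z. (X \<circ> f) (g z))"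
    by (rule continuous_on_compose2) (use g in \<open>auto simp: homeomorphism_def\<close>)
  then have "continuous_on (f ` V) X"
    by (rule continuous_on_eq) (use g in \<open>auto simp: homeomorphism_def\<close>)
  then have c: "continuous (at p within f ` V) X" using f(2) unfolding continuous_on_eq_continuous_within by blast
  obtain T where T: "open T" "f ` V = M \<inter> T" using f unfolding regular_param_def by (auto simp: openin_open)
  have "at p within f ` V = at p within M"
    by (rule at_within_nhd[of p T]) (use T f(2) in auto)
  then show "continuous (at p within M) X" using c by simp
qed

lemma immersion_locally_injective:
  assumes "immersed_surface M X" "p \<in> M"
  obtains T where "openin (top_of_set M) T" "p \<in> T" "inj_on X T"
proof -
  obtain t1 t2 t3 y0 r f w where c: "frame t1 t2 t3" "r > 0" "graph_chart t1 t2 t3 M X (ball y0 r) f w" "f y0 = p"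
    using graph_chart_at[OF assms] by metis
  have "inj_on X (f ` ball y0 r)"
    using graph_chart_coords(1)[OF c(1,3)] by (intro inj_onI) (metis imageE)
  moreover have "openin (top_of_set M) (f ` ball y0 r)" using graph_chartD(7)[OF c(3), of "ball y0 r"] by simp
  moreover have "p \<in> f ` ball y0 r" using c by force
  ultimately show ?thesis using that by blast
qed

text \<open>Being joined by an admissible curve is an equivalence relation whose classes are open,
  because straight segments in a disc of chart parameters lift to admissible curves of bounded
  speed.\<close>

lemma surface_curve_exists:
  assumes imm: "immersed_surface M X" and "connected M" "p \<in> M" "q \<in> M"
  shows "\<exists>\<gamma> L. surface_curve M X p q \<gamma> L"
proof -
  \<comment> \<open>Both directions are put into the relation, which makes it symmetric without
    reversing curves.\<close>
  define R where "R p q \<longleftrightarrow> (\<exists>\<gamma> L. surface_curve M X p q \<gamma> L) \<and> (\<exists>\<gamma> L. surface_curve M X q p \<gamma> L)" for p q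
  have "R p q"
  proof (rule connected_equivalence_relation[OF assms(2-4)])
    show "R x y \<Longrightarrow> R y x" for x y unfolding R_def by auto
    show "R x y \<Longrightarrow> R y z \<Longrightarrow> R x z" for x y z unfolding R_def using surface_curve_join by blast
    fix a assume a: "a \<in> M"
    then obtain t1 t2 t3 y0 r f w where c: "frame t1 t2 t3" "r > 0" "graph_chart t1 t2 t3 M X (ball y0 r) f w" "f y0 = a"
      using graph_chart_at[OF imm] by metis
    note cD = graph_chartD[OF c(3)]
    have cv: "\<exists>\<gamma> L. surface_curve M X (f x) (f y) \<gamma> L" if xy: "x \<in> ball y0 r" "y \<in> ball y0 r" for x y
    proof -
      define s where "s t = x + t *\<^sub>R (y - x)" for t :: real
      have sB: "s t \<in> ball y0 r" if "t \<in> {0..1}" for t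
        using convexD_alt[OF convex_ball xy, of t] that unfolding s_def by (simp add: algebra_simps)
      define dX where "dX v z = v$1 *\<^sub>R t1 + v$2 *\<^sub>R t2 + frechet_derivative w (at z) v *\<^sub>R t3" for v z
      define c where "c t = s t$1 *\<^sub>R t1 + s t$2 *\<^sub>R t2 + w (s t) *\<^sub>R t3" for t
      have contd: "continuous_on (closed_segment 0 1) (\<lambda>t. dX (y - x) (s t))"
        unfolding dX_def closed_segment_eq_real_ivl
        by (intro continuous_intros continuous_on_compose2[OF smooth_on_imp_continuous_on[OF smooth_on_derivative[OF cD(2)]]])
          (use sB in \<open>auto simp: s_def intro!: continuous_intros\<close>)
      have "compact ((\<lambda>t. dX (y - x) (s t)) ` closed_segment 0 1)"
        by (rule compact_continuous_image[OF contd]) simp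
      then obtain K where K: "\<And>t. t \<in> closed_segment 0 1 \<Longrightarrow> norm (dX (y - x) (s t)) \<le> K"
        by (meson bounded_iff compact_imp_bounded imageI)
      have "\<exists>\<gamma> L. surface_curve M X ((f \<circ> s) 0) ((f \<circ> s) 1) \<gamma> L"
      proof (rule surface_curve_of_lift[of 0 1 "f \<circ> s" M X c "\<lambda>t. dX (y - x) (s t)" K])
        show "continuous_on (closed_segment 0 1) (f \<circ> s)"
          unfolding closed_segment_eq_real_ivl
          by (intro continuous_on_compose continuous_on_subset[OF cD(3)])
            (use sB in \<open>auto simp: s_def intro!: continuous_intros\<close>)
        show "(f \<circ> s) t \<in> M \<and> X ((f \<circ> s) t) = c t" if "t \<in> closed_segment 0 1" for t
          using cD(4) cD(6)[of "s t"] sB[of t] that unfolding closed_segment_eq_real_ivl c_def by auto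
        show "(c has_vector_derivative dX (y - x) (s t)) (at t)" if "t \<in> closed_segment 0 1" for t
        proof -
          have ds: "(s has_derivative (\<lambda>h. h *\<^sub>R (y - x))) (at t)"
            unfolding s_def by (auto intro!: derivative_eq_intros)
          have "(w has_derivative frechet_derivative w (at (s t))) (at (s t))"
            using smooth_on_has_derivative[OF cD(2) sB] that unfolding closed_segment_eq_real_ivl by auto
          from has_derivative_compose[OF ds this] has_derivative_linear[OF this]
          have dw: "((\<lambda>t. w (s t)) has_derivative (\<lambda>h. h *\<^sub>R frechet_derivative w (at (s t)) (y - x))) (at t)"
            by (simp add: linear_scale)
          have dn: "((\<lambda>t. s t $ i) has_derivative (\<lambda>h. h *\<^sub>R ((y - x) $ i))) (at t)" for i
            using has_derivative_compose[OF ds bounded_linear_imp_has_derivative[OF bounded_linear_vec_nth], of i] by simp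
          show ?thesis
            unfolding has_vector_derivative_def c_def dX_def
            by (auto intro!: derivative_eq_intros dn dw simp: algebra_simps)
        qed
      qed (use contd K in auto)
      then show ?thesis by (simp add: s_def)
    qed
    show "\<exists>T. openin (top_of_set M) T \<and> a \<in> T \<and> (\<forall>x\<in>T. R a x)"
    proof (intro exI conjI ballI)
      show "openin (top_of_set M) (f ` ball y0 r)" using cD(7)[of "ball y0 r"] by simp
      show "a \<in> f ` ball y0 r" using c by force
      show "R a x" if "x \<in> f ` ball y0 r" for x
        using that cv[of y0] cv[of _ y0] c(2,4) unfolding R_def by auto
    qed
  qed
  then show ?thesis unfolding R_def by auto
qed

text \<open>
  The existence of a curve matters here: the infimum of the empty set is an unspecified real number.
\<close>

lemma surface_dist_ge:
  fixes M :: "('a::{t2_space, second_countable_topology}) set"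
  assumes imm: "immersed_surface M X" and con: "connected M"
    and fr: "frame t1 t2 t3" and gc: "graph_chart t1 t2 t3 M X D f w"
    and r: "r > 0" "cball y0 r \<subseteq> D" and q: "q \<in> M" "q \<notin> f ` ball y0 r"
  shows "r \<le> surface_dist M X q (f y0)"
proof -
  note cD = graph_chartD[OF gc]
  have y0: "y0 \<in> D" using r by auto
  have p: "f y0 \<in> M" using cD(4) y0 by auto
  have "r \<le> L" if cv: "surface_curve M X q (f y0) \<gamma> L" for \<gamma> L
  proof -
    have g: "path \<gamma>" "path_image \<gamma> \<subseteq> M" "pathstart \<gamma> = q" "pathfinish \<gamma> = f y0" "valid_path (X \<circ> \<gamma>)"
      "((\<lambda>t. norm (vector_derivative (X \<circ> \<gamma>) (at t))) has_integral L) {0..1}"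
      using cv unfolding surface_curve_def by auto
    \<comment> \<open>The curve starts outside the disc and ends at its centre. The image of the
      open disc is open in \<open>M\<close>, that of the closed disc is compact and hence closed
      since the space is Hausdorff; a connected curve that avoids the image of the circle would be
      separated by the two.\<close>
    have "\<exists>t\<in>{0..1}. \<gamma> t \<in> f ` sphere y0 r"
    proof (rule ccontr)
      assume no: "\<not> ?thesis"
      have o1: "openin (top_of_set M) (f ` ball y0 r)"
        by (rule cD(7)) (use r in auto)
      have "compact (f ` cball y0 r)"
        by (rule compact_continuous_image[OF continuous_on_subset[OF cD(3) r(2)]]) simp
      then have o2: "open (- (f ` cball y0 r))" using compact_imp_closed by blast
      obtain T where T: "open T" "f ` ball y0 r = M \<inter> T" using o1 by (auto simp: openin_open)
      have "connected (path_image \<gamma>)" using g(1) by (rule connected_path_image)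
      moreover have "path_image \<gamma> \<subseteq> T \<union> - (f ` cball y0 r)"
      proof
        fix z assume z: "z \<in> path_image \<gamma>"
        have "cball y0 r = ball y0 r \<union> sphere y0 r" by auto
        moreover have "z \<notin> f ` sphere y0 r" using z no unfolding path_image_def by auto
        ultimately show "z \<in> T \<union> - (f ` cball y0 r)" using T(2) by (auto simp: image_Un)
      qed
      moreover have "T \<inter> - (f ` cball y0 r) \<inter> path_image \<gamma> = {}"
      proof -
        have "f ` ball y0 r \<subseteq> f ` cball y0 r" by (intro image_mono) auto
        then show ?thesis using T(2) g(2) by auto
      qed
      ultimately have "T \<inter> path_image \<gamma> = {} \<or> - (f ` cball y0 r) \<inter> path_image \<gamma> = {}"
        using connectedD[of "path_image \<gamma>" T "- (f ` cball y0 r)"] T(1) o2 by auto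
      moreover have "f y0 \<in> T \<inter> path_image \<gamma>"
        using T(2) r(1) g(4) pathfinish_in_path_image[of \<gamma>] by force
      moreover have "q \<in> - (f ` cball y0 r) \<inter> path_image \<gamma>"
      proof -
        have "q \<notin> f ` sphere y0 r" using no g(3) unfolding pathstart_def by force
        moreover have "cball y0 r = ball y0 r \<union> sphere y0 r" by auto
        ultimately show ?thesis using q(2) g(3) pathstart_in_path_image[of \<gamma>] by (auto simp: image_Un)
      qed
      ultimately show False by auto
    qed
    then obtain t y where t: "t \<in> {0..1}" "y \<in> sphere y0 r" "\<gamma> t = f y" by auto
    have y: "y \<in> D" using t(2) r(2) by (auto simp: subset_iff)
    \<comment> \<open>From the crossing point to the centre the chart coordinates move by
      \<open>r\<close>, and orthogonal projection does not increase distances, so the curve moves at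
      least that far in space.\<close>
    have "r = norm (y0 - y)" using t(2) by (simp add: dist_norm)
    also have "\<dots> = norm (coords t1 t2 (X (f y0) - X (f y)))"
      unfolding coords_diff[symmetric] using graph_chart_coords(1)[OF fr gc] y y0 by simp
    also have "\<dots> \<le> norm (X (f y0) - X (f y))" by (rule norm_coords_le[OF fr])
    also have "\<dots> = norm ((X \<circ> \<gamma>) 1 - (X \<circ> \<gamma>) t)" using g(4) t(3) by (simp add: pathfinish_def)
    also have "\<dots> \<le> L" by (rule displacement_le_length[OF g(5,6) t(1)])
    finally show ?thesis .
  qed
  then show ?thesis
    unfolding surface_dist_eq
    using surface_curve_exists[OF imm con q(1) p] by (intro cInf_greatest) auto
qed

text \<open>Links completeness, a metric statement, with the topology of \<open>M\<close>: by
  \<open>surface_dist_ge\<close> a point close to \<open>p\<close> in surface distance lies in a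
  prescribed small disc around \<open>p\<close>.\<close>

lemma surface_dist_tendsto_imp_tendsto:
  fixes M :: "('a::{t2_space, second_countable_topology}) set"
  assumes imm: "immersed_surface M X" and con: "connected M" and p: "p \<in> M" and \<sigma>: "\<And>n. \<sigma> n \<in> M"
    and lim: "(\<lambda>n. surface_dist M X (\<sigma> n) p) \<longlonglongrightarrow> 0"
  shows "\<sigma> \<longlonglongrightarrow> p"
proof (rule topological_tendstoI)
  fix T assume T: "open T" "p \<in> T"
  obtain t1 t2 t3 y0 r f w where c: "frame t1 t2 t3" "r > 0" "graph_chart t1 t2 t3 M X (ball y0 r) f w" "f y0 = p"
    using graph_chart_at[OF imm p] by metis
  have "open (ball y0 r \<inter> f -` T)"
    using continuous_open_preimage[OF graph_chartD(3)[OF c(3)] open_ball T(1)] .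
  moreover have "y0 \<in> ball y0 r \<inter> f -` T" using T c by auto
  ultimately obtain e where e: "e > 0" "cball y0 e \<subseteq> ball y0 r \<inter> f -` T" using open_contains_cball by blast
  have "eventually (\<lambda>n. surface_dist M X (\<sigma> n) p < e) sequentially"
    using lim e(1) by (rule order_tendstoD)
  then show "eventually (\<lambda>n. \<sigma> n \<in> T) sequentially"
  proof eventually_elim
    case (elim n)
    have "\<sigma> n \<in> f ` ball y0 e"
      using surface_dist_ge[OF imm con c(1,3) e(1) _ \<sigma>, of y0 n] e(2) elim c(4) by (auto simp: not_le)
    then show ?case using e(2) by (auto simp: subset_iff)
  qed
qed

section \<open>Lifting curves by completeness\<close>

text \<open>The set of agreement is open because \<open>F\<close> is locally injective, and closed
  because the target is Hausdorff. It is used with \<open>F\<close> equal to \<open>X\<close> for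
  curves and to the developing map \<open>Y\<close> for curves and for sections over planar
  sets.\<close>

lemma lift_unique:
  fixes l l' :: "'b::topological_space \<Rightarrow> 'a::t2_space"
  assumes S: "connected S" and cl: "continuous_on S l" "continuous_on S l'"
    and M: "l ` S \<subseteq> M" "l' ` S \<subseteq> M"
    and inj: "\<And>p. p \<in> M \<Longrightarrow> \<exists>T. openin (top_of_set M) T \<and> p \<in> T \<and> inj_on F T"
    and eq: "\<And>s. s \<in> S \<Longrightarrow> F (l s) = F (l' s)"
    and s0: "s0 \<in> S" "l s0 = l' s0" and s: "s \<in> S"
  shows "l s = l' s"
proof -
  define E where "E = {s \<in> S. l s = l' s}"
  have "openin (top_of_set S) E"
    unfolding openin_subopen[of _ E]
  proof
    fix u assume u: "u \<in> E"
    then have "l u \<in> M" using M unfolding E_def by auto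
    then obtain T where T: "openin (top_of_set M) T" "l u \<in> T" "inj_on F T" using inj by blast
    obtain O' where O: "open O'" "T = M \<inter> O'" using T(1) by (auto simp: openin_open)
    define U where "U = (S \<inter> l -` O') \<inter> (S \<inter> l' -` O')"
    have "openin (top_of_set S) U"
      unfolding U_def using cl O(1) by (intro openin_Int continuous_openin_preimage_gen)
    moreover have "u \<in> U" using u T O unfolding E_def U_def by auto
    moreover have "U \<subseteq> E"
    proof
      fix v assume v: "v \<in> U"
      then have "l v \<in> T" "l' v \<in> T" "v \<in> S" using M O unfolding U_def by auto
      then show "v \<in> E" using T(3) eq[of v] unfolding E_def by (auto dest: inj_onD)
    qed
    ultimately show "\<exists>T. openin (top_of_set S) T \<and> u \<in> T \<and> T \<subseteq> E" by blast
  qed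
  moreover have "openin (top_of_set S) (S - E)"
    unfolding openin_subopen[of _ "S - E"]
  proof
    fix u assume u: "u \<in> S - E"
    then have "l u \<noteq> l' u" unfolding E_def by auto
    then obtain A B where AB: "open A" "open B" "l u \<in> A" "l' u \<in> B" "A \<inter> B = {}" using hausdorff by metis
    define U where "U = (S \<inter> l -` A) \<inter> (S \<inter> l' -` B)"
    have "openin (top_of_set S) U"
      unfolding U_def using cl AB by (intro openin_Int continuous_openin_preimage_gen)
    moreover have "u \<in> U" using u AB unfolding U_def by auto
    moreover have "U \<subseteq> S - E" using AB(5) unfolding U_def E_def by auto
    ultimately show "\<exists>T. openin (top_of_set S) T \<and> u \<in> T \<and> T \<subseteq> S - E" by blast
  qed
  moreover have "E \<subseteq> S" unfolding E_def by auto
  ultimately have "E = {} \<or> E = S"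
    using S unfolding connected_clopen closedin_def by simp
  then show ?thesis using s0 s unfolding E_def by auto
qed

text \<open>
  The invariant \<open>St\<close> is carried along the lift: it has to propagate locally and to be closed, and
  only points satisfying it need a local lift.
\<close>

lemma lift_exists:
  fixes M :: "('a::{t2_space, second_countable_topology}) set"
  assumes imm: "immersed_surface M X" and con: "connected M" and compl: "complete_surface M X"
    and c: "\<And>t. t \<in> {0..1} \<Longrightarrow> (c has_vector_derivative c' t) (at t)" "continuous_on {0..1} c'"
    and p0: "p0 \<in> M" "X p0 = c 0" "St p0 0"
    and ext: "\<And>p t. p \<in> M \<Longrightarrow> t \<in> {0..1} \<Longrightarrow> X p = c t \<Longrightarrow> St p t \<Longrightarrow>
       \<exists>e>0. \<exists>l. continuous_on ({t-e..t+e} \<inter> {0..1}) l \<and> l t = p \<and>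
          (\<forall>s\<in>{t-e..t+e} \<inter> {0..1}. l s \<in> M \<and> X (l s) = c s \<and> St (l s) s)"
    and clos: "\<And>p t \<sigma> \<tau>. p \<in> M \<Longrightarrow> t \<in> {0..1} \<Longrightarrow> X p = c t \<Longrightarrow> \<tau> \<longlonglongrightarrow> t \<Longrightarrow> \<sigma> \<longlonglongrightarrow> p \<Longrightarrow>
        (\<And>n::nat. \<tau> n \<in> {0..1} \<and> \<sigma> n \<in> M \<and> X (\<sigma> n) = c (\<tau> n) \<and> St (\<sigma> n) (\<tau> n)) \<Longrightarrow> St p t"
  obtains l where "continuous_on {0..1} l" "l 0 = p0" "\<And>s. s \<in> {0..1} \<Longrightarrow> l s \<in> M \<and> X (l s) = c s \<and> St (l s) s"
proof -
  define Good where "Good \<tau> l \<longleftrightarrow> continuous_on {0..\<tau>} l \<and> l 0 = p0 \<and>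
    (\<forall>s\<in>{0..\<tau>}. l s \<in> M \<and> X (l s) = c s \<and> St (l s) s)" for \<tau> :: real and l
  have linj: "\<exists>T. openin (top_of_set M) T \<and> p \<in> T \<and> inj_on X T" if "p \<in> M" for p
    using immersion_locally_injective[OF imm that] by metis
  have uniq: "l s = l' s" if "Good \<tau> l" "Good \<tau>' l'" "0 \<le> s" "s \<le> \<tau>" "s \<le> \<tau>'" for l l' \<tau> \<tau>' s
  proof (rule lift_unique[of "{0..s}" l l' M X 0])
    show "continuous_on {0..s} l" "continuous_on {0..s} l'"
      using that unfolding Good_def by (auto elim!: continuous_on_subset)
  qed (use that linj in \<open>auto simp: Good_def\<close>)
  define T where "T = {\<tau>\<in>{0..1}. \<exists>l. Good \<tau> l}"
  have T0: "0 \<in> T" unfolding T_def Good_def using p0 by (auto intro!: exI[of _ "\<lambda>_. p0"])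
  have bdd: "bdd_above T" by (rule bdd_aboveI[of _ 1]) (auto simp: T_def)
  define b where "b = Sup T"
  have b0: "0 \<le> b" unfolding b_def using T0 bdd by (rule cSup_upper)
  have b1: "b \<le> 1" unfolding b_def
  proof (rule cSup_least)
    show "T \<noteq> {}" using T0 by auto
  qed (auto simp: T_def)
  have down: "s \<in> T" if st: "\<tau> \<in> T" "0 \<le> s" "s \<le> \<tau>" for s \<tau>
  proof -
    obtain l where l: "Good \<tau> l" using st(1) unfolding T_def by auto
    have "Good s l"
      using l that(2,3) continuous_on_subset[of "{0..\<tau>}" l "{0..s}"] unfolding Good_def by auto
    then show ?thesis using that unfolding T_def by auto
  qed
  have below: "s \<in> T" if s: "0 \<le> s" "s < b" for s
  proof -
    obtain \<tau> where "\<tau> \<in> T" "s < \<tau>" using s(2) T0 unfolding b_def by (metis less_cSupE empty_iff)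
    then show ?thesis using down s(1) by auto
  qed
  \<comment> \<open>Starts at 0 and tends to \<open>b\<close> from below, strictly so when
    \<open>b\<close> is positive; for b = 0 it is constantly 0, a time known to be in
    \<open>T\<close>.\<close>
  define \<tau> where "\<tau> n = b - b / (real n + 1)" for n :: nat
  have \<tau>b: "0 \<le> \<tau> n" "\<tau> n \<le> b" for n
    unfolding \<tau>_def using b0 by (auto simp: field_simps)
  have \<tau>T: "\<tau> n \<in> T" for n
  proof (cases "b = 0")
    case True then show ?thesis using T0 unfolding \<tau>_def by simp
  next
    case False
    then have "\<tau> n < b" unfolding \<tau>_def using b0 by simp
    then show ?thesis using below \<tau>b by auto
  qed
  have \<tau>lim: "\<tau> \<longlonglongrightarrow> b"
  proof -
    have "(\<lambda>n. inverse (real (Suc n))) \<longlonglongrightarrow> 0" by (rule LIMSEQ_inverse_real_of_nat)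
    then have "(\<lambda>n. b - b * inverse (real (Suc n))) \<longlonglongrightarrow> b - b * 0" by (intro tendsto_intros)
    then show ?thesis unfolding \<tau>_def by (simp add: divide_inverse add.commute)
  qed
  have "\<exists>l. \<forall>n. Good (\<tau> n) (l n)" using \<tau>T unfolding T_def by (intro choice) auto
  then obtain l where l: "\<And>n. Good (\<tau> n) (l n)" by blast
  define \<sigma> where "\<sigma> n = l n (\<tau> n)" for n
  have \<sigma>: "\<sigma> n \<in> M" "X (\<sigma> n) = c (\<tau> n)" "St (\<sigma> n) (\<tau> n)" for n
    using l[of n] \<tau>b[of n] unfolding Good_def \<sigma>_def by auto
  have "compact (c' ` {0..1})" by (rule compact_continuous_image[OF c(2)]) simp
  then obtain K where K: "\<And>t. t \<in> {0..1} \<Longrightarrow> norm (c' t) \<le> K"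
    by (meson bounded_iff compact_imp_bounded imageI)
  have K0: "0 \<le> K" using order_trans[OF norm_ge_zero K[of 0]] by simp
  have dist: "surface_dist M X (\<sigma> m) (\<sigma> n) \<le> K * \<bar>\<tau> n - \<tau> m\<bar>" for m n
  proof -
    \<comment> \<open>The later of the two times: by uniqueness the single lift \<open>l N\<close>
      passes through both points, so that bounded speed makes the points \<sigma> a Cauchy sequence
      for the surface distance.\<close>
    define N where "N = (if \<tau> m \<le> \<tau> n then n else m)"
    have N: "\<tau> m \<le> \<tau> N" "\<tau> n \<le> \<tau> N" unfolding N_def by auto
    have seg: "closed_segment (\<tau> m) (\<tau> n) \<subseteq> {0..\<tau> N}"
    proof -
      have "0 \<le> \<tau> m" "0 \<le> \<tau> n" using \<tau>b by auto
      then show ?thesis using N by (simp add: closed_segment_eq_real_ivl)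
    qed
    have seg1: "closed_segment (\<tau> m) (\<tau> n) \<subseteq> {0..1}"
    proof -
      have "{0..\<tau> N} \<subseteq> {0..1}" using \<tau>b(2)[of N] b1 by simp
      then show ?thesis using seg by (rule order_trans[rotated])
    qed
    have e: "l N (\<tau> m) = \<sigma> m" "l N (\<tau> n) = \<sigma> n"
      unfolding \<sigma>_def
      using uniq[OF l[of N] l[of m], of "\<tau> m"] uniq[OF l[of N] l[of n], of "\<tau> n"] N \<tau>b by auto
    obtain \<gamma> L where "surface_curve M X (l N (\<tau> m)) (l N (\<tau> n)) \<gamma> L" "L \<le> K * \<bar>\<tau> n - \<tau> m\<bar>"
    proof (rule surface_curve_of_lift[of "\<tau> m" "\<tau> n" "l N" M X c c' K])
      show "continuous_on (closed_segment (\<tau> m) (\<tau> n)) (l N)"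
        using l[of N] seg unfolding Good_def by (auto elim: continuous_on_subset)
      show "continuous_on (closed_segment (\<tau> m) (\<tau> n)) c'" using c(2) seg1 by (rule continuous_on_subset)
      fix t assume t: "t \<in> closed_segment (\<tau> m) (\<tau> n)"
      then show "l N t \<in> M \<and> X (l N t) = c t" using l[of N] seg unfolding Good_def by blast
      show "(c has_vector_derivative c' t) (at t)" "norm (c' t) \<le> K" using c(1) K t seg1 by blast+
    qed blast
    then show ?thesis unfolding e using surface_dist_le by force
  qed
  have "\<exists>p\<in>M. (\<lambda>n. surface_dist M X (\<sigma> n) p) \<longlonglongrightarrow> 0"
  proof (rule compl[unfolded complete_surface_def, rule_format], intro conjI allI impI)
    show "range \<sigma> \<subseteq> M" using \<sigma>(1) by auto
    fix e :: real assume e: "e > 0"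
    have "e / (K + 1) > 0" using e K0 by simp
    then obtain N where N: "\<And>m n. m \<ge> N \<Longrightarrow> n \<ge> N \<Longrightarrow> dist (\<tau> m) (\<tau> n) < e / (K + 1)"
      using LIMSEQ_imp_Cauchy[OF \<tau>lim] unfolding Cauchy_def by metis
    have "surface_dist M X (\<sigma> m) (\<sigma> n) < e" if "m \<ge> N" "n \<ge> N" for m n
    proof -
      have "\<bar>\<tau> n - \<tau> m\<bar> < e / (K + 1)" using N[OF that] by (simp add: dist_real_def abs_minus_commute)
      then have "(K + 1) * \<bar>\<tau> n - \<tau> m\<bar> < e" using K0 by (simp add: pos_less_divide_eq mult.commute)
      moreover have "K * \<bar>\<tau> n - \<tau> m\<bar> \<le> (K + 1) * \<bar>\<tau> n - \<tau> m\<bar>" by (intro mult_right_mono) auto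
      ultimately show ?thesis using dist[of m n] by linarith
    qed
    then show "\<exists>N. \<forall>m\<ge>N. \<forall>n\<ge>N. surface_dist M X (\<sigma> m) (\<sigma> n) < e" by blast
  qed
  then obtain p where p: "p \<in> M" and "(\<lambda>n. surface_dist M X (\<sigma> n) p) \<longlonglongrightarrow> 0" by blast
  then have \<sigma>lim: "\<sigma> \<longlonglongrightarrow> p"
    using surface_dist_tendsto_imp_tendsto[where \<sigma>=\<sigma>, OF imm con p] \<sigma>(1) by blast
  have bI: "b \<in> {0..1}" using b0 b1 by simp
  have Xp: "X p = c b"
  proof (rule LIMSEQ_unique)
    show "(\<lambda>n. X (\<sigma> n)) \<longlonglongrightarrow> X p"
      by (rule continuous_on_tendsto_compose[OF continuous_on_immersion[OF imm] \<sigma>lim p]) (use \<sigma> in auto)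
    have "isCont c b" using c(1)[OF bI] has_vector_derivative_continuous by blast
    then show "(\<lambda>n. X (\<sigma> n)) \<longlonglongrightarrow> c b" unfolding \<sigma>(2) using \<tau>lim isCont_tendsto_compose by blast
  qed
  have Stp: "St p b"
    using clos[OF p bI Xp \<tau>lim \<sigma>lim] \<sigma> \<tau>b b1 by (meson atLeastAtMost_iff order_trans)
  obtain e k where e: "e > 0" and k: "continuous_on ({b-e..b+e} \<inter> {0..1}) k" "k b = p"
    "\<And>s. s \<in> {b-e..b+e} \<inter> {0..1} \<Longrightarrow> k s \<in> M \<and> X (k s) = c s \<and> St (k s) s"
    using ext[OF p bI Xp Stp] by blast
  \<comment> \<open>The local lift at the limit point has to be matched with an earlier lift. At a
    late time both lie in a set on which \<open>X\<close> is injective and have the same image,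
    hence they coincide there and can be glued.\<close>
  obtain V where V: "openin (top_of_set M) V" "p \<in> V" "inj_on X V" using linj[OF p] by blast
  obtain W where W: "open W" "V = M \<inter> W" using V(1) by (auto simp: openin_open)
  have ev1: "eventually (\<lambda>n. \<sigma> n \<in> W) sequentially"
    using \<sigma>lim W V(2) by (auto intro: topological_tendstoD)
  have ev2: "eventually (\<lambda>n. b - e < \<tau> n) sequentially"
    using \<tau>lim e by (intro order_tendstoD) auto
  have ev3: "eventually (\<lambda>n. k (\<tau> n) \<in> W) sequentially"
  proof -
    have "(\<lambda>n. k (\<tau> n)) \<longlonglongrightarrow> k b"
      by (rule continuous_on_tendsto_compose[OF k(1) \<tau>lim])
        (use e bI in simp, use ev2 in \<open>rule eventually_mono\<close>, use \<tau>b b1 e in \<open>smt (verit) Int_iff atLeastAtMost_iff\<close>)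
    then show ?thesis using W V(2) k(2) by (auto intro: topological_tendstoD)
  qed
  obtain n where n: "\<sigma> n \<in> W" "b - e < \<tau> n" "k (\<tau> n) \<in> W"
    using eventually_happens'[OF sequentially_bot eventually_conj[OF ev1 eventually_conj[OF ev2 ev3]]] by auto
  have \<tau>e: "\<tau> n \<in> {b-e..b+e} \<inter> {0..1}" using n(2) \<tau>b[of n] e b1 by auto
  have "k (\<tau> n) \<in> V" "\<sigma> n \<in> V" "X (k (\<tau> n)) = X (\<sigma> n)"
    using k(3)[OF \<tau>e] n \<sigma>[of n] W(2) by auto
  then have glue: "k (\<tau> n) = l n (\<tau> n)" using V(3) unfolding \<sigma>_def by (auto dest: inj_onD)
  define b' where "b' = min 1 (b + e)"
  define h where "h s = (if s \<le> \<tau> n then l n s else k s)" for s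
  have b': "\<tau> n \<le> b'" "b' \<le> 1" "b' \<le> b + e" "0 \<le> b'" unfolding b'_def using \<tau>b[of n] b1 e b0 by auto
  have "continuous_on ({0..\<tau> n} \<union> {\<tau> n..b'}) h"
    unfolding h_def
  proof (rule continuous_on_cases)
    show "continuous_on {0..\<tau> n} (l n)" using l[of n] unfolding Good_def by auto
    show "continuous_on {\<tau> n..b'} k"
      by (rule continuous_on_subset[OF k(1)]) (use n(2) b' \<tau>b[of n] in auto)
  qed (use glue in auto)
  moreover have "{0..\<tau> n} \<union> {\<tau> n..b'} = {0..b'}" using \<tau>b[of n] b' by auto
  ultimately have "continuous_on {0..b'} h" by simp
  moreover have "h 0 = p0" unfolding h_def using \<tau>b[of n] l[of n] by (auto simp: Good_def)
  moreover have "h s \<in> M \<and> X (h s) = c s \<and> St (h s) s" if "s \<in> {0..b'}" for s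
    unfolding h_def using l[of n] k(3)[of s] that n(2) b' by (auto simp: Good_def)
  ultimately have good: "Good b' h" unfolding Good_def by auto
  then have "b' \<in> T" unfolding T_def using b' by auto
  then have "b' \<le> b" unfolding b_def using bdd by (intro cSup_upper)
  \<comment> \<open>The glued lift reaches the minimum of 1 and b + e with e > 0; as this does not
    exceed \<open>b\<close>, the minimum must be 1.\<close>
  then have "b' = 1" unfolding b'_def using e by (auto simp: min_def split: if_splits)
  then show ?thesis using that[of h] good unfolding Good_def by auto
qed

text \<open>
  \<open>Y\<close> develops the surface onto the planar domain \<open>\<Omega>\<close>, with local sections given by \<open>sect\<close>.
  Only lifts of segments are used, so \<open>\<Omega>\<close> need not be complete.
\<close>

locale developed_surface =
  fixes M :: "('a::{t2_space, second_countable_topology}) set" and X :: "'a \<Rightarrow> real^3"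
    and Y :: "'a \<Rightarrow> real^2" and \<Omega> :: "(real^2) set" and G G'
  assumes imm: "immersed_surface M X" and con: "connected M" and compl: "complete_surface M X" and ne: "M \<noteq> {}"
    and conv: "convex \<Omega>" and Ycont: "continuous_on M Y" and YM: "Y ` M \<subseteq> \<Omega>"
    and sect: "\<And>p. p \<in> M \<Longrightarrow> \<exists>D f. open D \<and> continuous_on D f \<and> f ` D \<subseteq> M \<and>
        (\<forall>D'. open D' \<and> D' \<subseteq> D \<longrightarrow> openin (top_of_set M) (f ` D')) \<and> p \<in> f ` D \<and> (\<forall>y\<in>D. Y (f y) = y)"
    and G: "\<And>y. y \<in> \<Omega> \<Longrightarrow> (G has_derivative G' y) (at y)" "\<And>v. continuous_on \<Omega> (\<lambda>y. G' y v)"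
    and XG: "\<And>p. p \<in> M \<Longrightarrow> X p = G (Y p)"
begin

lemma Y_locally_injective:
  assumes "p \<in> M"
  shows "\<exists>T. openin (top_of_set M) T \<and> p \<in> T \<and> inj_on Y T"
proof -
  obtain D f where f: "open D" "p \<in> f ` D" "\<And>y. y \<in> D \<Longrightarrow> Y (f y) = y" "openin (top_of_set M) (f ` D)"
    using sect[OF assms] by blast
  have "inj_on Y (f ` D)" using f(3) by (intro inj_onI) (metis imageE)
  then show ?thesis using f by blast
qed

section \<open>Lifting segments and sections over their neighbourhoods\<close>

definition seg :: "real^2 \<Rightarrow> real^2 \<Rightarrow> real \<Rightarrow> real^2"
  where "seg a b t = a + t *\<^sub>R (b - a)"

lemma seg_simps [simp]: "seg a b 0 = a" "seg a b 1 = b"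
  unfolding seg_def by simp_all

lemma seg_cont: "continuous_on S (seg a b)"
  unfolding seg_def by (intro continuous_intros)

lemma seg_in: "convex C \<Longrightarrow> a \<in> C \<Longrightarrow> b \<in> C \<Longrightarrow> t \<in> {0..1} \<Longrightarrow> seg a b t \<in> C"
  using convexD_alt[of C a b t] unfolding seg_def by (simp add: algebra_simps)

text \<open>The segment is pushed into space by \<open>G\<close> and lifted there by completeness.
  The invariant says that the lift develops onto the segment; it propagates through local sections
  and is closed because \<open>Y\<close> is continuous.\<close>

lemma segment_lift:
  assumes p: "p \<in> M" and v: "v \<in> \<Omega>"
  obtains l where "continuous_on {0..1} l" "l 0 = p" "\<And>s. s \<in> {0..1} \<Longrightarrow> l s \<in> M \<and> Y (l s) = seg (Y p) v s"
proof -
  let ?s = "seg (Y p) v"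
  have s\<Omega>: "?s t \<in> \<Omega>" if "t \<in> {0..1}" for t using seg_in[OF conv _ v that] YM p by auto
  have ds: "(?s has_derivative (\<lambda>h. h *\<^sub>R (v - Y p))) (at t)" for t
    unfolding seg_def by (auto intro!: derivative_eq_intros)
  have "\<exists>l. continuous_on {0..1} l \<and> l 0 = p \<and> (\<forall>s\<in>{0..1}. l s \<in> M \<and> X (l s) = G (?s s) \<and> Y (l s) = ?s s)"
  proof (rule lift_exists[OF imm con compl, where c="\<lambda>t. G (?s t)" and c'="\<lambda>t. G' (?s t) (v - Y p)"
        and St="\<lambda>q t. Y q = ?s t" and ?p0.0=p])
    show "((\<lambda>t. G (?s t)) has_vector_derivative G' (?s t) (v - Y p)) (at t)" if "t \<in> {0..1}" for t
      using has_derivative_compose[OF ds[of t] G(1)[OF s\<Omega>[OF that]]]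
        has_derivative_linear[OF G(1)[OF s\<Omega>[OF that]]]
      by (simp add: has_vector_derivative_def linear_scale)
    show "continuous_on {0..1} (\<lambda>t. G' (?s t) (v - Y p))"
      by (rule continuous_on_compose2[OF G(2) seg_cont]) (use s\<Omega> in auto)
    show "p \<in> M" "X p = G (?s 0)" "Y p = ?s 0" using p XG by auto
    show "\<exists>e>0. \<exists>l. continuous_on ({t-e..t+e} \<inter> {0..1}) l \<and> l t = q \<and>
          (\<forall>s\<in>{t-e..t+e} \<inter> {0..1}. l s \<in> M \<and> X (l s) = G (?s s) \<and> Y (l s) = ?s s)"
      if q: "q \<in> M" "t \<in> {0..1}" "X q = G (?s t)" "Y q = ?s t" for q t
    proof -
      obtain D f where f: "open D" "continuous_on D f" "f ` D \<subseteq> M" "q \<in> f ` D" "\<And>y. y \<in> D \<Longrightarrow> Y (f y) = y"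
        using sect[OF q(1)] by blast
      have D: "?s t \<in> D" "f (?s t) = q" using f(4,5) q(4) by force+
      have "open (?s -` D)" using f(1) seg_cont[of UNIV] by (simp add: continuous_open_vimage continuous_on_eq_continuous_at)
      moreover have "t \<in> ?s -` D" using D by simp
      ultimately obtain e where e: "e > 0" "cball t e \<subseteq> ?s -` D" using open_contains_cball by blast
      have sD: "?s s \<in> D" if "s \<in> {t-e..t+e}" for s
        using e(2) that by (auto simp: cball_eq_atLeastAtMost subset_iff)
      have "continuous_on ({t-e..t+e} \<inter> {0..1}) (f \<circ> ?s)"
        by (intro continuous_on_compose seg_cont continuous_on_subset[OF f(2)]) (use sD in auto)
      moreover have "(f \<circ> ?s) s \<in> M \<and> X ((f \<circ> ?s) s) = G (?s s) \<and> Y ((f \<circ> ?s) s) = ?s s" if "s \<in> {t-e..t+e}" for s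
        using f(3,5) sD[OF that] XG by force
      ultimately show ?thesis using e(1) D(2) by (intro exI[of _ e] conjI exI[of _ "f \<circ> ?s"]) auto
    qed
    show "Y q = ?s t"
      if "q \<in> M" "t \<in> {0..1}" "\<tau> \<longlonglongrightarrow> t" "\<sigma> \<longlonglongrightarrow> q"
        "\<And>n::nat. \<tau> n \<in> {0..1} \<and> \<sigma> n \<in> M \<and> X (\<sigma> n) = G (?s (\<tau> n)) \<and> Y (\<sigma> n) = ?s (\<tau> n)" for q t \<sigma> \<tau>
    proof (rule LIMSEQ_unique)
      show "(\<lambda>n. Y (\<sigma> n)) \<longlonglongrightarrow> Y q"
        by (rule continuous_on_tendsto_compose[OF Ycont that(4,1)]) (use that(5) in auto)
      have "(\<lambda>n. ?s (\<tau> n)) \<longlonglongrightarrow> ?s t"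
        by (rule continuous_on_tendsto_compose[OF seg_cont[of UNIV] that(3)]) auto
      then show "(\<lambda>n. Y (\<sigma> n)) \<longlonglongrightarrow> ?s t" using that(5) by simp
    qed
  qed blast
  then show ?thesis using that by blast
qed

lemma segment_lift_unique:
  assumes "continuous_on {0..1} l" "\<And>s. s \<in> {0..1} \<Longrightarrow> l s \<in> M \<and> Y (l s) = seg a v s"
    and "continuous_on {0..1} l'" "\<And>s. s \<in> {0..1} \<Longrightarrow> l' s \<in> M \<and> Y (l' s) = seg a v s"
    and "l 0 = l' 0" "s \<in> {0..1}"
  shows "l s = l' s"
  by (rule lift_unique[of "{0..1}" l l' M Y 0]) (use assms Y_locally_injective in auto)

text \<open>A neighbourhood of part of a segment, convex like the segment itself; intersections of
  tubes are therefore connected, as gluing of sections requires.\<close>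

definition tube :: "real^2 \<Rightarrow> real^2 \<Rightarrow> real \<Rightarrow> real \<Rightarrow> real \<Rightarrow> (real^2) set"
  where "tube u v a b e = {z. \<exists>t\<in>{a..b}. dist z (seg u v t) < e}"

lemma open_tube: "open (tube u v a b e)"
proof -
  have "tube u v a b e = (\<Union>t\<in>{a..b}. ball (seg u v t) e)" unfolding tube_def by (auto simp: dist_commute)
  then show ?thesis by auto
qed

lemma convex_tube: "convex (tube u v a b e)"
proof (rule convexI)
  fix x y and \<alpha> \<beta> :: real
  assume "x \<in> tube u v a b e" "y \<in> tube u v a b e" and ab: "0 \<le> \<alpha>" "0 \<le> \<beta>" "\<alpha> + \<beta> = 1"
  then obtain s t where s: "s \<in> {a..b}" "dist x (seg u v s) < e" and t: "t \<in> {a..b}" "dist y (seg u v t) < e"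
    unfolding tube_def by auto
  have "\<alpha> * s + \<beta> * t \<in> {a..b}"
    using convexD[OF convex_closed_interval s(1) t(1) ab] unfolding cbox_interval by (simp add: convex_real_interval)
  moreover have "dist (\<alpha> *\<^sub>R x + \<beta> *\<^sub>R y) (seg u v (\<alpha> * s + \<beta> * t)) < e"
  proof -
    have "seg u v (\<alpha> * s + \<beta> * t) = \<alpha> *\<^sub>R seg u v s + \<beta> *\<^sub>R seg u v t"
    proof -
      have "u = \<alpha> *\<^sub>R u + \<beta> *\<^sub>R u" using ab(3) by (metis scaleR_add_left scaleR_one)
      then show ?thesis unfolding seg_def by (simp add: algebra_simps)
    qed
    then have "\<alpha> *\<^sub>R x + \<beta> *\<^sub>R y - seg u v (\<alpha> * s + \<beta> * t) = \<alpha> *\<^sub>R (x - seg u v s) + \<beta> *\<^sub>R (y - seg u v t)"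
      by (simp add: algebra_simps)
    moreover have "x - seg u v s \<in> ball 0 e" "y - seg u v t \<in> ball 0 e"
      using s(2) t(2) unfolding mem_ball_0 by (simp_all add: dist_norm)
    ultimately have "\<alpha> *\<^sub>R x + \<beta> *\<^sub>R y - seg u v (\<alpha> * s + \<beta> * t) \<in> ball 0 e"
      using convexD[OF convex_ball _ _ ab] by metis
    then show ?thesis unfolding mem_ball_0 by (simp add: dist_norm)
  qed
  ultimately show "\<alpha> *\<^sub>R x + \<beta> *\<^sub>R y \<in> tube u v a b e" unfolding tube_def by auto
qed

lemma section_unique:
  assumes C: "connected C" "continuous_on C \<Gamma>" "continuous_on C \<Gamma>'"
    and "\<And>z. z \<in> C \<Longrightarrow> \<Gamma> z \<in> M \<and> Y (\<Gamma> z) = z" "\<And>z. z \<in> C \<Longrightarrow> \<Gamma>' z \<in> M \<and> Y (\<Gamma>' z) = z"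
    and "z0 \<in> C" "\<Gamma> z0 = \<Gamma>' z0" "z \<in> C"
  shows "\<Gamma> z = \<Gamma>' z"
  by (rule lift_unique[of C \<Gamma> \<Gamma>' M Y z0]) (use assms Y_locally_injective in auto)

text \<open>This gives continuous dependence of a lifted segment on its end point. It is proved by
  bisection: sections over adjacent tubes can be glued, and over a short tube a single chart
  suffices.\<close>

lemma tube_section:
  assumes l: "continuous_on {0..1} l" "\<And>s. s \<in> {0..1} \<Longrightarrow> l s \<in> M \<and> Y (l s) = seg u v s"
  shows "\<exists>e>0. \<exists>\<Gamma>. continuous_on (tube u v 0 1 e) \<Gamma> \<and> (\<forall>z\<in>tube u v 0 1 e. \<Gamma> z \<in> M \<and> Y (\<Gamma> z) = z)
    \<and> (\<forall>t\<in>{0..1}. \<Gamma> (seg u v t) = l t)"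
proof -
  \<comment> \<open>The range condition sits inside \<open>P\<close>, since the bisection principle
    also tests small intervals that stick out of the unit interval.\<close>
  define P where "P a b \<longleftrightarrow> (0 \<le> a \<and> a \<le> b \<and> b \<le> 1 \<longrightarrow>
     (\<exists>e>0. \<exists>\<Gamma>. continuous_on (tube u v a b e) \<Gamma> \<and> (\<forall>z\<in>tube u v a b e. \<Gamma> z \<in> M \<and> Y (\<Gamma> z) = z)
    \<and> (\<forall>t\<in>{a..b}. \<Gamma> (seg u v t) = l t)))" for a b :: real
  have mono: "tube u v a b e \<subseteq> tube u v a b e'" if "e \<le> e'" for a b e e' using that unfolding tube_def by force
  have "P 0 1"
  proof (rule Bolzano)
    fix a b c assume trans: "P a b" "P b c" "a \<le> b" "b \<le> c"
    show "P a c"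
      unfolding P_def
    proof (intro impI)
      assume ac: "0 \<le> a \<and> a \<le> c \<and> c \<le> 1"
      obtain e1 \<Gamma>1 where 1: "e1 > 0" "continuous_on (tube u v a b e1) \<Gamma>1"
        "\<And>z. z \<in> tube u v a b e1 \<Longrightarrow> \<Gamma>1 z \<in> M \<and> Y (\<Gamma>1 z) = z" "\<And>t. t \<in> {a..b} \<Longrightarrow> \<Gamma>1 (seg u v t) = l t"
        using trans ac unfolding P_def by (smt (verit, best))
      obtain e2 \<Gamma>2 where 2: "e2 > 0" "continuous_on (tube u v b c e2) \<Gamma>2"
        "\<And>z. z \<in> tube u v b c e2 \<Longrightarrow> \<Gamma>2 z \<in> M \<and> Y (\<Gamma>2 z) = z" "\<And>t. t \<in> {b..c} \<Longrightarrow> \<Gamma>2 (seg u v t) = l t"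
        using trans ac unfolding P_def by (smt (verit, best))
      define e where "e = min e1 e2"
      have e: "e > 0" "e \<le> e1" "e \<le> e2" unfolding e_def using 1 2 by auto
      define A where "A = tube u v a b e"
      define B where "B = tube u v b c e"
      have A: "A \<subseteq> tube u v a b e1" and B: "B \<subseteq> tube u v b c e2" unfolding A_def B_def using mono e by auto
      have segA: "seg u v t \<in> A" if "t \<in> {a..b}" for t unfolding A_def tube_def using that e by force
      have segB: "seg u v t \<in> B" if "t \<in> {b..c}" for t unfolding B_def tube_def using that e by force
      have AB: "A \<union> B = tube u v a c e"
      proof
        show "tube u v a c e \<subseteq> A \<union> B"
        proof
          fix z assume "z \<in> tube u v a c e"
          then obtain t where t: "t \<in> {a..c}" "dist z (seg u v t) < e" unfolding tube_def by auto
          then have "t \<in> {a..b} \<or> t \<in> {b..c}" by auto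
          then show "z \<in> A \<union> B" using t(2) unfolding A_def B_def tube_def by blast
        qed
        show "A \<union> B \<subseteq> tube u v a c e" unfolding A_def B_def tube_def using trans by force
      qed
      define \<Gamma> where "\<Gamma> z = (if z \<in> A then \<Gamma>1 z else \<Gamma>2 z)" for z
      have bA: "seg u v b \<in> A \<inter> B" using segA[of b] segB[of b] trans by auto
      \<comment> \<open>The overlap of the tubes is convex and contains the division point of the
        segment, where both sections follow the lift \<open>l\<close>.\<close>
      have agree: "\<Gamma>1 z = \<Gamma>2 z" if "z \<in> A \<inter> B" for z
      proof (rule section_unique[of "A \<inter> B" \<Gamma>1 \<Gamma>2 "seg u v b"])
        show "connected (A \<inter> B)" unfolding A_def B_def by (intro convex_connected convex_Int convex_tube)
        show "continuous_on (A \<inter> B) \<Gamma>1" "continuous_on (A \<inter> B) \<Gamma>2"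
          using A B by (auto intro: continuous_on_subset[OF 1(2)] continuous_on_subset[OF 2(2)])
        show "\<Gamma>1 (seg u v b) = \<Gamma>2 (seg u v b)" using 1(4)[of b] 2(4)[of b] trans by auto
      qed (use that A B 1(3) 2(3) bA in auto)
      have \<Gamma>B: "\<Gamma> z = \<Gamma>2 z" if "z \<in> B" for z using agree that unfolding \<Gamma>_def by auto
      have \<Gamma>A: "\<Gamma> z = \<Gamma>1 z" if "z \<in> A" for z using that unfolding \<Gamma>_def by auto
      have "continuous_on (A \<union> B) \<Gamma>"
      proof (rule continuous_on_open_Un)
        show "open A" "open B" unfolding A_def B_def by (auto simp: open_tube)
        show "continuous_on A \<Gamma>" by (rule continuous_on_eq[OF continuous_on_subset[OF 1(2) A]]) (simp add: \<Gamma>A)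
        show "continuous_on B \<Gamma>" by (rule continuous_on_eq[OF continuous_on_subset[OF 2(2) B]]) (simp add: \<Gamma>B)
      qed
      moreover have "\<Gamma> z \<in> M \<and> Y (\<Gamma> z) = z" if "z \<in> A \<union> B" for z
        using that \<Gamma>A[of z] \<Gamma>B[of z] 1(3)[of z] 2(3)[of z] A B by auto
      moreover have "\<Gamma> (seg u v t) = l t" if "t \<in> {a..c}" for t
      proof (cases "t \<le> b")
        case True then show ?thesis using that \<Gamma>A[OF segA] 1(4) by auto
      next
        case False then show ?thesis using that \<Gamma>B[OF segB] 2(4) by auto
      qed
      ultimately show "\<exists>e>0. \<exists>\<Gamma>. continuous_on (tube u v a c e) \<Gamma> \<and> (\<forall>z\<in>tube u v a c e. \<Gamma> z \<in> M \<and> Y (\<Gamma> z) = z)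
        \<and> (\<forall>t\<in>{a..c}. \<Gamma> (seg u v t) = l t)"
        unfolding AB using e(1) by blast
    qed
  next
    fix x :: real assume "0 \<le> x" "x \<le> 1"
    then have x: "x \<in> {0..1}" by auto
    obtain D f where f: "open D" "continuous_on D f" "f ` D \<subseteq> M" "l x \<in> f ` D" "\<And>y. y \<in> D \<Longrightarrow> Y (f y) = y"
        "openin (top_of_set M) (f ` D)"
      using sect[of "l x"] l(2)[OF x] by blast
    obtain W where W: "open W" "f ` D = M \<inter> W" using f(6) by (auto simp: openin_open)
    have "seg u v x \<in> D" using f(4,5) l(2)[OF x] by force
    then obtain e where e: "e > 0" "ball (seg u v x) e \<subseteq> D" using f(1) openE by blast
    have fs: "f (seg u v s) = l s" if "s \<in> {0..1}" "l s \<in> W" for s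
    proof -
      have "l s \<in> f ` D" using W l(2)[OF that(1)] that by auto
      then show ?thesis using f(5) l(2)[OF that(1)] by force
    qed
    obtain d1 where d1: "d1 > 0" "\<And>s. s \<in> {0..1} \<Longrightarrow> dist s x < d1 \<Longrightarrow> l s \<in> W"
    proof -
      have "openin (top_of_set {0..1}) ({0..1} \<inter> l -` W)" using continuous_openin_preimage_gen[OF l(1) W(1)] .
      moreover have "x \<in> {0..1} \<inter> l -` W" using x f(4) W by auto
      ultimately obtain d where "d > 0" "ball x d \<inter> {0..1} \<subseteq> {0..1} \<inter> l -` W"
        unfolding openin_contains_ball by blast
      then show ?thesis using that[of d] by (auto simp: dist_commute subset_iff)
    qed
    obtain d2 where d2: "d2 > 0" "\<And>s. dist s x < d2 \<Longrightarrow> dist (seg u v s) (seg u v x) < e / 2"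
      using seg_cont[of UNIV u v] e(1) unfolding continuous_on_iff by (metis UNIV_I half_gt_zero)
    show "\<exists>d>0. \<forall>a b. a \<le> x \<and> x \<le> b \<and> b - a < d \<longrightarrow> P a b"
    proof (intro exI[of _ "min d1 d2"] conjI allI impI)
      fix a b assume ab: "a \<le> x \<and> x \<le> b \<and> b - a < min d1 d2"
      show "P a b" unfolding P_def
      proof (intro impI exI[of _ "e/2"] conjI exI[of _ f] ballI)
        assume ab': "0 \<le> a \<and> a \<le> b \<and> b \<le> 1"
        have tD: "tube u v a b (e/2) \<subseteq> D"
        proof
          fix z assume "z \<in> tube u v a b (e/2)"
          then obtain t where t: "t \<in> {a..b}" "dist z (seg u v t) < e/2" unfolding tube_def by auto
          have "dist (seg u v t) (seg u v x) < e/2" using t(1) ab by (intro d2) (auto simp: dist_real_def)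
          then have "dist z (seg u v x) < e" using t(2) dist_triangle_half_l[of z _ e] by (metis dist_commute)
          then show "z \<in> D" using e(2) by (auto simp: dist_commute)
        qed
        show "continuous_on (tube u v a b (e/2)) f" using f(2) tD by (rule continuous_on_subset)
        show "f z \<in> M" "Y (f z) = z" if "z \<in> tube u v a b (e/2)" for z using that tD f(3,5) by auto
        show "f (seg u v t) = l t" if "t \<in> {a..b}" for t
          using that ab ab' by (intro fs d1) (auto simp: dist_real_def)
      qed (use e in auto)
    qed (use d1 d2 in auto)
  qed simp
  then show ?thesis unfolding P_def by simp
qed

text \<open>The end points \<open>E v\<close> of radial lifts from a base point form a global
  section of \<open>Y\<close>, which gives surjectivity. Injectivity amounts to E(Y p) = p for all
  p, a condition shown to be open and closed and true at the base point.\<close>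

proposition developing_bijective: "bij_betw Y M \<Omega>"
proof -
  obtain p0 where p0: "p0 \<in> M" using ne by auto
  define u where "u = Y p0"
  define L where "L v = (SOME l. continuous_on {0..1} l \<and> l 0 = p0 \<and> (\<forall>s\<in>{0..1}. l s \<in> M \<and> Y (l s) = seg u v s))" for v
  have L: "continuous_on {0..1} (L v)" "L v 0 = p0" "\<And>s. s \<in> {0..1} \<Longrightarrow> L v s \<in> M \<and> Y (L v s) = seg u v s"
    if v: "v \<in> \<Omega>" for v
  proof -
    have "\<exists>l. continuous_on {0..1} l \<and> l 0 = p0 \<and> (\<forall>s\<in>{0..1}. l s \<in> M \<and> Y (l s) = seg u v s)"
      using segment_lift[OF p0 v] unfolding u_def by metis
    from someI_ex[OF this] show "continuous_on {0..1} (L v)" "L v 0 = p0"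
      "\<And>s. s \<in> {0..1} \<Longrightarrow> L v s \<in> M \<and> Y (L v s) = seg u v s"
      unfolding L_def[symmetric] by auto
  qed
  define E where "E v = L v 1" for v
  have EM: "E v \<in> M \<and> Y (E v) = v" if "v \<in> \<Omega>" for v using L(3)[OF that, of 1] unfolding E_def by simp
  \<comment> \<open>Near a given point two sections are compared over a small disc, the radial one
    and the inverse of a chart. By uniqueness they agree everywhere on the disc or nowhere, which
    settles openness and closedness together.\<close>
  have nbhd: "\<exists>T. openin (top_of_set M) T \<and> p \<in> T \<and> ((\<forall>q\<in>T. E (Y q) = q) \<or> (\<forall>q\<in>T. E (Y q) \<noteq> q))" if p: "p \<in> M" for p
  proof -
    define v where "v = Y p"
    have v: "v \<in> \<Omega>" unfolding v_def using YM p by auto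
    obtain e \<Gamma> where e: "e > 0" and \<Gamma>: "continuous_on (tube u v 0 1 e) \<Gamma>"
      "\<And>z. z \<in> tube u v 0 1 e \<Longrightarrow> \<Gamma> z \<in> M \<and> Y (\<Gamma> z) = z" "\<And>t. t \<in> {0..1} \<Longrightarrow> \<Gamma> (seg u v t) = L v t"
      using tube_section[of "L v" u v, OF L(1)[OF v] L(3)[OF v]] by blast
    have ball: "ball v e \<subseteq> tube u v 0 1 e"
      unfolding tube_def by (auto intro!: bexI[of _ 1] simp: dist_commute)
    have ut: "u \<in> tube u v 0 1 e" unfolding tube_def using e by (auto intro!: bexI[of _ 0])
    \<comment> \<open>The section over the tube, restricted to the segment from \<open>u\<close> to
      \<open>z\<close>, is a lift from the base point, hence the radial lift.\<close>
    have E\<Gamma>: "E z = \<Gamma> z" if z: "z \<in> ball v e" for z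
    proof -
      have z\<Omega>: "z \<in> \<Omega>" using \<Gamma>(2)[of z] z ball YM by force
      have st: "seg u z s \<in> tube u v 0 1 e" if "s \<in> {0..1}" for s
        using seg_in[OF convex_tube ut _ that] z ball by auto
      have "L z 1 = (\<Gamma> \<circ> seg u z) 1"
      proof (rule segment_lift_unique)
        show "continuous_on {0..1} (\<Gamma> \<circ> seg u z)"
          by (intro continuous_on_compose seg_cont continuous_on_subset[OF \<Gamma>(1)]) (use st in auto)
        show "L z 0 = (\<Gamma> \<circ> seg u z) 0" using L(2)[OF z\<Omega>] L(2)[OF v] \<Gamma>(3)[of 0] by simp
      qed (use L[OF z\<Omega>] \<Gamma>(2) st in auto)
      then show ?thesis unfolding E_def by simp
    qed
    obtain D f where f: "open D" "continuous_on D f" "f ` D \<subseteq> M" "p \<in> f ` D" "\<And>y. y \<in> D \<Longrightarrow> Y (f y) = y"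
       "\<And>D'. open D' \<Longrightarrow> D' \<subseteq> D \<Longrightarrow> openin (top_of_set M) (f ` D')"
      using sect[OF p] by blast
    have vD: "v \<in> D" "f v = p" using f(4,5) unfolding v_def by force+
    obtain e' where e': "e' > 0" "ball v e' \<subseteq> D" using f(1) vD openE by blast
    define B where "B = ball v (min e e')"
    have B: "B \<subseteq> ball v e" "B \<subseteq> D" "v \<in> B" using e e' unfolding B_def by auto
    have fB: "E (Y q) = q \<longleftrightarrow> \<Gamma> y = f y" if "y \<in> B" "q = f y" for y q
      using that E\<Gamma>[OF subsetD[OF B(1) that(1)]] f(5)[OF subsetD[OF B(2) that(1)]] by simp
    have all: "\<Gamma> z = f z" if "y \<in> B" "\<Gamma> y = f y" "z \<in> B" for y z
    proof (rule section_unique[of B \<Gamma> f y])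
      show "connected B" unfolding B_def by (intro convex_connected) simp
      show "continuous_on B \<Gamma>" using \<Gamma>(1) B(1) ball by (metis continuous_on_subset subset_trans)
      show "continuous_on B f" using f(2) B(2) by (rule continuous_on_subset)
      show "\<Gamma> x \<in> M \<and> Y (\<Gamma> x) = x" "f x \<in> M \<and> Y (f x) = x" if "x \<in> B" for x
        using that \<Gamma>(2)[of x] B ball f(3) f(5)[of x] by blast+
    qed (use that in auto)
    have "(\<forall>q\<in>f ` B. E (Y q) = q) \<or> (\<forall>q\<in>f ` B. E (Y q) \<noteq> q)" using fB all by blast
    moreover have "openin (top_of_set M) (f ` B)" by (rule f(6)) (use B in \<open>auto simp: B_def\<close>)
    moreover have "p \<in> f ` B" using vD B by auto
    ultimately show ?thesis by blast
  qed
  define Z where "Z = {p \<in> M. E (Y p) = p}"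
  have "openin (top_of_set M) Z" unfolding openin_subopen[of _ Z]
  proof
    fix p assume p: "p \<in> Z"
    then obtain T where T: "openin (top_of_set M) T" "p \<in> T" "(\<forall>q\<in>T. E (Y q) = q) \<or> (\<forall>q\<in>T. E (Y q) \<noteq> q)"
      using nbhd unfolding Z_def by blast
    then show "\<exists>T. openin (top_of_set M) T \<and> p \<in> T \<and> T \<subseteq> Z"
      using p openin_imp_subset[OF T(1)] unfolding Z_def by blast
  qed
  moreover have "openin (top_of_set M) (M - Z)" unfolding openin_subopen[of _ "M - Z"]
  proof
    fix p assume p: "p \<in> M - Z"
    then obtain T where T: "openin (top_of_set M) T" "p \<in> T" "(\<forall>q\<in>T. E (Y q) = q) \<or> (\<forall>q\<in>T. E (Y q) \<noteq> q)"
      using nbhd by blast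
    then show "\<exists>T. openin (top_of_set M) T \<and> p \<in> T \<and> T \<subseteq> M - Z"
      using p openin_imp_subset[OF T(1)] unfolding Z_def by blast
  qed
  moreover have "Z \<subseteq> M" unfolding Z_def by auto
  ultimately have "Z = {} \<or> Z = M" using con unfolding connected_clopen closedin_def by simp
  moreover have "p0 \<in> Z"
  proof -
    have u: "u \<in> \<Omega>" unfolding u_def using YM p0 by auto
    have "L u 1 = (\<lambda>_. p0) 1"
      by (rule segment_lift_unique[of "L u" u u "\<lambda>_. p0"]) (use L[OF u] p0 in \<open>auto simp: seg_def u_def\<close>)
    then show ?thesis unfolding Z_def E_def u_def using p0 by simp
  qed
  ultimately have ZM: "Z = M" by auto
  have "inj_on Y M"
  proof (rule inj_onI)
    fix p q assume "p \<in> M" "q \<in> M" "Y p = Y q"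
    then show "p = q" using ZM unfolding Z_def by (metis (mono_tags, lifting) mem_Collect_eq)
  qed
  moreover have "Y ` M = \<Omega>" using YM EM by force
  ultimately show ?thesis unfolding bij_betw_def by simp
qed

end

section \<open>The graph equation and its rulings\<close>

lemma smooth_on_add: "open S \<Longrightarrow> smooth_on S f \<Longrightarrow> smooth_on S g \<Longrightarrow> smooth_on S (\<lambda>x. f x + g x)"
  by (simp add: smooth_on_def Ck_on_add)

lemma smooth_on_mult:
  fixes f g :: "'a::euclidean_space \<Rightarrow> real"
  shows "open S \<Longrightarrow> smooth_on S f \<Longrightarrow> smooth_on S g \<Longrightarrow> smooth_on S (\<lambda>x. f x * g x)"
  by (simp add: smooth_on_def Ck_on_mult)

lemma smooth_on_minus: "open S \<Longrightarrow> smooth_on S f \<Longrightarrow> smooth_on S (\<lambda>x. - f x)"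
  by (simp add: smooth_on_def Ck_on_minus)

lemma smooth_on_inverse:
  fixes f :: "'a::euclidean_space \<Rightarrow> real"
  shows "open S \<Longrightarrow> smooth_on S f \<Longrightarrow> (\<And>x. x \<in> S \<Longrightarrow> f x \<noteq> 0) \<Longrightarrow> smooth_on S (\<lambda>x. inverse (f x))"
  by (simp add: smooth_on_def Ck_on_inverse)

lemma smooth_real_deriv:
  fixes f :: "real \<Rightarrow> real"
  assumes "smooth_on UNIV f"
  shows "(f has_real_derivative deriv f z) (at z)" "smooth_on UNIV (deriv f)"
proof -
  have *: "(f has_real_derivative frechet_derivative f (at z) 1) (at z)" for z
  proof -
    have d: "(f has_derivative frechet_derivative f (at z)) (at z)"
      using smooth_on_has_derivative[OF assms] by simp
    have "frechet_derivative f (at z) = (*) (frechet_derivative f (at z) 1)"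
    proof
      fix h show "frechet_derivative f (at z) h = frechet_derivative f (at z) 1 * h"
        using linear_scale[OF has_derivative_linear[OF d], of h 1] by (simp add: mult.commute)
    qed
    then show ?thesis unfolding has_field_derivative_def using d by metis
  qed
  then have e: "deriv f = (\<lambda>z. frechet_derivative f (at z) 1)" by (auto intro: DERIV_imp_deriv)
  show "(f has_real_derivative deriv f z) (at z)" unfolding e by (rule *)
  show "smooth_on UNIV (deriv f)" unfolding e by (rule smooth_on_derivative[OF assms])
qed

lemma pd_add:
  assumes "smooth_on D f" "smooth_on D g" "y \<in> D"
  shows "pd k (\<lambda>y. f y + g y) y = pd k f y + pd k g y"
  using pd_eqI[OF has_derivative_add[OF smooth_on_has_derivative[OF assms(1,3)] smooth_on_has_derivative[OF assms(2,3)]]]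
  by (simp add: pd_def)

lemma pd_mult:
  assumes "smooth_on D f" "smooth_on D g" "y \<in> D"
  shows "pd k (\<lambda>y. f y * g y) y = f y * pd k g y + pd k f y * g y"
  using pd_eqI[OF has_derivative_mult[OF smooth_on_has_derivative[OF assms(1,3)] smooth_on_has_derivative[OF assms(2,3)]]]
  by (simp add: pd_def)

lemma pd_minus:
  assumes "smooth_on D f" "y \<in> D"
  shows "pd k (\<lambda>y. - f y) y = - pd k f y"
  using pd_eqI[OF has_derivative_minus[OF smooth_on_has_derivative[OF assms]]] by (simp add: pd_def)

lemma pd_compose:
  assumes "smooth_on D f" "y \<in> D" "(g has_real_derivative g') (at (f y))"
  shows "pd k (\<lambda>y. g (f y)) y = g' * pd k f y"
  using pd_eqI[OF has_derivative_compose[OF smooth_on_has_derivative[OF assms(1,2)] assms(3)[unfolded has_field_derivative_def]]]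
  by (simp add: pd_def)

lemma pd_const: "pd k (\<lambda>y. c) y = 0"
  by (rule pd_eqI[where w'="\<lambda>_. 0"]) simp

lemma pd_const_on:
  assumes "open D" "y \<in> D" "\<And>z. z \<in> D \<Longrightarrow> w z = c"
  shows "pd k w y = 0"
  using pd_cong[OF assms(1,2), of w "\<lambda>_. c" k] assms(3) pd_const by simp

lemma has_derivative_pd:
  assumes "smooth_on D w" "y \<in> D" "i \<noteq> (j::2)"
  shows "(w has_derivative (\<lambda>v. v$i * pd i w y + v$j * pd j w y)) (at y)"
proof -
  have "(i = 1 \<and> j = 2) \<or> (i = 2 \<and> j = 1)" using assms(3) exhaust_2[of i] exhaust_2[of j] by auto
  then show ?thesis using pd_has_derivative[OF assms(1,2)] by (auto simp: add.commute)
qed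

lemma line_derivative:
  assumes "smooth_on D f" "y + t *\<^sub>R n \<in> D" "i \<noteq> (j::2)"
  shows "((\<lambda>t. f (y + t *\<^sub>R n)) has_real_derivative
     (n$i * pd i f (y + t *\<^sub>R n) + n$j * pd j f (y + t *\<^sub>R n))) (at t)"
proof -
  have "((\<lambda>t. y + t *\<^sub>R n) has_derivative (\<lambda>h. h *\<^sub>R n)) (at t)" by (auto intro!: derivative_eq_intros)
  from has_derivative_compose[OF this has_derivative_pd[OF assms]]
  show ?thesis unfolding has_field_derivative_def
    by (rule has_derivative_eq_rhs) (simp add: fun_eq_iff algebra_simps)
qed

lemma pd_zero_imp_const:
  assumes "convex D" "open D" "smooth_on D f" "i \<noteq> (j::2)" "\<And>y. y \<in> D \<Longrightarrow> pd i f y = 0" "\<And>y. y \<in> D \<Longrightarrow> pd j f y = 0"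
    "y \<in> D" "z \<in> D"
  shows "f y = f z"
proof -
  have "(f has_derivative (\<lambda>h. 0)) (at x within D)" if "x \<in> D" for x
    using has_derivative_pd[OF assms(3) that assms(4)] assms(5,6)[OF that] by (simp add: has_derivative_at_withinI)
  from has_derivative_zero_constant[OF assms(1) this] obtain c where "\<And>x. x \<in> D \<Longrightarrow> f x = c" by blast
  then show ?thesis using assms(7,8) by simp
qed

section \<open>The equations over the horizontal plane and the rank-one Hessian\<close>

locale soliton_graph =
  fixes \<phi> :: "real \<Rightarrow> real" and D :: "(real^2) set" and w :: "real^2 \<Rightarrow> real" and i j :: 2
  assumes \<phi>: "smooth_on UNIV \<phi>" and \<phi>pos: "\<And>z. deriv \<phi> z > 0"
    and D: "open D" and w: "smooth_on D w" and ij: "i \<noteq> j"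
    and MA: "\<And>y. y \<in> D \<Longrightarrow> pd i (pd i w) y * pd j (pd j w) y = (pd i (pd j w) y)\<^sup>2"
    and PDE: "\<And>y. y \<in> D \<Longrightarrow> (1 + (pd j w y)\<^sup>2) * pd i (pd i w) y - 2 * pd i w y * pd j w y * pd i (pd j w) y
      + (1 + (pd i w y)\<^sup>2) * pd j (pd j w) y = deriv \<phi> (w y) * (1 + (pd i w y)\<^sup>2 + (pd j w y)\<^sup>2)"
begin

abbreviation "p \<equiv> pd i w"
abbreviation "q \<equiv> pd j w"
abbreviation "A \<equiv> pd i p"
abbreviation "B \<equiv> pd i q"
abbreviation "C \<equiv> pd j q"

lemma smooth: "smooth_on D p" "smooth_on D q" "smooth_on D A" "smooth_on D B" "smooth_on D C"
  by (intro smooth_on_pd w)+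

lemma pjp: "y \<in> D \<Longrightarrow> pd j p y = B y"
  by (rule pd_commute[OF D w])

text \<open>A Hessian with null vector (m, 1) is \<open>A\<close> times the square of the form (1,
  -m), and minimality then equates a positive multiple of \<open>A\<close> with a positive number.
  This recovers strict positivity at limit points, where only closed conditions survive.\<close>

lemma null_imp_pos:
  assumes y: "y \<in> D" and n: "B y + m * A y = 0" "C y + m * B y = 0"
  shows "A y > 0"
proof -
  have e1: "B y = - m * A y" using n(1) by simp
  have "C y = - m * B y" using n(2) by simp
  then have e: "B y = - m * A y" "C y = m * m * A y" using e1 by simp_all
  have "A y * ((1 + m\<^sup>2) + (q y + p y * m)\<^sup>2) = deriv \<phi> (w y) * (1 + (p y)\<^sup>2 + (q y)\<^sup>2)"
    using PDE[OF y] unfolding e by (simp add: power2_eq_square algebra_simps)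
  moreover have "deriv \<phi> (w y) * (1 + (p y)\<^sup>2 + (q y)\<^sup>2) > 0"
    using \<phi>pos by (intro mult_pos_pos) (auto simp: add_pos_nonneg)
  moreover have "(1 + m\<^sup>2) + (q y + p y * m)\<^sup>2 > 0" by (simp add: add_pos_nonneg)
  ultimately show ?thesis by (metis zero_less_mult_pos2)
qed

text \<open>If neither were positive, the vanishing determinant would give |B| = sqrt(-A) sqrt(-C),
  and the inequality between arithmetic and geometric mean would bound the left side of the equation
  by A + C \<le> 0, against the positive right side.\<close>

lemma pos_cases:
  assumes y: "y \<in> D"
  shows "A y > 0 \<or> C y > 0"
proof (rule ccontr)
  assume "\<not> ?thesis"
  then have le: "A y \<le> 0" "C y \<le> 0" by auto
  have pos: "deriv \<phi> (w y) * (1 + (p y)\<^sup>2 + (q y)\<^sup>2) > 0"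
    using \<phi>pos by (intro mult_pos_pos) (auto simp: add_pos_nonneg)
  have B: "\<bar>B y\<bar> = sqrt (- A y) * sqrt (- C y)"
    using MA[OF y] by (metis minus_mult_minus real_sqrt_abs real_sqrt_mult)
  have "(sqrt (- A y))\<^sup>2 = - A y" "(sqrt (- C y))\<^sup>2 = - C y" using le by auto
  moreover have "\<bar>2 * p y * q y * B y\<bar> = 2 * \<bar>(p y * sqrt (- C y)) * (q y * sqrt (- A y))\<bar>"
    unfolding abs_mult B using le by (simp add: mult_ac)
  moreover have "2 * \<bar>(p y * sqrt (- C y)) * (q y * sqrt (- A y))\<bar> \<le> (p y * sqrt (- C y))\<^sup>2 + (q y * sqrt (- A y))\<^sup>2"
    using sum_squares_bound[of "\<bar>p y * sqrt (- C y)\<bar>" "\<bar>q y * sqrt (- A y)\<bar>"] by (simp add: abs_mult mult_ac power_mult_distrib)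
  ultimately have "\<bar>2 * p y * q y * B y\<bar> \<le> - (p y)\<^sup>2 * C y - (q y)\<^sup>2 * A y"
    by (simp add: power_mult_distrib)
  then have "(1 + (q y)\<^sup>2) * A y - 2 * p y * q y * B y + (1 + (p y)\<^sup>2) * C y \<le> A y + C y"
    by (simp add: algebra_simps abs_le_iff)
  then show False using PDE[OF y] pos le by linarith
qed

lemma soliton_graph_subset:
  assumes "open D'" "D' \<subseteq> D"
  shows "soliton_graph \<phi> D' w i j"
  using assms ij by unfold_locales (auto intro: smooth_on_subset[OF w] \<phi> \<phi>pos MA PDE)

text \<open>The indices are kept abstract so that the coordinate whose pure second derivative is
  positive can always be called \<open>i\<close>.\<close>

lemma soliton_graph_swap: "soliton_graph \<phi> D w j i"
proof
  fix y assume y: "y \<in> D"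
  show "pd j (pd j w) y * pd i (pd i w) y = (pd j (pd i w) y)\<^sup>2"
    using MA[OF y] pjp[OF y] by (simp add: mult.commute)
  show "(1 + (pd i w y)\<^sup>2) * pd j (pd j w) y - 2 * pd j w y * pd i w y * pd j (pd i w) y +
         (1 + (pd j w y)\<^sup>2) * pd i (pd i w) y = deriv \<phi> (w y) * (1 + (pd j w y)\<^sup>2 + (pd i w y)\<^sup>2)"
    using PDE[OF y] pjp[OF y] by (simp add: algebra_simps)
qed (use \<phi> \<phi>pos D w ij in auto)

end

locale convex_soliton_graph = soliton_graph +
  assumes Apos: "\<And>y. y \<in> D \<Longrightarrow> A y > 0"
begin

text \<open>
  The null direction of the Hessian, in which the ruling runs, is \<open>e\<^sub>j + m e\<^sub>i\<close>; \<open>\<kappa>\<close> is the derivative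
  of \<open>w\<close> in this direction.
\<close>

definition m :: "real^2 \<Rightarrow> real" where "m y = - (B y * inverse (A y))"
definition \<kappa> :: "real^2 \<Rightarrow> real" where "\<kappa> y = q y + m y * p y"

lemma smooth_m: "smooth_on D m"
  unfolding m_def[abs_def]
  by (intro smooth_on_minus smooth_on_mult smooth_on_inverse D smooth) (use Apos in force)

lemma smooth_\<kappa>: "smooth_on D \<kappa>"
  unfolding \<kappa>_def[abs_def] by (intro smooth_on_add smooth_on_mult D smooth smooth_m)

lemma B_eq: "y \<in> D \<Longrightarrow> B y = - (m y * A y)"
  unfolding m_def using Apos[of y] by simp

lemma C_eq:
  assumes y: "y \<in> D" shows "C y = m y * (m y * A y)"
proof -
  have "A y * C y = A y * (m y * (m y * A y))"
    using MA[OF y] unfolding B_eq[OF y] by (simp add: power2_eq_square algebra_simps)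
  then show ?thesis using Apos[OF y] by simp
qed

text \<open>The integrability conditions \<partial>j A = \<partial>i B and \<partial>j B =
  \<partial>i C for B = -mA and C = m^2 A: the derivatives of \<open>A\<close> cancel, and A times
  (\<partial>j m + m \<partial>i m) = 0 is left.\<close>

lemma burgers:
  assumes y: "y \<in> D" shows "pd j m y = - m y * pd i m y"
proof -
  have mA: "smooth_on D (\<lambda>y. m y * A y)" by (intro smooth_on_mult D smooth smooth_m)
  have Aj: "pd j A y = - (m y * pd i A y + pd i m y * A y)"
  proof -
    have "pd j A y = pd i (pd j p) y" by (rule pd_commute[OF D smooth(1) y])
    also have "\<dots> = pd i (\<lambda>y. - (m y * A y)) y" by (rule pd_cong[OF D y]) (simp add: pjp B_eq)
    also have "\<dots> = - (m y * pd i A y + pd i m y * A y)"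
      by (simp add: pd_minus[OF mA y] pd_mult[OF smooth_m smooth(3) y])
    finally show ?thesis .
  qed
  have "pd j B y = pd i C y" by (rule pd_commute[OF D smooth(2) y])
  also have "\<dots> = pd i (\<lambda>y. m y * (m y * A y)) y" by (rule pd_cong[OF D y]) (simp add: C_eq)
  also have "\<dots> = m y * (m y * pd i A y + pd i m y * A y) + pd i m y * (m y * A y)"
    by (simp add: pd_mult[OF smooth_m mA y] pd_mult[OF smooth_m smooth(3) y])
  finally have 1: "pd j B y = \<dots>" .
  have "pd j B y = pd j (\<lambda>y. - (m y * A y)) y" by (rule pd_cong[OF D y]) (simp add: B_eq)
  also have "\<dots> = - (m y * pd j A y + pd j m y * A y)"
    by (simp add: pd_minus[OF mA y] pd_mult[OF smooth_m smooth(3) y])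
  finally have "A y * (pd j m y + m y * pd i m y) = 0" unfolding 1 Aj by (simp add: algebra_simps)
  then show ?thesis using Apos[OF y] by (simp add: add_eq_0_iff)
qed

definition Dn :: "(real^2 \<Rightarrow> real) \<Rightarrow> real^2 \<Rightarrow> real" where "Dn f y = pd j f y + m y * pd i f y"

text \<open>\<open>Dn\<close> differentiates in the null direction. Gradient and slope are constant
  along it, hence so are the tangent plane and \<kappa>; the last identity is the Riccati equation
  obtained by differentiating Burgers' equation.\<close>

lemma Dn_simps:
  assumes y: "y \<in> D"
  shows "Dn p y = 0" "Dn q y = 0" "Dn m y = 0" "Dn w y = \<kappa> y" "Dn A y = - pd i m y * A y" "Dn \<kappa> y = 0"
    "Dn (pd i m) y = - (pd i m y)\<^sup>2"
proof -
  show 1: "Dn p y = 0" "Dn q y = 0" unfolding Dn_def pjp[OF y] B_eq[OF y] C_eq[OF y] by simp_all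
  show 2: "Dn m y = 0" unfolding Dn_def burgers[OF y] by simp
  show "Dn w y = \<kappa> y" unfolding Dn_def \<kappa>_def ..
  have mA: "smooth_on D (\<lambda>y. m y * A y)" by (intro smooth_on_mult D smooth smooth_m)
  have "pd j A y = pd i (pd j p) y" by (rule pd_commute[OF D smooth(1) y])
  also have "\<dots> = pd i (\<lambda>y. - (m y * A y)) y" by (rule pd_cong[OF D y]) (simp add: pjp B_eq)
  also have "\<dots> = - (m y * pd i A y + pd i m y * A y)"
    by (simp add: pd_minus[OF mA y] pd_mult[OF smooth_m smooth(3) y])
  finally show "Dn A y = - pd i m y * A y" unfolding Dn_def by simp
  have mp: "smooth_on D (\<lambda>y. m y * p y)" by (intro smooth_on_mult D smooth smooth_m)
  have "Dn \<kappa> y = Dn q y + (m y * Dn p y + Dn m y * p y)"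
    unfolding Dn_def \<kappa>_def[abs_def] pd_add[OF smooth(2) mp y] pd_mult[OF smooth_m smooth(1) y]
    by (simp add: algebra_simps)
  then show "Dn \<kappa> y = 0" using 1 2 by simp
  have mm: "smooth_on D (\<lambda>y. m y * pd i m y)" by (intro smooth_on_mult D smooth_m smooth_on_pd)
  have "pd j (pd i m) y = pd i (pd j m) y" by (rule pd_commute[OF D smooth_m y])
  also have "\<dots> = pd i (\<lambda>y. - (m y * pd i m y)) y" by (rule pd_cong[OF D y]) (simp add: burgers)
  also have "\<dots> = - (m y * pd i (pd i m) y + pd i m y * pd i m y)"
    by (simp add: pd_minus[OF mm y] pd_mult[OF smooth_m smooth_on_pd[OF smooth_m] y])
  finally show "Dn (pd i m) y = - (pd i m y)\<^sup>2" unfolding Dn_def by (simp add: power2_eq_square)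
qed

lemma Dn_mult:
  assumes "smooth_on D f" "smooth_on D g" "y \<in> D"
  shows "Dn (\<lambda>y. f y * g y) y = f y * Dn g y + Dn f y * g y"
  unfolding Dn_def pd_mult[OF assms] by (simp add: algebra_simps)

lemma Dn_add:
  assumes "smooth_on D f" "smooth_on D g" "y \<in> D"
  shows "Dn (\<lambda>y. f y + g y) y = Dn f y + Dn g y"
  unfolding Dn_def pd_add[OF assms] by (simp add: algebra_simps)

lemma Dn_compose:
  assumes "smooth_on UNIV g" "y \<in> D"
  shows "Dn (\<lambda>y. g (w y)) y = deriv g (w y) * \<kappa> y"
  unfolding Dn_def pd_compose[OF w assms(2) smooth_real_deriv(1)[OF assms(1)]] \<kappa>_def
  by (simp add: algebra_simps)

lemma Dn_cong:
  assumes "\<And>y. y \<in> D \<Longrightarrow> f y = g y" "y \<in> D"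
  shows "Dn f y = Dn g y"
  unfolding Dn_def using pd_cong[OF D assms(2), of f g] assms(1) by simp

abbreviation "\<rho> \<equiv> deriv \<phi>"

lemma smooth_\<rho>: "smooth_on UNIV \<rho>" "smooth_on UNIV (deriv \<rho>)"
  using smooth_real_deriv(2)[OF \<phi>] smooth_real_deriv(2) by blast+

lemma smooth_comp: "smooth_on UNIV g \<Longrightarrow> smooth_on D (\<lambda>y. g (w y))"
  by (rule smooth_on_compose[OF D open_UNIV _ w]) auto

lemma PDE_m:
  assumes y: "y \<in> D"
  shows "A y * ((1 + (m y)\<^sup>2) + (\<kappa> y)\<^sup>2) = \<rho> (w y) * (1 + (p y)\<^sup>2 + (q y)\<^sup>2)"
  using PDE[OF y] unfolding B_eq[OF y] C_eq[OF y] \<kappa>_def by (simp add: power2_eq_square algebra_simps)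

text \<open>In \<open>PDE_m\<close> every factor except \<open>A\<close> and \<rho>(w) is constant
  along a ruling. Differentiating in that direction and dividing by the equation itself compares the
  logarithmic derivatives of these two, which are -\<partial>i m and \<rho>' \<kappa> /
  \<rho>.\<close>

lemma slope_derivative:
  assumes y: "y \<in> D"
  shows "pd i m y * \<rho> (w y) = - (deriv \<rho> (w y) * \<kappa> y)"
proof -
  define E where "E y = (1 + m y * m y) + \<kappa> y * \<kappa> y" for y
  define F where "F y = 1 + p y * p y + q y * q y" for y
  have c: "smooth_on D (\<lambda>y. 1)" by (simp add: smooth_on_def Ck_on_const)
  have sE: "smooth_on D E" unfolding E_def[abs_def]
    by (intro smooth_on_add smooth_on_mult D smooth_m smooth_\<kappa> c)
  have sF: "smooth_on D F" unfolding F_def[abs_def]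
    by (intro smooth_on_add smooth_on_mult D smooth c)
  have D1: "Dn (\<lambda>y. 1) y = 0" unfolding Dn_def by (simp add: pd_const)
  have DE: "Dn E y = 0"
  proof -
    have "Dn E y = Dn (\<lambda>y. 1) y + Dn (\<lambda>y. m y * m y) y + Dn (\<lambda>y. \<kappa> y * \<kappa> y) y"
      unfolding E_def[abs_def]
      using Dn_add[OF smooth_on_add[OF D c smooth_on_mult[OF D smooth_m smooth_m]] smooth_on_mult[OF D smooth_\<kappa> smooth_\<kappa>] y]
        Dn_add[OF c smooth_on_mult[OF D smooth_m smooth_m] y] by simp
    then show ?thesis using D1 Dn_mult[OF smooth_m smooth_m y] Dn_mult[OF smooth_\<kappa> smooth_\<kappa> y] Dn_simps[OF y] by simp
  qed
  have DF: "Dn F y = 0"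
  proof -
    have "Dn F y = Dn (\<lambda>y. 1) y + Dn (\<lambda>y. p y * p y) y + Dn (\<lambda>y. q y * q y) y"
      unfolding F_def[abs_def]
      using Dn_add[OF smooth_on_add[OF D c smooth_on_mult[OF D smooth(1,1)]] smooth_on_mult[OF D smooth(2,2)] y]
        Dn_add[OF c smooth_on_mult[OF D smooth(1,1)] y] by simp
    then show ?thesis using D1 Dn_mult[OF smooth(1,1) y] Dn_mult[OF smooth(2,2) y] Dn_simps[OF y] by simp
  qed
  have eq: "A y * E y = \<rho> (w y) * F y" if "y \<in> D" for y
    using PDE_m[OF that] unfolding E_def F_def by (simp add: power2_eq_square)
  have "Dn (\<lambda>y. A y * E y) y = Dn (\<lambda>y. \<rho> (w y) * F y) y" by (rule Dn_cong[OF eq y])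
  then have "- pd i m y * (A y * E y) = deriv \<rho> (w y) * \<kappa> y * F y"
    unfolding Dn_mult[OF smooth(3) sE y] Dn_mult[OF smooth_comp[OF smooth_\<rho>(1)] sF y] DE DF
      Dn_compose[OF smooth_\<rho>(1) y] Dn_simps(5)[OF y] by simp
  then have "F y * (pd i m y * \<rho> (w y)) = F y * (- (deriv \<rho> (w y) * \<kappa> y))"
    unfolding eq[OF y] by (simp add: algebra_simps)
  moreover have "F y > 0" unfolding F_def by (simp add: add_pos_nonneg)
  then have "F y \<noteq> 0" by simp
  ultimately show ?thesis using mult_left_cancel[of "F y"] by blast
qed

text \<open>The second factor is \<open>\<rho>\<^sup>3 (1 / \<rho>)''\<close> at height \<open>w y\<close>.\<close>

lemma curvature_along_ruling:
  assumes y: "y \<in> D"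
  shows "(\<kappa> y)\<^sup>2 * (2 * (deriv \<rho> (w y))\<^sup>2 - \<rho> (w y) * deriv (deriv \<rho>) (w y)) = 0"
proof -
  let ?\<rho> = "\<rho> (w y)" and ?\<rho>' = "deriv \<rho> (w y)" and ?\<rho>'' = "deriv (deriv \<rho>) (w y)" and ?g = "pd i m y"
  have sm: "smooth_on D (\<lambda>y. deriv \<rho> (w y) * \<kappa> y)"
    by (intro smooth_on_mult D smooth_comp smooth_\<rho> smooth_\<kappa>)
  have mn: "Dn (\<lambda>y. - (deriv \<rho> (w y) * \<kappa> y)) y = - Dn (\<lambda>y. deriv \<rho> (w y) * \<kappa> y) y"
    unfolding Dn_def pd_minus[OF sm y] by simp
  have "Dn (\<lambda>y. pd i m y * \<rho> (w y)) y = Dn (\<lambda>y. - (deriv \<rho> (w y) * \<kappa> y)) y"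
    by (rule Dn_cong[OF slope_derivative y])
  then have "?g * (?\<rho>' * \<kappa> y) - ?g\<^sup>2 * ?\<rho> = - (?\<rho>'' * \<kappa> y * \<kappa> y)"
    unfolding mn Dn_mult[OF smooth_on_pd[OF smooth_m] smooth_comp[OF smooth_\<rho>(1)] y]
      Dn_mult[OF smooth_comp[OF smooth_\<rho>(2)] smooth_\<kappa> y]
      Dn_compose[OF smooth_\<rho>(1) y] Dn_compose[OF smooth_\<rho>(2) y] Dn_simps(6,7)[OF y] by simp
  \<comment> \<open>The factor \<rho> makes \<open>pd i m y\<close> occur only in products with
    \<rho>, which \<open>slope_derivative\<close> eliminates.\<close>
  then have "?\<rho> * (?g * (?\<rho>' * \<kappa> y) - ?g\<^sup>2 * ?\<rho>) = ?\<rho> * (- (?\<rho>'' * \<kappa> y * \<kappa> y))" by simp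
  then have "(?g * ?\<rho>) * (?\<rho>' * \<kappa> y) - (?g * ?\<rho>)\<^sup>2 = - (?\<rho> * ?\<rho>'' * (\<kappa> y)\<^sup>2)"
    by (simp add: power2_eq_square algebra_simps)
  then show ?thesis unfolding slope_derivative[OF y] by (simp add: power2_eq_square algebra_simps)
qed

lemma slope_locally_constant:
  assumes y: "y \<in> D" and "\<kappa> y = 0 \<or> deriv \<rho> (w y) = 0"
  shows "pd i m y = 0" "pd j m y = 0"
proof -
  show "pd i m y = 0" using slope_derivative[OF y] assms(2) \<phi>pos[of "w y"] by auto
  then show "pd j m y = 0" using burgers[OF y] by simp
qed

section \<open>Rulings as straight segments\<close>

definition nul :: "real \<Rightarrow> real^2" where "nul s = axis j 1 + s *\<^sub>R axis i 1"

lemma nul_nth [simp]: "nul s $ i = s" "nul s $ j = 1"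
  unfolding nul_def axis_def using ij by auto

text \<open>The line is drawn with the slope of its initial point; once the slope is seen not to
  change on it, the line follows the null direction throughout and the facts about \<open>Dn\<close>
  can be integrated.\<close>

lemma ruling:
  assumes seg: "\<And>t. t \<in> {a..b} \<Longrightarrow> y0 + t *\<^sub>R nul (m y0) \<in> D" and t0: "0 \<in> {a..b}" and t: "t \<in> {a..b}"
  defines "y \<equiv> \<lambda>t. y0 + t *\<^sub>R nul (m y0)"
  shows "m (y t) = m y0" "p (y t) = p y0" "q (y t) = q y0" "w (y t) = w y0 + t * \<kappa> y0"
proof -
  let ?n = "nul (m y0)"
  have line: "((\<lambda>t. f (y t)) has_real_derivative (m y0 * pd i f (y t) + pd j f (y t))) (at t within {a..b})"
    if "smooth_on D f" "t \<in> {a..b}" for f t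
    using has_field_derivative_at_within[OF line_derivative[OF that(1) seg[OF that(2)] ij]] unfolding y_def by simp
  \<comment> \<open>Along the line, Burgers' equation reads (m - m0)' = -(m - m0) \<partial>i m, a
    homogeneous linear equation with zero initial value.\<close>
  have mc: "m (y t) - m y0 = 0" if "t \<in> {a..b}" for t
  proof (rule linear_ODE_zero[of a b "\<lambda>t. m (y t) - m y0" "\<lambda>t. - pd i m (y t)" 0])
    fix t assume t: "t \<in> {a..b}"
    have "((\<lambda>t. m (y t) - m y0) has_real_derivative (m y0 * pd i m (y t) + pd j m (y t)) - 0) (at t within {a..b})"
      by (intro DERIV_diff line smooth_m t) simp
    then show "((\<lambda>t. m (y t) - m y0) has_real_derivative (m (y t) - m y0) * - pd i m (y t)) (at t within {a..b})"
      using burgers[of "y t"] seg[OF t] unfolding y_def by (simp add: algebra_simps)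
  next
    have "continuous_on {a..b} y" unfolding y_def by (intro continuous_intros)
    then show "continuous_on {a..b} (\<lambda>t. - pd i m (y t))"
      by (intro continuous_intros continuous_on_compose2[OF smooth_on_imp_continuous_on[OF smooth_on_pd[OF smooth_m]]])
        (use seg in \<open>auto simp: y_def\<close>)
  qed (use t0 that in \<open>auto simp: y_def\<close>)
  show "m (y t) = m y0" using mc[OF t] by simp
  have const: "f (y t) = f y0" if "smooth_on D f" "\<And>z. z \<in> D \<Longrightarrow> m z * pd i f z + pd j f z = 0" "t \<in> {a..b}" for f t
  proof -
    have "((\<lambda>t. f (y t)) has_real_derivative 0) (at s within {a..b})" if "s \<in> {a..b}" for s
      using line[OF \<open>smooth_on D f\<close> that] \<open>\<And>z. z \<in> D \<Longrightarrow> m z * pd i f z + pd j f z = 0\<close>[of "y s"] seg[OF that] mc[OF that]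
      unfolding y_def by simp
    then obtain c where "\<And>s. s \<in> {a..b} \<Longrightarrow> f (y s) = c"
      using has_field_derivative_zero_constant[of "{a..b}" "\<lambda>t. f (y t)"] by auto
    then have "f (y t) = f (y 0)" using that(3) t0 by simp
    then show ?thesis by (simp add: y_def)
  qed
  have Dz: "m z * pd i p z + pd j p z = 0" "m z * pd i q z + pd j q z = 0" if "z \<in> D" for z
    using Dn_simps(1,2)[OF that] unfolding Dn_def by (auto simp: add.commute)
  have pc: "p (y t) = p y0" and qc: "q (y t) = q y0" if "t \<in> {a..b}" for t
    using const[OF smooth(1) Dz(1) that] const[OF smooth(2) Dz(2) that] by auto
  show "p (y t) = p y0" "q (y t) = q y0" using pc qc t by auto
  have "((\<lambda>t. w (y t) - t * \<kappa> y0) has_real_derivative 0) (at s within {a..b})" if s: "s \<in> {a..b}" for s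
  proof -
    have "((\<lambda>t. w (y t) - t * \<kappa> y0) has_real_derivative (m y0 * p (y s) + q (y s)) - \<kappa> y0) (at s within {a..b})"
      by (intro DERIV_diff line[OF w s]) (auto intro!: derivative_eq_intros)
    then show ?thesis using pc[OF s] qc[OF s] unfolding \<kappa>_def by simp
  qed
  then obtain c where c: "\<And>s. s \<in> {a..b} \<Longrightarrow> w (y s) - s * \<kappa> y0 = c"
    using has_field_derivative_zero_constant[of "{a..b}" "\<lambda>t. w (y t) - t * \<kappa> y0"] by auto
  show "w (y t) = w y0 + t * \<kappa> y0" using c[OF t] c[OF t0] by (simp add: y_def)
qed

end

section \<open>The generating curve\<close>

lemma antiderivative_symmetric_interval:
  fixes f :: "real \<Rightarrow> real"
  assumes "continuous_on {-r<..<r} f"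
  shows "\<exists>F. F 0 = 0 \<and> (\<forall>s\<in>{-r<..<r}. (F has_real_derivative f s) (at s))"
proof -
  define F where "F s = integral {0..s} f - integral {s..0} f" for s
  have "(F has_real_derivative f s) (at s)" if s: "s \<in> {-r<..<r}" for s
  proof -
    \<comment> \<open>Half-way between |s| and \<open>r\<close>, so that \<open>f\<close> is
      integrable on a compact interval having \<open>s\<close> in its interior. There
      \<open>F\<close> is the integral from -b up to a constant; of the two integrals defining
      \<open>F\<close> only one is non-zero, depending on the sign.\<close>
    define b where "b = (\<bar>s\<bar> + r) / 2"
    have b: "\<bar>s\<bar> < b" "b < r" "b > 0" unfolding b_def using s by auto
    have cont: "continuous_on {-b..b} f" using assms by (rule continuous_on_subset) (use b in auto)
    have int: "f integrable_on {-b..b}" by (rule integrable_continuous_real[OF cont])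
    have eq: "integral {-b..t} f - integral {-b..0} f = F t" if t: "t \<in> {-b<..<b}" for t
    proof (cases "0 \<le> t")
      case True
      have "f integrable_on {-b..t}" by (rule integrable_on_subinterval[OF int]) (use t in auto)
      then have "integral {-b..0} f + integral {0..t} f = integral {-b..t} f"
        using True b by (intro Henstock_Kurzweil_Integration.integral_combine) auto
      moreover have "integral {t..0} f = 0"
        using True by (cases "t = 0") auto
      ultimately show ?thesis unfolding F_def by simp
    next
      case False
      have "f integrable_on {-b..0}" by (rule integrable_on_subinterval[OF int]) (use b in auto)
      then have "integral {-b..t} f + integral {t..0} f = integral {-b..0} f"
        using False t by (intro Henstock_Kurzweil_Integration.integral_combine) auto
      moreover have "integral {0..t} f = 0" using False by auto
      ultimately show ?thesis unfolding F_def by simp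
    qed
    have "((\<lambda>t. integral {-b..t} f) has_real_derivative f s) (at s within {-b..b})"
      by (rule integral_has_real_derivative[OF cont]) (use b in auto)
    then have "((\<lambda>t. integral {-b..t} f) has_real_derivative f s) (at s)"
      using at_within_interior[of s "{-b..b}"] b by (simp add: interior_atLeastAtMost_real abs_less_iff)
    then have "((\<lambda>t. integral {-b..t} f - integral {-b..0} f) has_real_derivative f s) (at s)"
      by (auto intro!: derivative_eq_intros)
    then show ?thesis
      by (rule has_field_derivative_transform_within_open[of _ _ _ "{-b<..<b}"]) (use b eq in auto)
  qed
  moreover have "F 0 = 0" unfolding F_def by simp
  ultimately show ?thesis by blast
qed

lemma DERIV_local_inverse:
  fixes f g :: "real \<Rightarrow> real"
  assumes "(f has_real_derivative f') (at x)" "f' \<noteq> 0" "open S" "x \<in> S" "continuous_on S f"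
    "\<And>z. z \<in> S \<Longrightarrow> g (f z) = z"
  shows "(g has_real_derivative inverse f') (at (f x))"
  unfolding has_field_derivative_def
  by (rule has_derivative_inverse_strong[of S x f g "(*) f'"]) (use assms in \<open>auto simp: has_field_derivative_def\<close>)

abbreviation angles :: "real set" where "angles \<equiv> {-(pi/2)<..<pi/2}"

lemma cos_angles: "s \<in> angles \<Longrightarrow> cos s > 0"
  using cos_gt_zero_pi[of s] by auto

section \<open>The generating curve as a function of its inclination angle\<close>

locale velocity =
  fixes \<phi> :: "real \<Rightarrow> real"
  assumes \<phi>: "smooth_on UNIV \<phi>" and \<phi>pos: "\<And>z. deriv \<phi> z > 0" and surj: "surj \<phi>"
begin

lemma d\<phi>: "(\<phi> has_real_derivative deriv \<phi> z) (at z)"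
  by (rule smooth_real_deriv(1)[OF \<phi>])

lemma strict_mono: "strict_mono \<phi>"
proof (rule strict_monoI)
  fix x y :: real assume "x < y"
  then show "\<phi> x < \<phi> y" by (rule DERIV_pos_imp_increasing) (use d\<phi> \<phi>pos in blast)
qed

lemma inv_left [simp]: "inv \<phi> (\<phi> z) = z"
  using strict_mono by (simp add: strict_mono_imp_inj_on)

lemma inv_right [simp]: "\<phi> (inv \<phi> z) = z"
  using surj by (simp add: surj_f_inv_f)

lemma d\<rho>: "(deriv \<phi> has_real_derivative deriv (deriv \<phi>) z) (at z)"
  by (rule smooth_real_deriv(1)[OF smooth_real_deriv(2)[OF \<phi>]])

lemma cont\<rho>: "continuous_on S (deriv \<phi>)"
  by (intro continuous_at_imp_continuous_on ballI DERIV_isCont[OF d\<rho>])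

lemma d_inv: "(inv \<phi> has_real_derivative inverse (deriv \<phi> (inv \<phi> z))) (at z)"
proof -
  have "(inv \<phi> has_real_derivative inverse (deriv \<phi> (inv \<phi> z))) (at (\<phi> (inv \<phi> z)))"
  proof (rule DERIV_local_inverse[OF d\<phi>])
    show "deriv \<phi> (inv \<phi> z) \<noteq> 0" using \<phi>pos[of "inv \<phi> z"] by simp
    show "continuous_on UNIV \<phi>" by (intro continuous_at_imp_continuous_on ballI DERIV_isCont[OF d\<phi>])
  qed auto
  then show ?thesis by simp
qed

text \<open>
  The solution is parametrized by its inclination angle \<open>s\<close>: the equation says
  \<open>x'(s) = 1 / \<phi>'(u)\<close>, and \<open>e\<^bsup>\<phi>(u)\<^esup> cos s\<close> is a first integral.
\<close>

definition h :: "real \<Rightarrow> real \<Rightarrow> real" where "h u0 s = inv \<phi> (\<phi> u0 - ln (cos s))"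

lemma dh:
  assumes "s \<in> angles"
  shows "(h u0 has_real_derivative tan s / deriv \<phi> (h u0 s)) (at s)"
proof -
  have "((\<lambda>s. \<phi> u0 - ln (cos s)) has_real_derivative tan s) (at s)"
    using cos_angles[OF assms] by (auto intro!: derivative_eq_intros simp: tan_def divide_inverse)
  from DERIV_chain2[OF d_inv this] show ?thesis
    unfolding h_def[abs_def] by (simp add: divide_inverse mult.commute)
qed

text \<open>The abscissa as a function of the inclination angle. The normalization at angle 0 places
  the lowest point of the curve over x = 0, as u(0) = u0 and u'(0) = 0 demand.\<close>

definition xi :: "real \<Rightarrow> real \<Rightarrow> real"
  where "xi u0 = (SOME F. F 0 = 0 \<and> (\<forall>s\<in>angles. (F has_real_derivative 1 / deriv \<phi> (h u0 s)) (at s)))"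

lemma xi: "xi u0 0 = 0" "s \<in> angles \<Longrightarrow> (xi u0 has_real_derivative 1 / deriv \<phi> (h u0 s)) (at s)"
proof -
  have ch: "continuous_on angles (h u0)"
    by (intro continuous_at_imp_continuous_on ballI DERIV_isCont[OF dh])
  have "continuous_on angles (\<lambda>s. 1 / deriv \<phi> (h u0 s))"
    using \<phi>pos by (intro continuous_intros continuous_on_compose2[OF cont\<rho> ch]) (auto simp: less_imp_neq[THEN not_sym])
  from antiderivative_symmetric_interval[OF this]
  have "xi u0 0 = 0 \<and> (\<forall>s\<in>angles. (xi u0 has_real_derivative 1 / deriv \<phi> (h u0 s)) (at s))"
    unfolding xi_def by (rule someI_ex)
  then show "xi u0 0 = 0" "s \<in> angles \<Longrightarrow> (xi u0 has_real_derivative 1 / deriv \<phi> (h u0 s)) (at s)" by auto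
qed

lemma xi_mono:
  assumes "s \<in> angles" "t \<in> angles" "s < t"
  shows "xi u0 s < xi u0 t"
proof (rule DERIV_pos_imp_increasing[OF assms(3)])
  fix r assume "s \<le> r" "r \<le> t"
  then show "\<exists>y. (xi u0 has_real_derivative y) (at r) \<and> y > 0"
    using xi(2)[of r] \<phi>pos assms by (intro exI[of _ "1 / deriv \<phi> (h u0 r)"]) auto
qed

lemma xi_inj: "inj_on (xi u0) angles"
proof (rule inj_onI)
  fix s t assume a: "s \<in> angles" "t \<in> angles" "xi u0 s = xi u0 t"
  show "s = t"
    using xi_mono[OF a(1,2), of u0] xi_mono[OF a(2,1), of u0] a(3) by (cases s t rule: linorder_cases) auto
qed

lemma xi_cont: "continuous_on angles (xi u0)"
  by (intro continuous_at_imp_continuous_on ballI DERIV_isCont[OF xi(2)])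

definition I :: "real \<Rightarrow> real set" where "I u0 = xi u0 ` angles"
definition ang :: "real \<Rightarrow> real \<Rightarrow> real" where "ang u0 = inv_into angles (xi u0)"
definition u :: "real \<Rightarrow> real \<Rightarrow> real" where "u u0 x = h u0 (ang u0 x)"

lemma ang: "x \<in> I u0 \<Longrightarrow> ang u0 x \<in> angles" "x \<in> I u0 \<Longrightarrow> xi u0 (ang u0 x) = x" "s \<in> angles \<Longrightarrow> ang u0 (xi u0 s) = s"
  unfolding I_def ang_def by (auto simp: inv_into_into f_inv_into_f inv_into_f_f[OF xi_inj] simp del: greaterThanLessThan_iff)

lemma open_I: "open (I u0)"
proof -
  have "\<forall>T. open T \<and> T \<subseteq> angles \<longrightarrow> open (xi u0 ` T)"
    using injective_eq_1d_open_map_UNIV[OF xi_cont is_interval_oo, of u0] xi_inj by blast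
  then show ?thesis unfolding I_def by simp
qed

lemma interval_I: "is_interval (I u0)"
  unfolding I_def is_interval_connected_1 by (intro connected_continuous_image xi_cont) (simp add: is_interval_connected_1[symmetric] is_interval_oo)

lemma zero_I: "0 \<in> I u0" and ang_0: "ang u0 0 = 0"
proof -
  have z: "0 \<in> angles" by auto
  show "0 \<in> I u0" unfolding I_def using xi(1) z by (metis image_eqI)
  show "ang u0 0 = 0" using ang(3)[OF z, of u0] xi(1) by simp
qed

lemma d_ang:
  assumes x: "x \<in> I u0"
  shows "(ang u0 has_real_derivative deriv \<phi> (u u0 x)) (at x)"
proof -
  have "(ang u0 has_real_derivative inverse (1 / deriv \<phi> (h u0 (ang u0 x)))) (at (xi u0 (ang u0 x)))"
  proof (rule DERIV_local_inverse[OF xi(2)])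
    show "1 / deriv \<phi> (h u0 (ang u0 x)) \<noteq> 0" using \<phi>pos[of "h u0 (ang u0 x)"] by simp
    show "open angles" by simp
    show "ang u0 x \<in> angles" by (rule ang(1)[OF x])
    then show "ang u0 x \<in> angles" .
    show "continuous_on angles (xi u0)" by (rule xi_cont)
    show "ang u0 (xi u0 z) = z" if "z \<in> angles" for z by (rule ang(3)[OF that])
  qed
  then show ?thesis using ang(2)[OF x] by (simp add: u_def)
qed

lemma du:
  assumes x: "x \<in> I u0"
  shows "(u u0 has_real_derivative tan (ang u0 x)) (at x)"
  using DERIV_chain2[OF dh[OF ang(1)[OF x]] d_ang[OF x], of u0] \<phi>pos[of "u u0 x"]
  unfolding u_def[abs_def] by (simp add: less_imp_neq[THEN not_sym])

lemma deriv_u: "x \<in> I u0 \<Longrightarrow> deriv (u u0) x = tan (ang u0 x)"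
  using du DERIV_imp_deriv by blast

lemma ddu:
  assumes x: "x \<in> I u0"
  shows "(deriv (u u0) has_real_derivative deriv \<phi> (u u0 x) * (1 + (deriv (u u0) x)\<^sup>2)) (at x)"
proof -
  have c: "cos (ang u0 x) \<noteq> 0" using cos_angles[OF ang(1)[OF x]] by simp
  have "((\<lambda>x. tan (ang u0 x)) has_real_derivative inverse ((cos (ang u0 x))\<^sup>2) * deriv \<phi> (u u0 x)) (at x)"
    using DERIV_chain2[OF DERIV_tan[OF c] d_ang[OF x]] .
  then have "((\<lambda>x. tan (ang u0 x)) has_real_derivative deriv \<phi> (u u0 x) * (1 + (deriv (u u0) x)\<^sup>2)) (at x)"
    unfolding deriv_u[OF x] using tan_sec[OF c] by (simp add: mult.commute power_inverse)
  then show ?thesis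
    by (rule has_field_derivative_transform_within_open[OF _ open_I x]) (simp add: deriv_u)
qed

text \<open>Angles bounded away from the vertical stay in a compact set, whose image under
  \<open>xi u0\<close> is closed and still inside the interval.\<close>

lemma I_limit:
  assumes "\<And>n::nat. x n \<in> I u0" "x \<longlonglongrightarrow> e" "b < pi / 2" "\<And>n. \<bar>ang u0 (x n)\<bar> \<le> b"
  shows "e \<in> I u0"
proof -
  have sub: "{-b..b} \<subseteq> angles" using assms(3) by auto
  have "compact (xi u0 ` {-b..b})"
    by (rule compact_continuous_image[OF continuous_on_subset[OF xi_cont sub]]) simp
  then have cl: "closed (xi u0 ` {-b..b})" by (rule compact_imp_closed)
  have "x n \<in> xi u0 ` {-b..b}" for n
    using ang(2)[OF assms(1)[of n]] assms(4)[of n] by (intro image_eqI[of _ _ "ang u0 (x n)"]) auto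
  then have "e \<in> xi u0 ` {-b..b}" using closed_sequentially[OF cl _ assms(2)] by blast
  then show ?thesis unfolding I_def using sub by auto
qed

text \<open>By the first integral \<phi>(u) + ln cos s = \<phi>(u0), a bound on the heights bounds
  cos s from below, so the angles stay away from the vertical. This prevents a surface in contact
  with the model from becoming vertical at a limit point.\<close>

lemma I_limit_height:
  assumes x: "\<And>n::nat. x n \<in> I u0" "x \<longlonglongrightarrow> e" and "(\<lambda>n. u u0 (x n)) \<longlonglongrightarrow> z"
  shows "e \<in> I u0"
proof -
  have "Bseq (\<lambda>n. u u0 (x n))" using assms(3) convergentI convergent_imp_Bseq by blast
  then obtain K where K: "\<And>n. \<bar>u u0 (x n)\<bar> \<le> K" by (auto simp: Bseq_def)
  define L where "L = exp (\<phi> u0 - \<phi> K)"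
  have c: "L \<le> cos (ang u0 (x n))" for n
  proof -
    have a: "cos (ang u0 (x n)) > 0" using cos_angles[OF ang(1)[OF x(1)]] .
    have "\<phi> (u u0 (x n)) \<le> \<phi> K" using K[of n] strict_mono by (simp add: strict_mono_less_eq)
    then have "\<phi> u0 - \<phi> K \<le> ln (cos (ang u0 (x n)))" unfolding u_def h_def by simp
    then show ?thesis unfolding L_def using a by (metis exp_le_cancel_iff exp_ln)
  qed
  have L0: "L > 0" unfolding L_def by simp
  have L1: "L \<le> 1" using c[of 0] cos_le_one order_trans by blast
  define b where "b = arccos L"
  have "b < pi / 2" unfolding b_def using L0 L1 arccos_less_arccos[of 0 L] by simp
  moreover have "\<bar>ang u0 (x n)\<bar> \<le> b" for n
  proof -
    have a: "ang u0 (x n) \<in> angles" by (rule ang(1)[OF x(1)])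
    have "arccos (cos \<bar>ang u0 (x n)\<bar>) \<le> arccos L"
      using c[of n] L0 by (intro arccos_le_arccos) auto
    then show ?thesis unfolding b_def using a by (subst (asm) arccos_cos) (auto simp: abs_le_iff)
  qed
  ultimately show ?thesis using I_limit[OF x] by blast
qed

text \<open>A proper extension would contain an end point of the interval and have a continuous
  slope there. But the slope is the tangent of the angle, and angles with bounded tangent do not
  lead to an end point.\<close>

lemma maximal_solution: "maximal_catenary_solution \<phi> u0 (I u0) (u u0)"
proof -
  have cat: "catenary_solution \<phi> u0 (I u0) (u u0)"
    unfolding catenary_solution_def
    using open_I interval_I zero_I du ddu deriv_u by (auto simp: ang_0 u_def h_def)
  have "J = I u0" if J: "catenary_solution \<phi> u0 J v" "I u0 \<subseteq> J" "\<forall>x\<in>I u0. v x = u u0 x" for J v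
  proof (rule ccontr)
    assume ne: "J \<noteq> I u0"
    have J': "connected J" "\<And>x. x \<in> J \<Longrightarrow> (deriv v has_real_derivative deriv \<phi> (v x) * (1 + (deriv v x)\<^sup>2)) (at x)"
      using J(1) unfolding catenary_solution_def is_interval_connected_1 by auto
    have "openin (top_of_set J) (I u0)" using open_I J(2) by (simp add: open_openin_trans open_subset)
    then have "\<not> closedin (top_of_set J) (I u0)"
      using J'(1) zero_I[of u0] ne unfolding connected_clopen by blast
    then have "I u0 \<noteq> J \<inter> closure (I u0)" by (metis closed_closure closedin_closed)
    then obtain e where e: "e \<in> J" "e \<in> closure (I u0)" "e \<notin> I u0" using J(2) closure_subset[of "I u0"] by auto
    obtain x where x: "\<And>n::nat. x n \<in> I u0" "x \<longlonglongrightarrow> e" using e(2) unfolding closure_sequential by auto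
    have dv: "deriv v (x n) = tan (ang u0 (x n))" for n
    proof -
      have "eventually (\<lambda>t. v t = u u0 t) (nhds (x n))"
        using eventually_nhds_in_open[OF open_I x(1)[of n]] by (rule eventually_mono) (use J(3) in blast)
      then have "deriv v (x n) = deriv (u u0) (x n)" by (rule deriv_cong_ev) simp
      then show ?thesis using deriv_u x(1) by simp
    qed
    have "isCont (deriv v) e" using J'(2)[OF e(1)] DERIV_isCont by blast
    then have "(\<lambda>n. deriv v (x n)) \<longlonglongrightarrow> deriv v e" using x(2) isCont_tendsto_compose by blast
    then have "Bseq (\<lambda>n. deriv v (x n))" using convergentI convergent_imp_Bseq by blast
    then obtain K where K: "\<And>n. \<bar>tan (ang u0 (x n))\<bar> \<le> K" unfolding dv by (auto simp: Bseq_def)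
    have "\<bar>ang u0 (x n)\<bar> \<le> arctan K" for n
    proof -
      have a: "arctan (tan (ang u0 (x n))) = ang u0 (x n)"
        using ang(1)[OF x(1)[of n]] by (intro arctan_tan) auto
      have "arctan (tan (ang u0 (x n))) \<le> arctan K" "arctan (- K) \<le> arctan (tan (ang u0 (x n)))"
        using K[of n] by (auto simp: arctan_le_iff abs_le_iff)
      then show ?thesis unfolding a by (simp add: arctan_minus abs_le_iff)
    qed
    then have "e \<in> I u0" by (rule I_limit[OF x arctan_ubound])
    then show False using e(3) by simp
  qed
  then show ?thesis unfolding maximal_catenary_solution_def using cat by blast
qed

text \<open>
  The plane element at \<open>(y, z)\<close> with gradient \<open>(g1, g2)\<close> is tangent to the tilted cylinder whose
  rulings have horizontal direction \<open>(- sa, ca)\<close> and slope \<open>k\<close>. Here \<open>s\<close> is the inclination angle of the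
  generating curve, and \<open>c = 1 / cos \<theta>\<close> for the tilting angle \<open>\<theta> = arctan k\<close>.
\<close>

definition contact :: "real \<Rightarrow> real \<Rightarrow> real \<Rightarrow> real \<Rightarrow> real \<Rightarrow> real^2 \<Rightarrow> real \<Rightarrow> real \<Rightarrow> real \<Rightarrow> bool"
  where
    "contact u0 \<beta> ca sa k y z g1 g2 \<longleftrightarrow>
       ca * g2 - sa * g1 = k \<and>
       (let c = sqrt (1 + k\<^sup>2); s = arctan ((ca * g1 + sa * g2) / c) in
          h u0 s = (z - k * (ca * y$2 - sa * y$1)) / c\<^sup>2 \<and>
          xi u0 s = (ca * y$1 + sa * y$2 - \<beta>) / c)"

lemma arctan_angles: "arctan t \<in> angles"
  using arctan_bounded[of t] by auto

lemma contact_exists: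
  assumes "ca * g2 - sa * g1 = k"
  shows "\<exists>u0 \<beta>. contact u0 \<beta> ca sa k y z g1 g2"
proof -
  define c where "c = sqrt (1 + k\<^sup>2)"
  have c: "c > 0" unfolding c_def by (simp add: add_pos_nonneg)
  define s where "s = arctan ((ca * g1 + sa * g2) / c)"
  define v where "v = (z - k * (ca * y$2 - sa * y$1)) / c\<^sup>2"
  \<comment> \<open>The first integral solved for its value at the lowest point, which uses that
    \<phi> is onto; then \<beta> is the shift that puts the abscissa right.\<close>
  define u0 where "u0 = inv \<phi> (\<phi> v + ln (cos s))"
  define \<beta> where "\<beta> = ca * y$1 + sa * y$2 - c * xi u0 s"
  have "h u0 s = v" unfolding h_def u0_def by simp
  moreover have "xi u0 s = (ca * y$1 + sa * y$2 - \<beta>) / c" unfolding \<beta>_def using c by simp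
  ultimately have "contact u0 \<beta> ca sa k y z g1 g2"
    unfolding contact_def Let_def c_def[symmetric] s_def[symmetric] v_def[symmetric] using assms by simp
  then show ?thesis by blast
qed

lemma contactD:
  assumes "contact u0 \<beta> ca sa k y z g1 g2"
  defines "c \<equiv> sqrt (1 + k\<^sup>2)"
  defines "x \<equiv> (ca * y$1 + sa * y$2 - \<beta>) / c"
  shows "x \<in> I u0" "z = c\<^sup>2 * u u0 x + k * (ca * y$2 - sa * y$1)"
    "ca * g1 + sa * g2 = c * tan (ang u0 x)" "ca * g2 - sa * g1 = k"
proof -
  have c: "c > 0" unfolding c_def by (simp add: add_pos_nonneg)
  define s where "s = arctan ((ca * g1 + sa * g2) / c)"
  have *: "h u0 s = (z - k * (ca * y$2 - sa * y$1)) / c\<^sup>2" "xi u0 s = x"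
    using assms(1) unfolding contact_def Let_def c_def[symmetric] s_def[symmetric] x_def by auto
  have s: "s \<in> angles" unfolding s_def by (rule arctan_angles)
  show "x \<in> I u0" unfolding *(2)[symmetric] I_def using s by blast
  have a: "ang u0 x = s" unfolding *(2)[symmetric] by (rule ang(3)[OF s])
  show "z = c\<^sup>2 * u u0 x + k * (ca * y$2 - sa * y$1)"
    unfolding u_def a *(1) using c by simp
  show "ca * g1 + sa * g2 = c * tan (ang u0 x)" unfolding a s_def tan_arctan using c by simp
  show "ca * g2 - sa * g1 = k" using assms(1) unfolding contact_def by simp
qed

lemma contactI:
  fixes y :: "real^2" and \<beta> :: real
  assumes "ca * g2 - sa * g1 = k"
  defines "c \<equiv> sqrt (1 + k\<^sup>2)"
  defines "x \<equiv> (ca * y$1 + sa * y$2 - \<beta>) / c"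
  assumes "x \<in> I u0" "z = c\<^sup>2 * u u0 x + k * (ca * y$2 - sa * y$1)" "ca * g1 + sa * g2 = c * tan (ang u0 x)"
  shows "contact u0 \<beta> ca sa k y z g1 g2"
proof -
  have c: "c > 0" unfolding c_def by (simp add: add_pos_nonneg)
  have s: "arctan ((ca * g1 + sa * g2) / c) = ang u0 x"
    using assms(6) c ang(1)[OF assms(4)] by (simp add: arctan_tan)
  show ?thesis
    unfolding contact_def Let_def c_def[symmetric] s
    using assms(1,5) c ang(2)[OF assms(4)] unfolding x_def[symmetric] u_def by simp
qed

text \<open>Convergence of the gradients is a conclusion: contact makes them continuous functions of
  the position, and \<open>I_limit_height\<close> keeps the limiting position in the domain of these
  functions because the heights converge.\<close>

lemma contact_limit:
  assumes cs: "ca\<^sup>2 + sa\<^sup>2 = 1" and con: "\<And>n::nat. contact u0 \<beta> ca sa k (y n) (z n) (g1 n) (g2 n)"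
    and y: "y \<longlonglongrightarrow> y'" and z: "z \<longlonglongrightarrow> z'"
  obtains g1' g2' where "g1 \<longlonglongrightarrow> g1'" "g2 \<longlonglongrightarrow> g2'" "contact u0 \<beta> ca sa k y' z' g1' g2'"
proof -
  define c where "c = sqrt (1 + k\<^sup>2)"
  have c: "c > 0" unfolding c_def by (simp add: add_pos_nonneg)
  define x where "x n = (ca * y n$1 + sa * y n$2 - \<beta>) / c" for n
  define x' where "x' = (ca * y'$1 + sa * y'$2 - \<beta>) / c"
  note cD = contactD[OF con, folded c_def, folded x_def]
  have yi: "(\<lambda>n. y n $ i) \<longlonglongrightarrow> y' $ i" for i using y by (rule tendsto_vec_nth)
  have xl: "x \<longlonglongrightarrow> x'" unfolding x_def x'_def using c by (intro tendsto_intros yi) auto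
  have ue: "u u0 (x n) = (z n - k * (ca * y n$2 - sa * y n$1)) / c\<^sup>2" for n
    using cD(2)[of n] c by simp
  have ul: "(\<lambda>n. u u0 (x n)) \<longlonglongrightarrow> (z' - k * (ca * y'$2 - sa * y'$1)) / c\<^sup>2"
    unfolding ue using c by (intro tendsto_intros yi z) auto
  have xI: "x' \<in> I u0" by (rule I_limit_height[OF cD(1) xl ul])
  have u': "u u0 x' = (z' - k * (ca * y'$2 - sa * y'$1)) / c\<^sup>2"
    using LIMSEQ_unique[OF isCont_tendsto_compose[OF DERIV_isCont[OF du[OF xI]] xl] ul] .
  have al: "(\<lambda>n. ang u0 (x n)) \<longlonglongrightarrow> ang u0 x'"
    using isCont_tendsto_compose[OF DERIV_isCont[OF d_ang[OF xI]] xl] .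
  have cos: "cos (ang u0 x') \<noteq> 0" using cos_angles[OF ang(1)[OF xI]] by simp
  define g1' where "g1' = ca * (c * tan (ang u0 x')) - sa * k"
  define g2' where "g2' = sa * (c * tan (ang u0 x')) + ca * k"
  have g1e: "g1 n = ca * (c * tan (ang u0 (x n))) - sa * k" for n
  proof -
    have "g1 n = (ca\<^sup>2 + sa\<^sup>2) * g1 n" using cs by simp
    also have "\<dots> = ca * (ca * g1 n + sa * g2 n) - sa * (ca * g2 n - sa * g1 n)"
      by (simp add: power2_eq_square algebra_simps)
    finally show ?thesis unfolding cD(3,4) .
  qed
  have g2e: "g2 n = sa * (c * tan (ang u0 (x n))) + ca * k" for n
  proof -
    have "g2 n = (ca\<^sup>2 + sa\<^sup>2) * g2 n" using cs by simp
    also have "\<dots> = sa * (ca * g1 n + sa * g2 n) + ca * (ca * g2 n - sa * g1 n)"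
      by (simp add: power2_eq_square algebra_simps)
    finally show ?thesis unfolding cD(3,4) .
  qed
  have "g1 \<longlonglongrightarrow> g1'" "g2 \<longlonglongrightarrow> g2'"
    unfolding g1e[abs_def] g2e[abs_def] g1'_def g2'_def by (intro tendsto_intros isCont_tendsto_compose[OF isCont_tan[OF cos] al])+
  moreover have "contact u0 \<beta> ca sa k y' z' g1' g2'"
  proof (rule contactI)
    have "ca * g2' - sa * g1' = (ca\<^sup>2 + sa\<^sup>2) * k" unfolding g1'_def g2'_def
      by (simp add: power2_eq_square algebra_simps)
    then show "ca * g2' - sa * g1' = k" using cs by simp
    have "ca * g1' + sa * g2' = (ca\<^sup>2 + sa\<^sup>2) * (c * tan (ang u0 x'))" unfolding g1'_def g2'_def
      by (simp add: power2_eq_square algebra_simps)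
    then show "ca * g1' + sa * g2' = sqrt (1 + k\<^sup>2) * tan (ang u0 ((ca * y'$1 + sa * y'$2 - \<beta>) / sqrt (1 + k\<^sup>2)))"
      using cs unfolding x'_def c_def by simp
    show "(ca * y'$1 + sa * y'$2 - \<beta>) / sqrt (1 + k\<^sup>2) \<in> I u0" using xI unfolding x'_def c_def .
    show "z' = (sqrt (1 + k\<^sup>2))\<^sup>2 * u u0 ((ca * y'$1 + sa * y'$2 - \<beta>) / sqrt (1 + k\<^sup>2)) + k * (ca * y'$2 - sa * y'$1)"
      using u' c unfolding x'_def c_def[symmetric] by simp
  qed
  ultimately show ?thesis using that by blast
qed

end

context soliton_graph
begin

text \<open>With the fixed null direction (-sa, ca), the slope along rulings and the functions
  \<open>F\<close> and \<open>G\<close> below have zero derivative on the convex set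
  \<open>D\<close>. Their values at \<open>y0\<close> say exactly that there is contact with the
  model.\<close>

lemma contact_propagates:
  assumes surj: "surj \<phi>" and conv: "convex D" and 12: "i = 1" "j = 2"
    and cs: "ca\<^sup>2 + sa\<^sup>2 = 1"
    and nul: "\<And>y. y \<in> D \<Longrightarrow> ca * B y = sa * A y" "\<And>y. y \<in> D \<Longrightarrow> ca * C y = sa * B y"
    and const: "k = 0 \<or> (\<forall>s t. deriv \<phi> s = deriv \<phi> t)"
    and y0: "y0 \<in> D" and c0: "velocity.contact \<phi> u0 \<beta> ca sa k y0 (w y0) (p y0) (q y0)"
    and y: "y \<in> D"
  shows "velocity.contact \<phi> u0 \<beta> ca sa k y (w y) (p y) (q y)"
proof -
  interpret velocity \<phi> by unfold_locales (use \<phi> \<phi>pos surj in auto)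
  define c where "c = sqrt (1 + k\<^sup>2)"
  have c: "c > 0" and c2: "c\<^sup>2 = 1 + k\<^sup>2" unfolding c_def by (simp_all add: add_pos_nonneg)
  define l where "l y = ca * y$1 + sa * y$2" for y :: "real^2"
  have dw: "(f has_derivative (\<lambda>h. h$1 * pd 1 f y + h$2 * pd 2 f y)) (at y)" if "smooth_on D f" "y \<in> D" for f y
    using has_derivative_pd[OF that, of 1 2] by simp
  have dn: "((\<lambda>y. y $ m) has_derivative (\<lambda>h. h $ m)) (at (y::real^2))" for m y
    by (intro bounded_linear_imp_has_derivative bounded_linear_vec_nth)
  have dl: "(l has_derivative l) (at y)" for y
    unfolding l_def[abs_def] by (auto intro!: derivative_eq_intros dn)
  have const0: "f x = f y0" if der: "\<And>y. y \<in> D \<Longrightarrow> (f has_derivative (\<lambda>h. 0)) (at y)" and x: "x \<in> D"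
    for f :: "real^2 \<Rightarrow> real" and x
  proof -
    obtain c where "\<And>x. x \<in> D \<Longrightarrow> f x = c"
      using has_derivative_zero_constant[OF conv has_derivative_at_withinI[OF der]] by blast
    then show ?thesis using x y0 by simp
  qed
  have kD: "ca * q y - sa * p y = k" if y: "y \<in> D" for y
  proof -
    have "((\<lambda>y. ca * q y - sa * p y) has_derivative (\<lambda>h. 0)) (at z)" if z: "z \<in> D" for z
    proof -
      have "((\<lambda>y. ca * q y - sa * p y) has_derivative
          (\<lambda>h. ca * (h$1 * B z + h$2 * C z) - sa * (h$1 * A z + h$2 * B z))) (at z)"
        using dw[OF smooth(1) z] dw[OF smooth(2) z] pjp[OF z] unfolding 12
        by (auto intro!: derivative_eq_intros)
      moreover have "ca * (h$1 * B z + h$2 * C z) - sa * (h$1 * A z + h$2 * B z) = 0" for h :: "real^2"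
      proof -
        have "ca * (h$1 * B z + h$2 * C z) - sa * (h$1 * A z + h$2 * B z)
          = h$1 * (ca * B z - sa * A z) + h$2 * (ca * C z - sa * B z)" by (simp add: algebra_simps)
        then show ?thesis using nul[OF z] by simp
      qed
      ultimately show ?thesis by simp
    qed
    from const0[OF this y]
    have "ca * q y - sa * p y = ca * q y0 - sa * p y0" .
    then show ?thesis using contactD(4)[OF c0] by simp
  qed
  define T where "T y = (ca * p y + sa * q y) / c" for y
  \<comment> \<open>The height with the contribution of the ruling removed, rescaled by c^2; for the
    model cylinder this is u, and \<open>T\<close> is u'.\<close>
  define v where "v y = (w y - k * (ca * y$2 - sa * y$1)) / c\<^sup>2" for y
  have pq: "p y = ca * (c * T y) - sa * k" "q y = sa * (c * T y) + ca * k" if y: "y \<in> D" for y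
  proof -
    have "p y = (ca\<^sup>2 + sa\<^sup>2) * p y" "q y = (ca\<^sup>2 + sa\<^sup>2) * q y" using cs by simp_all
    moreover have cT: "c * T y = ca * p y + sa * q y" unfolding T_def using c by simp
    ultimately show "p y = ca * (c * T y) - sa * k" "q y = sa * (c * T y) + ca * k"
      unfolding kD[OF y, symmetric] cT by (simp_all add: power2_eq_square algebra_simps)
  qed
  define H where "H y = A y + C y" for y
  \<comment> \<open>The Hessian is \<open>H\<close> times the square of the form (ca, sa), which
    annihilates the null direction.\<close>
  have ABC: "A y = ca * ca * H y" "B y = ca * sa * H y" "C y = sa * sa * H y" if y: "y \<in> D" for y
  proof -
    have 1: "ca * ca = 1 - sa * sa" using cs by (simp add: power2_eq_square)
    have "ca * ca * H y = ca * ca * A y + ca * (ca * C y)" unfolding H_def by (simp add: algebra_simps)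
    also have "\<dots> = ca * ca * A y + sa * (ca * B y)" using nul(2)[OF y] by simp
    also have "\<dots> = (ca * ca + sa * sa) * A y" using nul(1)[OF y] by (simp add: algebra_simps)
    finally show A: "A y = ca * ca * H y" using 1 by simp
    have "ca * ca * H y + sa * sa * H y = (ca * ca + sa * sa) * H y" by (simp add: algebra_simps)
    then have "sa * sa * H y = H y - ca * ca * H y" using 1 by simp
    then show "C y = sa * sa * H y" using A unfolding H_def by simp
    have "ca * sa * H y = ca * (sa * A y) + sa * (ca * C y)" unfolding H_def by (simp add: algebra_simps)
    also have "\<dots> = (ca * ca + sa * sa) * B y" using nul[OF y] by (simp add: algebra_simps)
    finally show "B y = ca * sa * H y" using 1 by simp
  qed
  \<comment> \<open>The one place that separates tilted from horizontal rulings. Tilting and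
    dilating changes the height at which \<phi>' is evaluated; this is harmless if k = 0, when v =
    w, or if \<phi>' is constant.\<close>
  have rho: "deriv \<phi> (w y) = deriv \<phi> (v y)" for y
    using const
  proof
    assume "k = 0"
    then show ?thesis unfolding v_def c_def by simp
  qed blast
  have Heq: "H y = deriv \<phi> (v y) * (1 + (T y)\<^sup>2)" if y: "y \<in> D" for y
  proof -
    have "(1 + (q y)\<^sup>2) * A y - 2 * p y * q y * B y + (1 + (p y)\<^sup>2) * C y
       = H y * ((ca\<^sup>2 + sa\<^sup>2) + (ca * q y - sa * p y)\<^sup>2)"
      unfolding ABC[OF y] by (simp add: power2_eq_square algebra_simps)
    also have "\<dots> = H y * c\<^sup>2" unfolding kD[OF y] cs c2 by simp
    finally have "H y * c\<^sup>2 = deriv \<phi> (v y) * (1 + (p y)\<^sup>2 + (q y)\<^sup>2)" using PDE[OF y] rho by simp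
    moreover have "1 + (p y)\<^sup>2 + (q y)\<^sup>2 = c\<^sup>2 * (1 + (T y)\<^sup>2)"
    proof -
      have "(p y)\<^sup>2 + (q y)\<^sup>2 = (ca\<^sup>2 + sa\<^sup>2) * (c\<^sup>2 * (T y)\<^sup>2 + k\<^sup>2)"
        unfolding pq[OF y] by (simp add: power2_eq_square algebra_simps)
      then show ?thesis unfolding cs using c2 by (simp add: algebra_simps)
    qed
    ultimately have "H y * c\<^sup>2 = deriv \<phi> (v y) * (c\<^sup>2 * (1 + (T y)\<^sup>2))" by simp
    then have "c\<^sup>2 * H y = c\<^sup>2 * (deriv \<phi> (v y) * (1 + (T y)\<^sup>2))" by (simp only: mult_ac)
    then show ?thesis using c by simp
  qed
  have dT: "(T has_derivative (\<lambda>h. l h * H y / c)) (at y)" if y: "y \<in> D" for y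
  proof -
    have "(T has_derivative (\<lambda>h. (ca * (h$1 * A y + h$2 * B y) + sa * (h$1 * B y + h$2 * C y)) / c)) (at y)"
      using dw[OF smooth(1) y] dw[OF smooth(2) y] pjp[OF y] c unfolding 12 T_def[abs_def]
      by (auto intro!: derivative_eq_intros)
    moreover have "ca * (h$1 * A y + h$2 * B y) + sa * (h$1 * B y + h$2 * C y) = l h * H y" for h
    proof -
      have "ca * (h$1 * A y + h$2 * B y) + sa * (h$1 * B y + h$2 * C y) = (ca\<^sup>2 + sa\<^sup>2) * (l h * H y)"
        unfolding ABC[OF y] l_def by (simp add: power2_eq_square algebra_simps)
      then show ?thesis unfolding cs by simp
    qed
    ultimately show ?thesis by simp
  qed
  have dv: "(v has_derivative (\<lambda>h. l h * T y / c)) (at y)" if y: "y \<in> D" for y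
  proof -
    have "((\<lambda>y. w y - k * (ca * y$2 - sa * y$1)) has_derivative
        (\<lambda>h. (h$1 * p y + h$2 * q y) - k * (ca * h$2 - sa * h$1))) (at y)"
      using dw[OF w y] unfolding 12 by (auto intro!: derivative_eq_intros dn)
    from has_derivative_mult_right[OF this, of "inverse (c\<^sup>2)"]
    have "(v has_derivative (\<lambda>h. ((h$1 * p y + h$2 * q y) - k * (ca * h$2 - sa * h$1)) / c\<^sup>2)) (at y)"
      unfolding v_def[abs_def] by (simp add: divide_inverse mult.commute)
    moreover have "((h$1 * p y + h$2 * q y) - k * (ca * h$2 - sa * h$1)) / c\<^sup>2 = l h * T y / c" for h
      unfolding pq[OF y] l_def using c by (simp add: power2_eq_square field_simps)
    ultimately show ?thesis by simp
  qed
  define s where "s y = arctan (T y)" for y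
  have ang: "s y \<in> angles" for y unfolding s_def by (rule arctan_angles)
  have tan_s: "tan (s y) = T y" for y unfolding s_def by (rule tan_arctan)
  have ds: "(s has_derivative (\<lambda>h. l h * deriv \<phi> (v y) / c)) (at y)" if y: "y \<in> D" for y
  proof -
    have "(s has_derivative (\<lambda>h. inverse (1 + (T y)\<^sup>2) * (l h * H y / c))) (at y)"
      unfolding s_def[abs_def]
      using has_derivative_compose[OF dT[OF y] DERIV_arctan[unfolded has_field_derivative_def]] .
    moreover have "1 + (T y)\<^sup>2 \<noteq> 0" using add_pos_nonneg[of 1 "(T y)\<^sup>2"] by simp
    moreover have "inverse W * (a * (r * W) / c) = a * r / c" if "W \<noteq> 0" for W a r :: real
      using that by (simp add: field_simps)
    ultimately show ?thesis unfolding Heq[OF y] by (simp only: simp_thms)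
  qed
  define F where "F y = \<phi> (v y) + ln (cos (s y))" for y
  have dF: "(F has_derivative (\<lambda>h. 0)) (at y)" if y: "y \<in> D" for y
  proof -
    have 1: "((\<lambda>y. \<phi> (v y)) has_derivative (\<lambda>h. deriv \<phi> (v y) * (l h * T y / c))) (at y)"
      using has_derivative_compose[OF dv[OF y] d\<phi>[unfolded has_field_derivative_def]] .
    have "((\<lambda>t. ln (cos t)) has_real_derivative - tan (s y)) (at (s y))"
      using cos_angles[OF ang[of y]] by (auto intro!: derivative_eq_intros simp: tan_def divide_inverse)
    from has_derivative_compose[OF ds[OF y] this[unfolded has_field_derivative_def]]
    have 2: "((\<lambda>y. ln (cos (s y))) has_derivative (\<lambda>h. - tan (s y) * (l h * deriv \<phi> (v y) / c))) (at y)" .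
    show "(F has_derivative (\<lambda>h. 0)) (at y)"
      using has_derivative_add[OF 1 2] unfolding F_def[abs_def] tan_s by (simp add: algebra_simps)
  qed
  have c0': "h u0 (s y0) = v y0" "xi u0 (s y0) = (l y0 - \<beta>) / c"
    using c0 unfolding contact_def Let_def c_def[symmetric] s_def T_def v_def l_def by auto
  have F0: "F y0 = \<phi> u0" unfolding F_def c0'(1)[symmetric] h_def by simp
  have hv: "h u0 (s y) = v y" if y: "y \<in> D" for y
  proof -
    have "\<phi> u0 - ln (cos (s y)) = \<phi> (v y)" using const0[OF dF y] F0 unfolding F_def by simp
    then show ?thesis unfolding h_def by simp
  qed
  define G where "G y = xi u0 (s y) - l y / c" for y
  have dG: "(G has_derivative (\<lambda>h. 0)) (at y)" if y: "y \<in> D" for y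
  proof -
    have "((\<lambda>y. xi u0 (s y)) has_derivative (\<lambda>t. 1 / deriv \<phi> (h u0 (s y)) * (l t * deriv \<phi> (v y) / c))) (at y)"
      by (rule has_derivative_compose[OF ds[OF y] xi(2)[OF ang, unfolded has_field_derivative_def]])
    then have 1: "((\<lambda>y. xi u0 (s y)) has_derivative (\<lambda>t. 1 / deriv \<phi> (v y) * (l t * deriv \<phi> (v y) / c))) (at y)"
      unfolding hv[OF y] .
    have 2: "((\<lambda>y. l y / c) has_derivative (\<lambda>h. l h / c)) (at y)"
      using c by (auto intro!: derivative_eq_intros dl)
    show ?thesis
      using has_derivative_diff[OF 1 2] \<phi>pos[of "v y"] unfolding G_def[abs_def] by simp
  qed
  have "xi u0 (s y) - l y / c = (l y0 - \<beta>) / c - l y0 / c"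
    using const0[OF dG y] c0'(2) unfolding G_def by simp
  then have "xi u0 (s y) = (l y - \<beta>) / c" by (simp add: diff_divide_distrib)
  then show ?thesis
    unfolding contact_def Let_def c_def[symmetric]
    using kD[OF y] hv[OF y] unfolding s_def T_def v_def l_def by simp
qed

end

section \<open>Limits of non-vertical tangent planes\<close>

lemma graph_chart_subset:
  assumes gc: "graph_chart t1 t2 t3 M X D f w" and D': "open D'" "D' \<subseteq> D"
  shows "graph_chart t1 t2 t3 M X D' f w"
proof -
  note cD = graph_chartD[OF gc]
  obtain g where g: "homeomorphism D (f ` D) f g" using cD(5) unfolding regular_param_def by auto
  have "homeomorphism D' (f ` D') f g"
    by (rule homeomorphism_of_subsets[OF g D'(2) _ refl]) (use D' in auto)
  moreover have "openin (top_of_set M) (f ` D')" by (rule cD(7)[OF D'])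
  ultimately have "regular_param M X D' f"
    using cD(5) D' unfolding regular_param_def by (auto intro: smooth_on_subset)
  then show ?thesis using cD(2,6) D' unfolding graph_chart_def by (auto intro: smooth_on_subset)
qed

text \<open>A point of \<open>M\<close> determines its parameters in a fixed frame, so two charts
  through it represent the same function near these parameters. Derivatives at a point of
  \<open>M\<close> thus do not depend on the chart.\<close>

lemma graph_charts_agree:
  assumes fr: "frame t1 t2 t3" and gc: "graph_chart t1 t2 t3 M X D f w" and gc': "graph_chart t1 t2 t3 M X D' f' w'"
    and y: "y \<in> D" "y' \<in> D'" "f y = f' y'"
  shows "y' = y" "pd i w' y = pd i w y" "pd i (pd j w') y = pd i (pd j w) y"
proof -
  note c = graph_chartD[OF gc] and c' = graph_chartD[OF gc']
  show yy: "y' = y" using graph_chart_coords(1)[OF fr gc y(1)] graph_chart_coords(1)[OF fr gc' y(2)] y(3) by simp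
  obtain T where T: "open T" "f ` D = M \<inter> T" using c(7)[OF c(1) order_refl] by (auto simp: openin_open)
  define U where "U = D' \<inter> f' -` T"
  have U: "open U" unfolding U_def by (rule continuous_open_preimage[OF c'(3) c'(1) T(1)])
  have "f y \<in> T" using y(1) T(2) by blast
  then have yU: "y \<in> U" unfolding U_def using y yy by auto
  have ww: "w' z = w z" if z: "z \<in> U" for z
  proof -
    have "f' z \<in> f ` D" using z T(2) c'(4) unfolding U_def by auto
    then obtain x where x: "x \<in> D" "f' z = f x" by auto
    have zD: "z \<in> D'" using z unfolding U_def by auto
    have "x = z" using graph_chart_coords(1)[OF fr gc x(1)] graph_chart_coords(1)[OF fr gc' zD] x(2) by simp
    then show ?thesis using graph_chart_coords(2)[OF fr gc x(1)] graph_chart_coords(2)[OF fr gc' zD] x(2) by simp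
  qed
  show "pd i w' y = pd i w y" by (rule pd_cong[OF U yU ww])
  have "pd j w' z = pd j w z" if "z \<in> U" for z by (rule pd_cong[OF U that ww])
  then show "pd i (pd j w') y = pd i (pd j w) y" by (rule pd_cong[OF U yU])
qed

text \<open>The relation w(coords P) = P \<bullet> t3 is differentiated in an arbitrary
  parametrization, which is available also at limit points not yet known to lie in a graph chart
  over this frame.\<close>

lemma graph_normal_orthogonal:
  assumes fr: "frame t1 t2 t3" and gc: "graph_chart t1 t2 t3 M X D f w" and y: "y \<in> D"
    and F: "regular_param M X V F" "x \<in> V" "F x = f y"
  shows "(t3 - pd 1 w y *\<^sub>R t1 - pd 2 w y *\<^sub>R t2) \<bullet> partial i (X \<circ> F) x = 0"
proof -
  note c = graph_chartD[OF gc]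
  define P where "P = X \<circ> F"
  have V: "open V" and sP: "smooth_on V P" and FV: "openin (top_of_set M) (F ` V)"
    using F(1) unfolding regular_param_def P_def by auto
  have FM: "F ` V \<subseteq> M" using openin_imp_subset[OF FV] .
  have cF: "continuous_on V F" using F(1) unfolding regular_param_def homeomorphism_def by auto
  obtain T where T: "open T" "f ` D = M \<inter> T" using c(7)[OF c(1) order_refl] by (auto simp: openin_open)
  define U where "U = V \<inter> F -` T"
  have U: "open U" unfolding U_def by (rule continuous_open_preimage[OF cF V T(1)])
  have xU: "x \<in> U" unfolding U_def using F(2,3) T(2) y by auto
  have eq: "w (coords t1 t2 (P z)) = P z \<bullet> t3" if z: "z \<in> U" for z
  proof -
    have "F z \<in> f ` D" using z T(2) FM unfolding U_def by auto
    then obtain u where "u \<in> D" "F z = f u" by auto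
    then show ?thesis using graph_chart_coords[OF fr gc] unfolding P_def by simp
  qed
  have dP: "(P has_derivative frechet_derivative P (at x)) (at x)" by (rule smooth_on_has_derivative[OF sP F(2)])
  have Px: "coords t1 t2 (P x) = y" using graph_chart_coords(1)[OF fr gc y] F(3) unfolding P_def by simp
  have dc: "((\<lambda>z. coords t1 t2 (P z)) has_derivative (\<lambda>v. coords t1 t2 (frechet_derivative P (at x) v))) (at x)"
    using bounded_linear.has_derivative[OF bounded_linear_coords dP] .
  have dw: "(w has_derivative (\<lambda>v. v$1 * pd 1 w y + v$2 * pd 2 w y)) (at (coords t1 t2 (P x)))"
    unfolding Px by (rule pd_has_derivative[OF c(2) y])
  have 1: "((\<lambda>z. w (coords t1 t2 (P z))) has_derivative
     (\<lambda>v. (frechet_derivative P (at x) v \<bullet> t1) * pd 1 w y + (frechet_derivative P (at x) v \<bullet> t2) * pd 2 w y)) (at x)"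
    using has_derivative_compose[OF dc dw] by simp
  have 2: "((\<lambda>z. P z \<bullet> t3) has_derivative (\<lambda>v. frechet_derivative P (at x) v \<bullet> t3)) (at x)"
    by (rule has_derivative_inner_left[OF dP])
  have "((\<lambda>z. w (coords t1 t2 (P z))) has_derivative (\<lambda>v. frechet_derivative P (at x) v \<bullet> t3)) (at x)"
    by (rule has_derivative_transform_within_open[OF 2 U xU]) (simp add: eq)
  from has_derivative_unique[OF 1 this]
  have "(v \<bullet> t1) * pd 1 w y + (v \<bullet> t2) * pd 2 w y = v \<bullet> t3" if "v = frechet_derivative P (at x) (axis i 1)" for v
    unfolding that by (rule fun_cong)
  from this[of "partial i P x"] show ?thesis
    unfolding partial_def P_def[symmetric] by (simp add: inner_diff_left inner_diff_right inner_commute mult.commute)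
qed

text \<open>
  The normal \<open>t3 - g1' t1 - g2' t2\<close> is a limit of normals, so the tangent plane at \<open>q\<close> is again a graph
  over the plane of \<open>t1\<close> and \<open>t2\<close>.
\<close>

lemma graph_chart_limit:
  fixes M :: "('a::{t2_space, second_countable_topology}) set"
  assumes fr: "frame t1 t2 t3" and imm: "immersed_surface M X" and q: "q \<in> M"
    and \<sigma>: "\<sigma> \<longlonglongrightarrow> q"
    and jet: "\<And>n::nat. \<exists>D f w. graph_chart t1 t2 t3 M X D f w \<and> y n \<in> D \<and> f (y n) = \<sigma> n \<and> pd 1 w (y n) = g1 n \<and> pd 2 w (y n) = g2 n"
    and g: "g1 \<longlonglongrightarrow> g1'" "g2 \<longlonglongrightarrow> g2'"
  obtains D f w y' where "graph_chart t1 t2 t3 M X D f w" "y' \<in> D" "f y' = q" "y \<longlonglongrightarrow> y'"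
    "pd 1 w y' = g1'" "pd 2 w y' = g2'" "eventually (\<lambda>n. y n \<in> D \<and> f (y n) = \<sigma> n) sequentially"
proof -
  have \<sigma>M: "\<sigma> n \<in> M" and yc: "y n = coords t1 t2 (X (\<sigma> n))" for n
  proof -
    obtain D f w where c: "graph_chart t1 t2 t3 M X D f w" "y n \<in> D" "f (y n) = \<sigma> n" using jet[of n] by blast
    show "\<sigma> n \<in> M" using graph_chartD(4)[OF c(1)] c(2,3) by auto
    show "y n = coords t1 t2 (X (\<sigma> n))" using graph_chart_coords(1)[OF fr c(1,2)] c(3) by simp
  qed
  obtain V F x where F: "regular_param M X V F" "x \<in> V" "F x = q"
    using imm q unfolding immersed_surface_def by (metis imageE)
  obtain G where G: "homeomorphism V (F ` V) F G" using F(1) unfolding regular_param_def by auto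
  define P where "P = X \<circ> F"
  have sP: "smooth_on V P" using F(1) unfolding regular_param_def P_def by auto
  obtain T where T: "open T" "F ` V = M \<inter> T" using F(1) unfolding regular_param_def by (auto simp: openin_open)
  have "q \<in> T" using F(2,3) T(2) by auto
  then have ev: "eventually (\<lambda>n. \<sigma> n \<in> F ` V) sequentially"
    using topological_tendstoD[OF \<sigma> T(1)] \<sigma>M T(2) by (auto elim: eventually_mono)
  define xs where "xs n = G (\<sigma> n)" for n
  have xl: "xs \<longlonglongrightarrow> x"
  proof -
    have "(\<lambda>n. G (\<sigma> n)) \<longlonglongrightarrow> G q"
      by (rule continuous_on_tendsto_compose[of "F ` V" G, OF _ \<sigma>]) (use G F ev in \<open>auto simp: homeomorphism_def\<close>)
    then show ?thesis unfolding xs_def using G F(2,3) by (auto simp: homeomorphism_def)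
  qed
  have xsV: "eventually (\<lambda>n. xs n \<in> V \<and> F (xs n) = \<sigma> n) sequentially"
    using ev by (rule eventually_mono) (use G in \<open>auto simp: homeomorphism_def xs_def\<close>)
  define n0 where "n0 = t3 - g1' *\<^sub>R t1 - g2' *\<^sub>R t2"
  \<comment> \<open>The normals of the graphs are orthogonal to the partial derivatives of one fixed
    parametrization around the limit point, and both converge.\<close>
  have orth: "n0 \<bullet> partial i P x = 0" for i
  proof (rule LIMSEQ_unique)
    have "continuous_on V (partial i P)"
      unfolding partial_def[abs_def] by (rule smooth_on_imp_continuous_on[OF smooth_on_derivative[OF sP]])
    then have "(\<lambda>n. partial i P (xs n)) \<longlonglongrightarrow> partial i P x"
      by (rule continuous_on_tendsto_compose[OF _ xl F(2)]) (use xsV in \<open>auto elim: eventually_mono\<close>)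
    then show "(\<lambda>n. (t3 - g1 n *\<^sub>R t1 - g2 n *\<^sub>R t2) \<bullet> partial i P (xs n)) \<longlonglongrightarrow> n0 \<bullet> partial i P x"
      unfolding n0_def by (intro tendsto_intros g)
    have "eventually (\<lambda>n. (t3 - g1 n *\<^sub>R t1 - g2 n *\<^sub>R t2) \<bullet> partial i P (xs n) = 0) sequentially"
      using xsV
    proof (rule eventually_mono)
      fix n assume n: "xs n \<in> V \<and> F (xs n) = \<sigma> n"
      obtain D f w where c: "graph_chart t1 t2 t3 M X D f w" "y n \<in> D" "f (y n) = \<sigma> n" "pd 1 w (y n) = g1 n" "pd 2 w (y n) = g2 n"
        using jet[of n] by blast
      show "(t3 - g1 n *\<^sub>R t1 - g2 n *\<^sub>R t2) \<bullet> partial i P (xs n) = 0"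
        using graph_normal_orthogonal[OF fr c(1,2) F(1), of "xs n" i] n c(3,4,5) unfolding P_def by simp
    qed
    then show "(\<lambda>n. (t3 - g1 n *\<^sub>R t1 - g2 n *\<^sub>R t2) \<bullet> partial i P (xs n)) \<longlonglongrightarrow> 0"
      by (rule tendsto_eventually)
  qed
  define \<nu> where "\<nu> = cross3 (partial 1 P x) (partial 2 P x)"
  have \<nu>0: "\<nu> \<noteq> 0" unfolding \<nu>_def P_def by (rule chart_normal_nonzero[OF F(1,2)])
  have "\<nu> \<bullet> t3 \<noteq> 0"
  proof
    assume 0: "\<nu> \<bullet> t3 = 0"
    \<comment> \<open>Orthogonal to both partial derivatives, n0 is parallel to the normal \<nu>;
      since n0 has t3-component 1, \<nu> cannot be orthogonal to t3.\<close>
    have "cross3 n0 \<nu> = 0" unfolding \<nu>_def Lagrange using orth by simp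
    then have e: "(n0 \<bullet> \<nu>) *\<^sub>R n0 = (n0 \<bullet> n0) *\<^sub>R \<nu>" using Lagrange[of n0 n0 \<nu>] by simp
    have n3: "n0 \<bullet> t3 = 1" unfolding n0_def by (simp add: inner_diff_left frame_inner[OF fr])
    have "((n0 \<bullet> \<nu>) *\<^sub>R n0) \<bullet> t3 = ((n0 \<bullet> n0) *\<^sub>R \<nu>) \<bullet> t3" unfolding e ..
    then have "n0 \<bullet> \<nu> = 0" using n3 0 by simp
    then have "(n0 \<bullet> n0) *\<^sub>R \<nu> = 0" using e by simp
    then show False using \<nu>0 n3 by auto
  qed
  then obtain y' r f w where c: "r > 0" "graph_chart t1 t2 t3 M X (ball y' r) f w" "f y' = q"
    using graph_chart_exists[OF fr F(1,2), of thesis] F(3) unfolding \<nu>_def P_def by auto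
  note cD = graph_chartD[OF c(2)]
  have y'D: "y' \<in> ball y' r" using c(1) by simp
  have y': "y' = coords t1 t2 (X q)" using graph_chart_coords(1)[OF fr c(2) y'D] c(3) by simp
  have yl: "y \<longlonglongrightarrow> y'"
    unfolding yc[abs_def] y'
    by (rule bounded_linear.tendsto[OF bounded_linear_coords], rule continuous_on_tendsto_compose[OF continuous_on_immersion[OF imm] \<sigma> q])
      (use \<sigma>M in auto)
  obtain O' where O: "open O'" "f ` ball y' r = M \<inter> O'" using cD(7)[OF cD(1) order_refl] by (auto simp: openin_open)
  have "q \<in> O'" using O(2) c(3) y'D by auto
  then have "eventually (\<lambda>n. \<sigma> n \<in> O') sequentially" using topological_tendstoD[OF \<sigma> O(1)] by simp
  then have ev2: "eventually (\<lambda>n. y n \<in> ball y' r \<and> f (y n) = \<sigma> n) sequentially"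
  proof (rule eventually_mono)
    fix n assume "\<sigma> n \<in> O'"
    then have "\<sigma> n \<in> f ` ball y' r" unfolding O(2) using \<sigma>M[of n] by simp
    then obtain z where z: "z \<in> ball y' r" "\<sigma> n = f z" by (rule imageE)
    then have "y n = z" using yc[of n] graph_chart_coords(1)[OF fr c(2) z(1)] by simp
    then show "y n \<in> ball y' r \<and> f (y n) = \<sigma> n" using z by simp
  qed
  have "pd i w y' = g'" if "g \<longlonglongrightarrow> g'"
    and gn: "\<And>n. y n \<in> ball y' r \<Longrightarrow> f (y n) = \<sigma> n \<Longrightarrow> pd i w (y n) = g n" for i g g'
  proof (rule LIMSEQ_unique[OF _ that(1)])
    have "(\<lambda>n. pd i w (y n)) \<longlonglongrightarrow> pd i w y'"
      by (rule continuous_on_tendsto_compose[OF smooth_on_imp_continuous_on[OF smooth_on_pd[OF cD(2)]] yl y'D])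
        (use ev2 in \<open>auto elim: eventually_mono\<close>)
    then show "g \<longlonglongrightarrow> pd i w y'"
      by (rule Lim_transform_eventually) (use ev2 gn in \<open>auto elim: eventually_mono\<close>)
  qed
  moreover have "pd 1 w (y n) = g1 n" "pd 2 w (y n) = g2 n" if n: "y n \<in> ball y' r" "f (y n) = \<sigma> n" for n
  proof -
    obtain D f' w' where c': "graph_chart t1 t2 t3 M X D f' w'" "y n \<in> D" "f' (y n) = \<sigma> n" "pd 1 w' (y n) = g1 n" "pd 2 w' (y n) = g2 n"
      using jet[of n] by blast
    show "pd 1 w (y n) = g1 n" "pd 2 w (y n) = g2 n"
      using graph_charts_agree(2)[OF fr c'(1) c(2) c'(2) n(1)] c'(3-5) n(2) by auto
  qed
  ultimately have "pd 1 w y' = g1'" "pd 2 w y' = g2'" using g by blast+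
  then show ?thesis using that[OF c(2) y'D c(3) yl _ _ ev2] by blast
qed

text \<open>The developing map is the projection to the frame coordinates, and \<open>X\<close> is
  injective because already its composite with this projection is.\<close>

lemma graph_over_domain:
  fixes M :: "('a::{t2_space, second_countable_topology}) set"
  assumes imm: "immersed_surface M X" and con: "connected M" and compl: "complete_surface M X" and ne: "M \<noteq> {}"
    and fr: "frame t1 t2 t3" and conv: "convex \<Omega>"
    and chart: "\<And>q. q \<in> M \<Longrightarrow> \<exists>D f w y. graph_chart t1 t2 t3 M X D f w \<and> y \<in> D \<and> f y = q"
    and \<Omega>: "\<And>q. q \<in> M \<Longrightarrow> coords t1 t2 (X q) \<in> \<Omega> \<and> X q = G (coords t1 t2 (X q))"
    and G: "\<And>y. y \<in> \<Omega> \<Longrightarrow> (G has_derivative G' y) (at y)" "\<And>v. continuous_on \<Omega> (\<lambda>y. G' y v)"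
  shows "inj_on X M" "X ` M = G ` \<Omega>"
proof -
  interpret developed_surface M X "\<lambda>q. coords t1 t2 (X q)" \<Omega> G G'
  proof
    show "continuous_on M (\<lambda>q. coords t1 t2 (X q))"
      by (rule bounded_linear.continuous_on[OF bounded_linear_coords continuous_on_immersion[OF imm]])
    show "\<exists>D f. open D \<and> continuous_on D f \<and> f ` D \<subseteq> M \<and>
        (\<forall>D'. open D' \<and> D' \<subseteq> D \<longrightarrow> openin (top_of_set M) (f ` D')) \<and> p \<in> f ` D \<and> (\<forall>y\<in>D. coords t1 t2 (X (f y)) = y)"
      if p: "p \<in> M" for p
    proof -
      obtain D f w y where c: "graph_chart t1 t2 t3 M X D f w" "y \<in> D" "f y = p" using chart[OF p] by blast
      note cD = graph_chartD[OF c(1)]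
      show ?thesis
        by (intro exI[of _ D] exI[of _ f]) (use c cD(1,3,4,7) graph_chart_coords(1)[OF fr c(1)] in auto)
    qed
  qed (use imm con compl ne conv \<Omega> G in auto)
  have bij: "bij_betw (\<lambda>q. coords t1 t2 (X q)) M \<Omega>" by (rule developing_bijective)
  show "inj_on X M"
    using inj_on_imageI2[of "coords t1 t2" X M] bij by (simp add: bij_betw_def comp_def)
  have "X ` M = G ` ((\<lambda>q. coords t1 t2 (X q)) ` M)" using \<Omega> by (force simp: image_image)
  then show "X ` M = G ` \<Omega>" using bij by (simp add: bij_betw_def)
qed

section \<open>Rulings of non-zero inclination\<close>

lemma frame_standard: "frame (axis 1 1) (axis 2 1) (axis 3 1)"
  unfolding frame_def by (simp add: inner_axis_axis cross_basis)

definition lift3 :: "real^2 \<Rightarrow> real \<Rightarrow> real^3"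
  where "lift3 y z = y$1 *\<^sub>R axis 1 1 + y$2 *\<^sub>R axis 2 1 + z *\<^sub>R axis 3 1"

lemma lift3_nth [simp]: "lift3 y z $ 1 = y$1" "lift3 y z $ 2 = y$2" "lift3 y z $ 3 = z"
  unfolding lift3_def by (simp_all add: axis_def)

lemma lift3_add: "lift3 (y + y') (z + z') = lift3 y z + lift3 y' z'"
  by (simp add: vec_eq_iff forall_3)

lemma lift3_scale: "lift3 (s *\<^sub>R y) (s * z) = s *\<^sub>R lift3 y z"
  by (simp add: vec_eq_iff forall_3)

lemma continuous_zero_of_eventually:
  fixes f :: "real^2 \<Rightarrow> real"
  assumes "continuous_on D f" "y \<longlonglongrightarrow> y'" "y' \<in> D" "eventually (\<lambda>n::nat. y n \<in> D \<and> f (y n) = 0) sequentially"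
  shows "f y' = 0"
proof (rule LIMSEQ_unique)
  show "(\<lambda>n. f (y n)) \<longlonglongrightarrow> f y'"
    by (rule continuous_on_tendsto_compose[OF assms(1-3)]) (use assms(4) in \<open>auto elim: eventually_mono\<close>)
  show "(\<lambda>n. f (y n)) \<longlonglongrightarrow> 0"
    by (rule tendsto_eventually) (use assms(4) in \<open>auto elim: eventually_mono\<close>)
qed

locale soliton = velocity \<phi> for \<phi> :: "real \<Rightarrow> real" +
  fixes M :: "('a::{t2_space, second_countable_topology}) set" and X :: "'a \<Rightarrow> real^3"
  assumes imm: "immersed_surface M X" and ne: "M \<noteq> {}" and con: "connected M" and compl: "complete_surface M X"
    and flat: "flat_surface M X" and mini: "phi_minimal \<phi> M X"
begin

abbreviation "chart \<equiv> graph_chart (axis 1 1) (axis 2 1) (axis 3 1) M X"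
abbreviation "pr \<equiv> coords (axis 1 1) (axis 2 1)"

lemma chart_X:
  assumes "chart D f w" "y \<in> D"
  shows "X (f y) = lift3 y (w y)" "pr (X (f y)) = y" "X (f y) $ 3 = w y" "f y \<in> M"
  using graph_chartD(4,6)[OF assms(1)] assms(2) graph_chart_coords(1)[OF frame_standard assms]
  by (auto simp: lift3_def[symmetric])

lemma chart_soliton:
  assumes "chart D f w"
  shows "soliton_graph \<phi> D w 1 2"
proof
  fix y assume y: "y \<in> D"
  note pde = graph_chart_pde[OF frame_standard assms y flat mini]
  show "pd 1 (pd 1 w) y * pd 2 (pd 2 w) y = (pd 1 (pd 2 w) y)\<^sup>2" by (rule pde(1))
  have "e3 \<bullet> (axis 3 1 - pd 1 w y *\<^sub>R axis 1 1 - pd 2 w y *\<^sub>R axis 2 1) = 1"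
    unfolding e3_def by (simp add: inner_diff_right inner_axis_axis)
  then show "(1 + (pd 2 w y)\<^sup>2) * pd 1 (pd 1 w) y - 2 * pd 1 w y * pd 2 w y * pd 1 (pd 2 w) y +
    (1 + (pd 1 w y)\<^sup>2) * pd 2 (pd 2 w) y = deriv \<phi> (w y) * (1 + (pd 1 w y)\<^sup>2 + (pd 2 w y)\<^sup>2)"
    using pde(2) chart_X(3)[OF assms y] by simp
qed (use \<phi> \<phi>pos graph_chartD(1,2)[OF assms] in auto)

lemma chart_soliton_ij:
  assumes "chart D f w" "i \<noteq> j"
  shows "soliton_graph \<phi> D w i j"
proof -
  have "(i = 1 \<and> j = 2) \<or> (i = 2 \<and> j = 1)" using assms(2) exhaust_2[of i] exhaust_2[of j] by auto
  then show ?thesis using chart_soliton[OF assms(1)] soliton_graph.soliton_graph_swap[OF chart_soliton[OF assms(1)]] by auto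
qed

lemma positive_ball:
  assumes c: "chart D f w" and y: "y \<in> D" and ij: "i \<noteq> j" and pos: "pd i (pd i w) y > 0"
  obtains r where "r > 0" "ball y r \<subseteq> D" "chart (ball y r) f w" "convex_soliton_graph \<phi> (ball y r) w i j"
proof -
  note cD = graph_chartD[OF c]
  have "continuous_on D (pd i (pd i w))"
    by (rule smooth_on_imp_continuous_on[OF smooth_on_pd[OF smooth_on_pd[OF cD(2)]]])
  then have "open (D \<inter> pd i (pd i w) -` {0<..})"
    by (rule continuous_open_preimage[OF _ cD(1)]) simp
  moreover have "y \<in> D \<inter> pd i (pd i w) -` {0<..}" using y pos by simp
  ultimately obtain r where r: "r > 0" "ball y r \<subseteq> D \<inter> pd i (pd i w) -` {0<..}" using openE by blast
  have sub: "ball y r \<subseteq> D" using r by auto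
  have "convex_soliton_graph \<phi> (ball y r) w i j"
    unfolding convex_soliton_graph_def convex_soliton_graph_axioms_def
    using soliton_graph.soliton_graph_subset[OF chart_soliton_ij[OF c ij] open_ball sub] r by auto
  then show ?thesis using that r(1) sub graph_chart_subset[OF c open_ball sub] by blast
qed

text \<open>
  Along a ruling of slope \<open>\<kappa> \<noteq> 0\<close>, completeness makes every height occur, and the ruling
  stays inside the non-vertical part of the surface since its tangent plane is constant.
\<close>

lemma ruling_reaches:
  assumes c: "chart D f w" and y: "y \<in> D" and ij: "i \<noteq> j" and csg: "convex_soliton_graph \<phi> D w i j"
    and \<kappa>: "convex_soliton_graph.\<kappa> w i j y \<noteq> 0"
  shows "\<exists>D' f' w' y'. chart D' f' w' \<and> y' \<in> D' \<and> w' y' = z \<and> convex_soliton_graph \<phi> D' w' i j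
     \<and> convex_soliton_graph.\<kappa> w' i j y' \<noteq> 0"
proof -
  interpret g: convex_soliton_graph \<phi> D w i j by (rule csg)
  define m0 where "m0 = g.m y"
  define \<kappa>0 where "\<kappa>0 = g.\<kappa> y"
  define gi where "gi = pd i w y"
  define gj where "gj = pd j w y"
  define n where "n = g.nul m0"
  \<comment> \<open>The signed parameter at which the ruling, rising at rate \<kappa>0, attains the
    height \<open>z\<close>.\<close>
  define s where "s = (z - w y) / \<kappa>0"
  have \<kappa>0: "\<kappa>0 \<noteq> 0" "\<kappa>0 = gj + m0 * gi" using \<kappa> unfolding \<kappa>0_def g.\<kappa>_def gi_def gj_def m0_def by auto
  define V where "V = s *\<^sub>R lift3 n \<kappa>0"
  define cc where "cc t = X (f y) + t *\<^sub>R V" for t :: real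
  \<comment> \<open>Only closed conditions are carried along: gradient and null direction, both
    constant on the ruling. Positivity of the second derivative is not closed and is recovered each
    time from \<open>null_imp_pos\<close>.\<close>
  define St where "St p t \<longleftrightarrow> (\<exists>D f w y. chart D f w \<and> y \<in> D \<and> f y = p \<and> pd i w y = gi \<and> pd j w y = gj \<and>
      pd i (pd j w) y + m0 * pd i (pd i w) y = 0 \<and> pd j (pd j w) y + m0 * pd i (pd j w) y = 0)" for p and t :: real
  have good: "\<exists>D f w y. chart D f w \<and> y \<in> D \<and> f y = p \<and> convex_soliton_graph \<phi> D w i j \<and> pd i w y = gi \<and> pd j w y = gj \<and>
      convex_soliton_graph.m w i j y = m0 \<and> convex_soliton_graph.\<kappa> w i j y = \<kappa>0 \<and> (\<exists>r>0. D = ball y r)" if St: "St p t" for p t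
  proof -
    obtain D f w y where c: "chart D f w" "y \<in> D" "f y = p" and g: "pd i w y = gi" "pd j w y = gj"
      and n: "pd i (pd j w) y + m0 * pd i (pd i w) y = 0" "pd j (pd j w) y + m0 * pd i (pd j w) y = 0"
      using St unfolding St_def by blast
    have pos: "pd i (pd i w) y > 0"
      by (rule soliton_graph.null_imp_pos[OF chart_soliton_ij[OF c(1) ij] c(2) n])
    obtain r where r: "r > 0" "ball y r \<subseteq> D" "chart (ball y r) f w" "convex_soliton_graph \<phi> (ball y r) w i j"
      by (rule positive_ball[OF c(1,2) ij pos])
    have m: "convex_soliton_graph.m w i j y = m0"
    proof -
      have "pd i (pd j w) y = - m0 * pd i (pd i w) y" using n(1) by simp
      then show ?thesis unfolding convex_soliton_graph.m_def[OF r(4)] using pos by simp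
    qed
    have "convex_soliton_graph.\<kappa> w i j y = \<kappa>0"
      unfolding convex_soliton_graph.\<kappa>_def[OF r(4)] m \<kappa>0(2) g by simp
    then show ?thesis using r c(3) g m
      by (intro exI[of _ "ball y r"] exI[of _ f] exI[of _ w] exI[of _ y]) auto
  qed
  obtain l where l: "\<And>t. t \<in> {0..1} \<Longrightarrow> l t \<in> M \<and> X (l t) = cc t \<and> St (l t) t"
  proof (rule lift_exists[OF imm con compl, where c=cc and c'="\<lambda>_. V" and ?p0.0="f y" and St=St])
    show "(cc has_vector_derivative V) (at t)" for t
      unfolding cc_def by (auto intro!: derivative_eq_intros)
    show "continuous_on {0..1} (\<lambda>_. V)" by simp
    show "f y \<in> M" using chart_X(4)[OF c y] .
    show "X (f y) = cc 0" unfolding cc_def by simp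
    show "St (f y) 0"
      unfolding St_def
      by (intro exI[of _ D] exI[of _ f] exI[of _ w] exI[of _ y] conjI c y refl)
        (simp_all add: gi_def gj_def m0_def g.B_eq[OF y] g.C_eq[OF y])
    show "\<exists>e>0. \<exists>l. continuous_on ({t-e..t+e} \<inter> {0..1}) l \<and> l t = p \<and>
          (\<forall>s\<in>{t-e..t+e} \<inter> {0..1}. l s \<in> M \<and> X (l s) = cc s \<and> St (l s) s)"
      if p: "p \<in> M" "t \<in> {0..1}" "X p = cc t" "St p t" for p t
    proof -
      obtain D f w y r where c: "chart D f w" "y \<in> D" "f y = p" and csg: "convex_soliton_graph \<phi> D w i j"
        and g: "pd i w y = gi" "pd j w y = gj" and m: "convex_soliton_graph.m w i j y = m0"
        and \<kappa>: "convex_soliton_graph.\<kappa> w i j y = \<kappa>0" and r: "r > 0" "D = ball y r"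
        using good[OF p(4)] by blast
      interpret h: convex_soliton_graph \<phi> D w i j by (rule csg)
      have nn: "h.nul m0 = n" unfolding n_def h.nul_def g.nul_def ..
      \<comment> \<open>Keeps the piece of ruling within r/2 of the centre of the chart; the summand
        1 makes the denominator positive even when s = 0.\<close>
      define e where "e = r / (2 * (\<bar>s\<bar> * norm n + 1))"
      have den: "\<bar>s\<bar> * norm n + 1 > 0" by (simp add: add_nonneg_pos)
      have e: "e > 0" unfolding e_def using r den by simp
      have inD: "y + \<tau> *\<^sub>R n \<in> D" if "\<bar>\<tau>\<bar> \<le> e * \<bar>s\<bar>" for \<tau>
      proof -
        have "norm (\<tau> *\<^sub>R n) \<le> e * \<bar>s\<bar> * norm n" using that by (simp add: mult_right_mono)
        also have "\<dots> < e * (\<bar>s\<bar> * norm n + 1)" using e by (simp add: algebra_simps)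
        also have "\<dots> = r / 2" unfolding e_def using den by (simp add: field_simps)
        finally show ?thesis using r by (simp add: dist_norm)
      qed
      define l where "l t' = f (y + ((t' - t) * s) *\<^sub>R n)" for t'
      have lt: "y + ((t' - t) * s) *\<^sub>R n \<in> D" "\<bar>(t' - t) * s\<bar> \<le> e * \<bar>s\<bar>" if "t' \<in> {t-e..t+e}" for t'
      proof -
        show 1: "\<bar>(t' - t) * s\<bar> \<le> e * \<bar>s\<bar>" unfolding abs_mult using that by (intro mult_right_mono) auto
        show "y + ((t' - t) * s) *\<^sub>R n \<in> D" by (rule inD[OF 1])
      qed
      have "continuous_on ({t-e..t+e} \<inter> {0..1}) l"
        unfolding l_def
        by (rule continuous_on_compose2[OF graph_chartD(3)[OF c(1)]]) (use lt in \<open>auto intro!: continuous_intros\<close>)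
      moreover have "l t = p" unfolding l_def using c(3) by simp
      moreover have "l t' \<in> M \<and> X (l t') = cc t' \<and> St (l t') t'" if t': "t' \<in> {t-e..t+e}" for t'
      proof (intro conjI)
        define \<tau> where "\<tau> = (t' - t) * s"
        have \<tau>: "y + \<tau> *\<^sub>R n \<in> D" "\<tau> \<in> {-(e * \<bar>s\<bar>)..e * \<bar>s\<bar>}" using lt[OF t'] unfolding \<tau>_def abs_le_iff by auto
        have lt': "l t' = f (y + \<tau> *\<^sub>R n)" unfolding l_def \<tau>_def ..
        show "l t' \<in> M" unfolding lt' by (rule chart_X(4)[OF c(1) \<tau>(1)])
        have seg: "y + \<tau> *\<^sub>R h.nul (h.m y) \<in> D" if "\<tau> \<in> {-(e * \<bar>s\<bar>)..e * \<bar>s\<bar>}" for \<tau>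
          unfolding m nn by (rule inD) (use that in auto)
        have 0: "(0::real) \<in> {-(e * \<bar>s\<bar>)..e * \<bar>s\<bar>}" using e by simp
        have rul: "h.m (y + \<tau> *\<^sub>R n) = m0" "h.p (y + \<tau> *\<^sub>R n) = gi" "h.q (y + \<tau> *\<^sub>R n) = gj"
          "w (y + \<tau> *\<^sub>R n) = w y + \<tau> * \<kappa>0"
          using h.ruling[OF seg 0 \<tau>(2), unfolded m nn \<kappa>] g by simp_all
        have "X (l t') = lift3 (y + \<tau> *\<^sub>R n) (w y + \<tau> * \<kappa>0)"
          unfolding lt' using chart_X(1)[OF c(1) \<tau>(1)] rul(4) by simp
        also have "\<dots> = X p + \<tau> *\<^sub>R lift3 n \<kappa>0"
          using chart_X(1)[OF c(1,2)] c(3) by (simp add: lift3_add lift3_scale)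
        also have "\<dots> = cc t'" unfolding p(3) cc_def \<tau>_def V_def by (simp add: algebra_simps)
        finally show "X (l t') = cc t'" .
        show "St (l t') t'"
          unfolding St_def lt'
          by (intro exI[of _ D] exI[of _ f] exI[of _ w] exI[of _ "y + \<tau> *\<^sub>R n"] conjI c \<tau> refl)
            (simp_all add: rul g h.B_eq[OF \<tau>(1)] h.C_eq[OF \<tau>(1)])
      qed
      ultimately show ?thesis using e by blast
    qed
    show "St p t" if p: "p \<in> M" "\<sigma> \<longlonglongrightarrow> p"
      "\<And>k::nat. \<tau> k \<in> {0..1} \<and> \<sigma> k \<in> M \<and> X (\<sigma> k) = cc (\<tau> k) \<and> St (\<sigma> k) (\<tau> k)" for p t \<sigma> \<tau>
    proof -
      \<comment> \<open>The constant gradient, reordered from the indices \<open>i\<close>,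
        \<open>j\<close> to the coordinates 1, 2 in which the limit lemma is stated.\<close>
      define g1 where "g1 = (if i = 1 then gi else gj)"
      define g2 where "g2 = (if i = 1 then gj else gi)"
      have ij2: "(i = 1 \<and> j = 2) \<or> (i = 2 \<and> j = 1)" using ij exhaust_2[of i] exhaust_2[of j] by auto
      have jets: "\<exists>D f w. chart D f w \<and> pr (X (\<sigma> k)) \<in> D \<and> f (pr (X (\<sigma> k))) = \<sigma> k \<and> pd 1 w (pr (X (\<sigma> k))) = g1 \<and> pd 2 w (pr (X (\<sigma> k))) = g2" for k
      proof -
        obtain D f w y where c: "chart D f w" "y \<in> D" "f y = \<sigma> k" "pd i w y = gi" "pd j w y = gj"
          using p(3)[of k] unfolding St_def by blast
        moreover have "pr (X (\<sigma> k)) = y" using chart_X(2)[OF c(1,2)] c(3) by simp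
        ultimately show ?thesis
          unfolding g1_def g2_def using ij2 by auto
      qed
      obtain D f w y' where c: "chart D f w" "y' \<in> D" "f y' = p" and lim: "(\<lambda>k. pr (X (\<sigma> k))) \<longlonglongrightarrow> y'"
        and g: "pd 1 w y' = g1" "pd 2 w y' = g2"
        and ev: "eventually (\<lambda>k. pr (X (\<sigma> k)) \<in> D \<and> f (pr (X (\<sigma> k))) = \<sigma> k) sequentially"
        by (rule graph_chart_limit[OF frame_standard imm p(1,2) jets tendsto_const tendsto_const])
      define F where "F z = pd i (pd j w) z + m0 * pd i (pd i w) z" for z
      define G where "G z = pd j (pd j w) z + m0 * pd i (pd j w) z" for z
      \<comment> \<open>The null relations are known in a chart that varies with \<open>k\<close>;
        independence of the chart moves them to the limit chart, where continuity of second
        derivatives applies.\<close>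
      have FG: "F (pr (X (\<sigma> k))) = 0 \<and> G (pr (X (\<sigma> k))) = 0"
        if k: "pr (X (\<sigma> k)) \<in> D" "f (pr (X (\<sigma> k))) = \<sigma> k" for k
      proof -
        obtain D' f' w' y where c': "chart D' f' w'" "y \<in> D'" "f' y = \<sigma> k"
          "pd i (pd j w') y + m0 * pd i (pd i w') y = 0" "pd j (pd j w') y + m0 * pd i (pd j w') y = 0"
          using p(3)[of k] unfolding St_def by blast
        have y: "y = pr (X (\<sigma> k))" using chart_X(2)[OF c'(1,2)] c'(3) by simp
        note agree = graph_charts_agree(3)[OF frame_standard c(1) c'(1) k(1) c'(2)]
        show ?thesis unfolding F_def G_def using agree c'(3-5) k(2) y by simp
      qed
      note sm = smooth_on_imp_continuous_on[OF smooth_on_pd[OF smooth_on_pd[OF graph_chartD(2)[OF c(1)]]]]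
      have "F y' = 0" "G y' = 0"
        by (rule continuous_zero_of_eventually[of D _ "\<lambda>k. pr (X (\<sigma> k))"], use sm lim c(2) ev FG in
          \<open>auto simp: F_def[abs_def] G_def[abs_def] intro!: continuous_intros elim!: eventually_mono\<close>)+
      moreover have "pd i w y' = gi" "pd j w y' = gj" using g ij2 unfolding g1_def g2_def by auto
      ultimately show "St p t" unfolding St_def F_def G_def using c by blast
    qed
  qed blast
  have "St (l 1) 1" "X (l 1) = cc 1" using l[of 1] by auto
  from good[OF this(1)] obtain D' f' w' y' where c': "chart D' f' w'" "y' \<in> D'" "f' y' = l 1" "convex_soliton_graph \<phi> D' w' i j"
    "convex_soliton_graph.\<kappa> w' i j y' = \<kappa>0" by blast
  have "w' y' = (cc 1) $ 3" using chart_X(3)[OF c'(1,2)] c'(3) \<open>X (l 1) = cc 1\<close> by simp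
  also have "\<dots> = w y + s * \<kappa>0" unfolding cc_def V_def using chart_X(3)[OF c y] by simp
  also have "\<dots> = z" unfolding s_def using \<kappa>0 by simp
  finally show ?thesis using c' \<kappa>0(1) by metis
qed

lemma velocity_constant:
  assumes c: "chart D f w" and y: "y \<in> D" and ij: "i \<noteq> j" and csg: "convex_soliton_graph \<phi> D w i j"
    and \<kappa>: "convex_soliton_graph.\<kappa> w i j y \<noteq> 0"
  shows "deriv \<phi> s = deriv \<phi> t"
proof -
  let ?\<rho> = "deriv \<phi>"
  have d2: "(deriv ?\<rho> has_real_derivative deriv (deriv ?\<rho>) z) (at z)" for z
    by (rule smooth_real_deriv(1)[OF smooth_real_deriv(2)[OF smooth_real_deriv(2)[OF \<phi>]]])
  have zero: "2 * (deriv ?\<rho> z)\<^sup>2 - ?\<rho> z * deriv (deriv ?\<rho>) z = 0" for z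
  proof -
    obtain D' f' w' y' where *: "y' \<in> D'" "w' y' = z" "convex_soliton_graph \<phi> D' w' i j" "convex_soliton_graph.\<kappa> w' i j y' \<noteq> 0"
      using ruling_reaches[OF assms, of z] by blast
    then show ?thesis using convex_soliton_graph.curvature_along_ruling[OF *(3,1)] by simp
  qed
  have d0: "((\<lambda>z. deriv ?\<rho> z / (?\<rho> z)\<^sup>2) has_real_derivative 0) (at z)" for z
  proof -
    have nz: "?\<rho> z \<noteq> 0" using \<phi>pos[of z] by simp
    have "((\<lambda>z. deriv ?\<rho> z / (?\<rho> z)\<^sup>2) has_real_derivative
      (deriv (deriv ?\<rho>) z * (?\<rho> z)\<^sup>2 - deriv ?\<rho> z * (2 * ?\<rho> z * deriv ?\<rho> z)) / ((?\<rho> z)\<^sup>2 * (?\<rho> z)\<^sup>2)) (at z)"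
      using nz by (auto intro!: derivative_eq_intros d2 d\<rho>)
    moreover have "deriv (deriv ?\<rho>) z * (?\<rho> z)\<^sup>2 - deriv ?\<rho> z * (2 * ?\<rho> z * deriv ?\<rho> z)
      = - ?\<rho> z * (2 * (deriv ?\<rho> z)\<^sup>2 - ?\<rho> z * deriv (deriv ?\<rho>) z)" by (simp add: power2_eq_square algebra_simps)
    ultimately show ?thesis unfolding zero by simp
  qed
  \<comment> \<open>Minus the derivative of 1/\<rho>, constant because the identity
    \<open>zero\<close> holds at every height.\<close>
  define C where "C = deriv ?\<rho> 0 / (?\<rho> 0)\<^sup>2"
  have C: "deriv ?\<rho> z / (?\<rho> z)\<^sup>2 = C" for z
    unfolding C_def by (rule DERIV_isconst_all[OF allI[OF d0]])
  have d1: "((\<lambda>z. inverse (?\<rho> z) + C * z) has_real_derivative 0) (at z)" for z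
  proof -
    have "?\<rho> z \<noteq> 0" using \<phi>pos[of z] by simp
    then have "((\<lambda>z. inverse (?\<rho> z) + C * z) has_real_derivative - (deriv ?\<rho> z / (?\<rho> z)\<^sup>2) + C) (at z)"
      by (auto intro!: derivative_eq_intros d\<rho> simp: power2_eq_square divide_inverse)
    then show ?thesis unfolding C by simp
  qed
  define r0 where "r0 = inverse (?\<rho> 0) + C * 0"
  have r0: "inverse (?\<rho> z) + C * z = r0" for z
    unfolding r0_def by (rule DERIV_isconst_all[OF allI[OF d1]])
  have "C = 0"
  proof (rule ccontr)
    assume "C \<noteq> 0"
    \<comment> \<open>The zero of the affine function 1/\<rho> if it were not constant.\<close>
    then have "inverse (?\<rho> (r0 / C)) = 0" using r0[of "r0 / C"] by simp
    then show False using \<phi>pos[of "r0 / C"] by simp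
  qed
  then have "inverse (?\<rho> s) = inverse (?\<rho> t)" using r0[of s] r0[of t] by simp
  then show ?thesis by simp
qed

end

section \<open>Classification\<close>

lemma (in convex_soliton_graph) null_direction_propagates:
  assumes m: "m z = m y" and y: "y \<in> D" and z: "z \<in> D" and n: "bi * A y + bj * B y = 0"
  shows "bi * A z + bj * B z = 0" "bi * B z + bj * C z = 0"
proof -
  have "(bi - bj * m y) * A y = 0" using n unfolding B_eq[OF y] by (simp add: algebra_simps)
  then have "bi = bj * m z" using Apos[OF y] m by simp
  then show "bi * A z + bj * B z = 0" "bi * B z + bj * C z = 0"
    unfolding B_eq[OF z] C_eq[OF z] by (simp_all add: algebra_simps)
qed

context soliton
begin

text \<open>The alternative is global: one point with \<kappa> \<noteq> 0 already makes \<phi>'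
  constant on the whole line. So at every point either \<kappa> or \<phi>'' vanishes, and the
  gradient of the slope with it.\<close>

lemma slope_constant:
  assumes c: "chart D f w" and ij: "i \<noteq> j" and csg: "convex_soliton_graph \<phi> D w i j" and D: "convex D"
    and y: "y \<in> D" and z: "z \<in> D"
  shows "convex_soliton_graph.m w i j y = convex_soliton_graph.m w i j z"
proof -
  interpret g: convex_soliton_graph \<phi> D w i j by (rule csg)
  have "g.\<kappa> x = 0 \<or> deriv (deriv \<phi>) (w x) = 0" if x: "x \<in> D" for x
  proof (rule disjCI)
    assume nz: "deriv (deriv \<phi>) (w x) \<noteq> 0"
    show "g.\<kappa> x = 0"
    proof (rule ccontr)
      assume "g.\<kappa> x \<noteq> 0"
      then have "deriv \<phi> t = deriv \<phi> 0" for t using velocity_constant[OF c x ij csg] by blast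
      then have "deriv \<phi> = (\<lambda>_. deriv \<phi> 0)" by blast
      then have "deriv (deriv \<phi>) (w x) = 0" by (metis deriv_const)
      then show False using nz by simp
    qed
  qed
  then show ?thesis
    using pd_zero_imp_const[OF D g.D g.smooth_m ij _ _ y z] g.slope_locally_constant by blast
qed

lemma two_cases: "(i::2) \<noteq> j \<Longrightarrow> (i = 1 \<and> j = 2) \<or> (i = 2 \<and> j = 1)"
  using exhaust_2[of i] exhaust_2[of j] by auto

lemma adapted_ball:
  assumes c: "chart D f w" and y: "y \<in> D"
  obtains r i j where "r > 0" "ball y r \<subseteq> D" "i \<noteq> j" "chart (ball y r) f w" "convex_soliton_graph \<phi> (ball y r) w i j"
proof -
  have "pd 1 (pd 1 w) y > 0 \<or> pd 2 (pd 2 w) y > 0"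
    by (rule soliton_graph.pos_cases[OF chart_soliton[OF c] y])
  then show ?thesis
  proof
    assume p: "pd 1 (pd 1 w) y > 0"
    show ?thesis by (rule positive_ball[OF c y _ p, of 2]) (use that[of _ 1 2] in auto)
  next
    assume p: "pd 2 (pd 2 w) y > 0"
    show ?thesis by (rule positive_ball[OF c y _ p, of 1]) (use that[of _ 2 1] in auto)
  qed
qed

text \<open>Replaces the slope, which depends on the choice of the index \<open>i\<close>, by a unit
  vector (-sa, ca) spanning the null direction; charts adapted to different indices can thus be
  chained.\<close>

lemma null_propagates:
  assumes c: "chart D f w" and y: "y \<in> D"
    and n: "ca * pd 1 (pd 2 w) y = sa * pd 1 (pd 1 w) y" "ca * pd 2 (pd 2 w) y = sa * pd 1 (pd 2 w) y"
  obtains r where "r > 0" "chart (ball y r) f w"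
    "\<And>z. z \<in> ball y r \<Longrightarrow> ca * pd 1 (pd 2 w) z = sa * pd 1 (pd 1 w) z \<and> ca * pd 2 (pd 2 w) z = sa * pd 1 (pd 2 w) z"
proof -
  obtain r i j where r: "r > 0" "ball y r \<subseteq> D" "i \<noteq> j" "chart (ball y r) f w" "convex_soliton_graph \<phi> (ball y r) w i j"
    by (rule adapted_ball[OF c y])
  interpret g: convex_soliton_graph \<phi> "ball y r" w i j by (rule r(5))
  have y': "y \<in> ball y r" using r(1) by simp
  have com: "pd 2 (pd 1 w) x = pd 1 (pd 2 w) x" if "x \<in> ball y r" for x
    by (rule pd_commute[OF g.D g.w that])
  have "ca * pd 1 (pd 2 w) z = sa * pd 1 (pd 1 w) z \<and> ca * pd 2 (pd 2 w) z = sa * pd 1 (pd 2 w) z" if z: "z \<in> ball y r" for z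
    using two_cases[OF r(3)]
  proof
    assume 12: "i = 1 \<and> j = 2"
    have "- sa * g.A y + ca * g.B y = 0" using n 12 by simp
    from g.null_direction_propagates[OF slope_constant[OF r(4,3,5) convex_ball z y'] y' z this]
    show ?thesis using 12 by simp
  next
    assume 21: "i = 2 \<and> j = 1"
    have "ca * g.A y + - sa * g.B y = 0" using n 21 com[OF y'] by simp
    from g.null_direction_propagates[OF slope_constant[OF r(4,3,5) convex_ball z y'] y' z this]
    show ?thesis using 21 com[OF z] by simp
  qed
  then show ?thesis using that r(1,4) by blast
qed

lemma ruling_frame:
  assumes c: "chart D f w" and y: "y \<in> D"
  obtains ca sa k where "ca\<^sup>2 + sa\<^sup>2 = 1" "ca * pd 1 (pd 2 w) y = sa * pd 1 (pd 1 w) y" "ca * pd 2 (pd 2 w) y = sa * pd 1 (pd 2 w) y"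
    "k = ca * pd 2 w y - sa * pd 1 w y" "k \<ge> 0" "k = 0 \<or> (\<forall>s t. deriv \<phi> s = deriv \<phi> t)"
proof -
  obtain r i j where r: "r > 0" "ball y r \<subseteq> D" "i \<noteq> j" "chart (ball y r) f w" "convex_soliton_graph \<phi> (ball y r) w i j"
    by (rule adapted_ball[OF c y])
  interpret g: convex_soliton_graph \<phi> "ball y r" w i j by (rule r(5))
  have y': "y \<in> ball y r" using r(1) by simp
  define m0 where "m0 = g.m y"
  \<comment> \<open>The null vector is oriented so that the ruling does not descend. This makes k
    \<ge> 0, as a tilting angle between 0 and pi/2 requires.\<close>
  define \<sigma> where "\<sigma> = (if g.\<kappa> y \<ge> 0 then 1 else - 1 :: real)"
  define N where "N = sqrt (1 + m0\<^sup>2)"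
  have N: "N > 0" "N\<^sup>2 = 1 + m0\<^sup>2" unfolding N_def by (simp_all add: add_pos_nonneg)
  define bi where "bi = \<sigma> * m0 / N"
  define bj where "bj = \<sigma> / N"
  have sq: "bi\<^sup>2 + bj\<^sup>2 = 1"
  proof -
    have "\<sigma>\<^sup>2 = 1" unfolding \<sigma>_def by simp
    then have "bi\<^sup>2 + bj\<^sup>2 = (1 + m0\<^sup>2) / N\<^sup>2"
      unfolding bi_def bj_def by (simp add: power_divide power_mult_distrib add_divide_distrib)
    then show ?thesis using N(1) unfolding N(2)[symmetric] by simp
  qed
  have bb: "bi = bj * m0" unfolding bi_def bj_def by simp
  have nul: "bi * g.A y + bj * g.B y = 0" "bi * g.B y + bj * g.C y = 0"
    unfolding bb g.B_eq[OF y'] g.C_eq[OF y'] m0_def by simp_all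
  have kap: "bi * g.p y + bj * g.q y = \<sigma> * g.\<kappa> y / N"
    unfolding bb g.\<kappa>_def m0_def[symmetric] bj_def by (simp add: algebra_simps add_divide_distrib)
  define k where "k = bi * g.p y + bj * g.q y"
  have k0: "k \<ge> 0" unfolding k_def kap \<sigma>_def using N by simp
  have k1: "k = 0 \<or> (\<forall>s t. deriv \<phi> s = deriv \<phi> t)"
  proof (cases "g.\<kappa> y = 0")
    case True then show ?thesis unfolding k_def kap by simp
  next
    case False then show ?thesis using velocity_constant[OF r(4) y' r(3,5)] by blast
  qed
  have com: "pd 2 (pd 1 w) y = pd 1 (pd 2 w) y" by (rule pd_commute[OF g.D g.w y'])
  show ?thesis using two_cases[OF r(3)]
  proof
    assume 12: "i = 1 \<and> j = 2"
    show ?thesis by (rule that[of bj "- bi" k]) (use 12 sq nul k0 k1 in \<open>auto simp: k_def add.commute\<close>)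
  next
    assume 21: "i = 2 \<and> j = 1"
    show ?thesis by (rule that[of bi "- bj" k]) (use 21 sq nul k0 k1 com in \<open>auto simp: k_def add.commute\<close>)
  qed
qed

text \<open>A point of the tilted cylinder with ruling parameter t has transverse coordinate T = t -
  k u and height u + k t; elimination of t gives (1 + k^2) u + k T.\<close>

definition model_height :: "real \<Rightarrow> real \<Rightarrow> real \<Rightarrow> real \<Rightarrow> real \<Rightarrow> real^2 \<Rightarrow> real"
  where "model_height u0 \<beta> ca sa k y = (sqrt (1 + k\<^sup>2))\<^sup>2 * u u0 ((ca * y$1 + sa * y$2 - \<beta>) / sqrt (1 + k\<^sup>2)) + k * (ca * y$2 - sa * y$1)"

definition model_domain :: "real \<Rightarrow> real \<Rightarrow> real \<Rightarrow> real \<Rightarrow> real \<Rightarrow> (real^2) set"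
  where "model_domain u0 \<beta> ca sa k = {y. (ca * y$1 + sa * y$2 - \<beta>) / sqrt (1 + k\<^sup>2) \<in> I u0}"

text \<open>The set \<open>Z\<close> of points in contact with the model found at one point is open
  because contact propagates in a disc, and closed because contact controls the gradient up to the
  limit. In particular no tangent plane is vertical.\<close>

lemma everywhere_contact:
  assumes c: "chart D f w" and y: "y \<in> D"
  obtains u0 \<beta> ca sa k where "ca\<^sup>2 + sa\<^sup>2 = 1" "k \<ge> 0"
    "\<And>q. q \<in> M \<Longrightarrow> \<exists>D f w y. chart D f w \<and> y \<in> D \<and> f y = q \<and> contact u0 \<beta> ca sa k y (w y) (pd 1 w y) (pd 2 w y)"
proof -
  obtain ca sa k where cs: "ca\<^sup>2 + sa\<^sup>2 = 1"
    and n0: "ca * pd 1 (pd 2 w) y = sa * pd 1 (pd 1 w) y" "ca * pd 2 (pd 2 w) y = sa * pd 1 (pd 2 w) y"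
    and k: "k = ca * pd 2 w y - sa * pd 1 w y" "k \<ge> 0" "k = 0 \<or> (\<forall>s t. deriv \<phi> s = deriv \<phi> t)"
    by (rule ruling_frame[OF c y])
  obtain u0 \<beta> where con0: "contact u0 \<beta> ca sa k y (w y) (pd 1 w y) (pd 2 w y)"
    using contact_exists[OF k(1)[symmetric]] by blast
  \<comment> \<open>The null direction is carried along with the contact, since propagation of
    contact presupposes it.\<close>
  define St where "St D f w y \<longleftrightarrow> chart D f w \<and> y \<in> D \<and> contact u0 \<beta> ca sa k y (w y) (pd 1 w y) (pd 2 w y) \<and>
     ca * pd 1 (pd 2 w) y = sa * pd 1 (pd 1 w) y \<and> ca * pd 2 (pd 2 w) y = sa * pd 1 (pd 2 w) y" for D f w y
  define Z where "Z = {q. \<exists>D f w y. St D f w y \<and> f y = q}"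
  have ZM: "Z \<subseteq> M" unfolding Z_def St_def using chart_X(4) by blast
  have "openin (top_of_set M) Z" unfolding openin_subopen[of _ Z]
  proof
    fix q assume "q \<in> Z"
    then obtain D f w y where st: "St D f w y" "f y = q" unfolding Z_def by blast
    then have c: "chart D f w" "y \<in> D" and con: "contact u0 \<beta> ca sa k y (w y) (pd 1 w y) (pd 2 w y)"
      and n: "ca * pd 1 (pd 2 w) y = sa * pd 1 (pd 1 w) y" "ca * pd 2 (pd 2 w) y = sa * pd 1 (pd 2 w) y"
      unfolding St_def by blast+
    obtain r where r: "r > 0" "chart (ball y r) f w"
      "\<And>z. z \<in> ball y r \<Longrightarrow> ca * pd 1 (pd 2 w) z = sa * pd 1 (pd 1 w) z \<and> ca * pd 2 (pd 2 w) z = sa * pd 1 (pd 2 w) z"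
      by (rule null_propagates[OF c n]) (rule that, simp_all)
    have y': "y \<in> ball y r" using r(1) by simp
    have "contact u0 \<beta> ca sa k z (w z) (pd 1 w z) (pd 2 w z)" if z: "z \<in> ball y r" for z
      by (rule soliton_graph.contact_propagates[OF chart_soliton[OF r(2)] surj convex_ball refl refl cs _ _ k(3) y' con z])
        (use r(3) in auto)
    then have "f ` ball y r \<subseteq> Z" unfolding Z_def St_def using r by blast
    moreover have "openin (top_of_set M) (f ` ball y r)" using graph_chartD(7)[OF r(2), of "ball y r"] by simp
    moreover have "q \<in> f ` ball y r" using st(2) y' by auto
    ultimately show "\<exists>T. openin (top_of_set M) T \<and> q \<in> T \<and> T \<subseteq> Z" by blast
  qed
  moreover have "closedin (top_of_set M) Z"
  proof -
    have "M \<inter> closure Z \<subseteq> Z"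
    proof
      fix q assume q: "q \<in> M \<inter> closure Z"
      then have "q \<in> closure Z" by simp
      then have "\<exists>\<sigma>. (\<forall>n::nat. \<sigma> n \<in> Z) \<and> \<sigma> \<longlonglongrightarrow> q" unfolding closure_sequential .
      then obtain \<sigma> where \<sigma>: "\<And>n::nat. \<sigma> n \<in> Z" "\<sigma> \<longlonglongrightarrow> q" by blast
      define ys where "ys n = pr (X (\<sigma> n))" for n
      have "\<forall>n. \<exists>g. \<exists>D f w. St D f w (ys n) \<and> f (ys n) = \<sigma> n \<and> pd 1 w (ys n) = fst g \<and> pd 2 w (ys n) = snd g"
      proof
        fix n
        obtain D f w y where st: "St D f w y" "f y = \<sigma> n" using \<sigma>(1)[of n] unfolding Z_def by blast
        have "ys n = y" unfolding ys_def st(2)[symmetric] using st(1) chart_X(2) unfolding St_def by blast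
        then show "\<exists>g. \<exists>D f w. St D f w (ys n) \<and> f (ys n) = \<sigma> n \<and> pd 1 w (ys n) = fst g \<and> pd 2 w (ys n) = snd g"
          using st by (intro exI[of _ "(pd 1 w y, pd 2 w y)"]) auto
      qed
      then obtain g where g: "\<And>n. \<exists>D f w. St D f w (ys n) \<and> f (ys n) = \<sigma> n \<and> pd 1 w (ys n) = fst (g n) \<and> pd 2 w (ys n) = snd (g n)"
        by metis
      have \<sigma>M: "\<sigma> n \<in> M" for n using ZM \<sigma>(1)[of n] by blast
      have Xl: "(\<lambda>n. X (\<sigma> n)) \<longlonglongrightarrow> X q"
        by (rule continuous_on_tendsto_compose[OF continuous_on_immersion[OF imm] \<sigma>(2)]) (use q \<sigma>M in auto)
      have yl: "ys \<longlonglongrightarrow> pr (X q)" unfolding ys_def by (rule bounded_linear.tendsto[OF bounded_linear_coords Xl])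
      have zl: "(\<lambda>n. X (\<sigma> n) $ 3) \<longlonglongrightarrow> X q $ 3" by (rule tendsto_vec_nth[OF Xl])
      have con: "contact u0 \<beta> ca sa k (ys n) (X (\<sigma> n) $ 3) (fst (g n)) (snd (g n))" for n
      proof -
        obtain D f w where st: "St D f w (ys n)" "f (ys n) = \<sigma> n" "pd 1 w (ys n) = fst (g n)" "pd 2 w (ys n) = snd (g n)"
          using g[of n] by blast
        then have "X (\<sigma> n) $ 3 = w (ys n)" using chart_X(3)[of D f w "ys n"] unfolding St_def by simp
        then show ?thesis using st unfolding St_def by simp
      qed
      \<comment> \<open>The order matters here: the model first yields finite limits of the
        gradients from positions alone, and these give a graph chart at the limit point
        \<open>q\<close>, of which no tangent information was assumed.\<close>
      obtain g1' g2' where g': "(\<lambda>n. fst (g n)) \<longlonglongrightarrow> g1'" "(\<lambda>n. snd (g n)) \<longlonglongrightarrow> g2'"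
        and conq: "contact u0 \<beta> ca sa k (pr (X q)) (X q $ 3) g1' g2'"
        by (rule contact_limit[OF cs con yl zl])
      have jets: "\<exists>D f w. chart D f w \<and> ys n \<in> D \<and> f (ys n) = \<sigma> n \<and> pd 1 w (ys n) = fst (g n) \<and> pd 2 w (ys n) = snd (g n)" for n
        using g[of n] unfolding St_def by blast
      have qM: "q \<in> M" using q by simp
      obtain D f w y' where c: "chart D f w" "y' \<in> D" "f y' = q" and lim: "ys \<longlonglongrightarrow> y'"
        and gy: "pd 1 w y' = g1'" "pd 2 w y' = g2'" and ev: "eventually (\<lambda>n. ys n \<in> D \<and> f (ys n) = \<sigma> n) sequentially"
        by (rule graph_chart_limit[OF frame_standard imm qM \<sigma>(2) jets g'])
      define F where "F z = ca * pd 1 (pd 2 w) z - sa * pd 1 (pd 1 w) z" for z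
      define G where "G z = ca * pd 2 (pd 2 w) z - sa * pd 1 (pd 2 w) z" for z
      have FG: "F (ys n) = 0 \<and> G (ys n) = 0" if n: "ys n \<in> D" "f (ys n) = \<sigma> n" for n
      proof -
        obtain D' f' w' where st: "St D' f' w' (ys n)" "f' (ys n) = \<sigma> n" using g[of n] by blast
        then have c': "chart D' f' w'" "ys n \<in> D'" unfolding St_def by blast+
        note agree = graph_charts_agree(3)[OF frame_standard c(1) c'(1) n(1) c'(2)]
        show ?thesis using st n(2) agree unfolding F_def G_def St_def by simp
      qed
      note sm = smooth_on_imp_continuous_on[OF smooth_on_pd[OF smooth_on_pd[OF graph_chartD(2)[OF c(1)]]]]
      have "continuous_on D F" "continuous_on D G"
        unfolding F_def[abs_def] G_def[abs_def] by (intro continuous_intros sm)+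
      moreover have "eventually (\<lambda>n. ys n \<in> D \<and> F (ys n) = 0) sequentially"
        "eventually (\<lambda>n. ys n \<in> D \<and> G (ys n) = 0) sequentially"
        using ev by (rule eventually_mono, use FG in blast)+
      ultimately have "F y' = 0" "G y' = 0"
        using continuous_zero_of_eventually[OF _ lim c(2)] by blast+
      moreover have "pr (X q) = y'" "X q $ 3 = w y'" using chart_X(2,3)[OF c(1,2)] c(3) by auto
      ultimately have "St D f w y'" using c conq gy unfolding St_def F_def G_def by simp
      then show "q \<in> Z" unfolding Z_def using c(3) by blast
    qed
    then have "Z = M \<inter> closure Z" using ZM closure_subset[of Z] by blast
    then show ?thesis by (metis closed_closure closedin_closed)
  qed
  moreover have "f y \<in> Z" unfolding Z_def St_def using c y con0 n0 by blast
  ultimately have Z: "Z = M" using con unfolding connected_clopen by blast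
  show ?thesis
  proof (rule that[OF cs k(2)])
    fix q assume "q \<in> M"
    then obtain D f w y where "St D f w y" "f y = q" unfolding Z[symmetric] Z_def by blast
    then show "\<exists>D f w y. chart D f w \<and> y \<in> D \<and> f y = q \<and> contact u0 \<beta> ca sa k y (w y) (pd 1 w y) (pd 2 w y)"
      unfolding St_def by blast
  qed
qed

text \<open>The domain is the preimage of an interval under a linear form, hence convex but possibly
  not the whole plane; the explicit model supplies the map \<open>G\<close> that the developing
  argument compares with.\<close>

lemma model_graph:
  assumes cnt: "\<And>q. q \<in> M \<Longrightarrow> \<exists>D f w y. chart D f w \<and> y \<in> D \<and> f y = q \<and> contact u0 \<beta> ca sa k y (w y) (pd 1 w y) (pd 2 w y)"
  shows "inj_on X M" "X ` M = (\<lambda>y. lift3 y (model_height u0 \<beta> ca sa k y)) ` model_domain u0 \<beta> ca sa k"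
proof -
  define c where "c = sqrt (1 + k\<^sup>2)"
  have c: "c > 0" unfolding c_def by (simp add: add_pos_nonneg)
  define x where "x y = (ca * y$1 + sa * y$2 - \<beta>) / c" for y :: "real^2"
  define \<Omega> where "\<Omega> = model_domain u0 \<beta> ca sa k"
  define G where "G y = lift3 y (model_height u0 \<beta> ca sa k y)" for y
  have \<Omega>: "y \<in> \<Omega> \<longleftrightarrow> x y \<in> I u0" for y unfolding \<Omega>_def model_domain_def x_def c_def by simp
  have Ge: "G y = y$1 *\<^sub>R axis 1 1 + y$2 *\<^sub>R axis 2 1 + (c\<^sup>2 * u u0 (x y) + k * (ca * y$2 - sa * y$1)) *\<^sub>R axis 3 1" for y
    unfolding G_def lift3_def model_height_def c_def x_def ..
  define G' where "G' y v = v$1 *\<^sub>R axis 1 1 + v$2 *\<^sub>R axis 2 1 +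
     (c\<^sup>2 * (tan (ang u0 (x y)) * ((ca * v$1 + sa * v$2) / c)) + k * (ca * v$2 - sa * v$1)) *\<^sub>R (axis 3 1 :: real^3)" for y v :: "real^2"
  have dn: "((\<lambda>y. y $ m) has_derivative (\<lambda>h. h $ m)) (at (y::real^2))" for m y
    by (intro bounded_linear_imp_has_derivative bounded_linear_vec_nth)
  have 0: "\<exists>D f w y. chart D f w \<and> y \<in> D \<and> f y = q" if "q \<in> M" for q using cnt[OF that] by blast
  have 1: "convex \<Omega>"
  proof -
    have lin: "linear (\<lambda>y::real^2. (ca * y$1 + sa * y$2) / c)"
      by (rule linearI) (simp_all add: algebra_simps add_divide_distrib)
    have eq: "\<Omega> = (\<lambda>y::real^2. (ca * y$1 + sa * y$2) / c) -` ((\<lambda>t. \<beta> / c + t) ` I u0)"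
    proof -
      have "x y \<in> I u0 \<longleftrightarrow> (ca * y$1 + sa * y$2) / c \<in> (\<lambda>t. \<beta> / c + t) ` I u0" for y
        unfolding x_def diff_divide_distrib by (auto intro!: image_eqI[of _ _ "(ca * y $ 1 + sa * y $ 2) / c - \<beta> / c"])
      then show ?thesis using \<Omega> by blast
    qed
    have cv: "convex ((\<lambda>t. \<beta> / c + t) ` I u0)"
      using interval_I[of u0] by (intro convex_translation) (simp add: is_interval_convex_1)
    show ?thesis unfolding eq by (rule convex_linear_vimage[OF lin cv])
  qed
  have 2: "pr (X q) \<in> \<Omega> \<and> X q = G (pr (X q))" if q: "q \<in> M" for q
  proof -
    obtain D f w y where ch: "chart D f w" "y \<in> D" "f y = q" and co: "contact u0 \<beta> ca sa k y (w y) (pd 1 w y) (pd 2 w y)"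
      using cnt[OF q] by blast
    note cD = contactD[OF co]
    have "X q = lift3 y (w y)" "pr (X q) = y" using chart_X(1,2)[OF ch(1,2)] ch(3) by auto
    moreover have "y \<in> \<Omega>" using cD(1) unfolding \<Omega>_def model_domain_def by simp
    moreover have "w y = model_height u0 \<beta> ca sa k y" using cD(2) unfolding model_height_def .
    ultimately show ?thesis unfolding G_def by simp
  qed
  have 3: "(G has_derivative G' y) (at y)" if y: "y \<in> \<Omega>" for y
  proof -
    have dx: "(x has_derivative (\<lambda>h. (ca * h$1 + sa * h$2) / c)) (at y)"
    proof -
      have "((\<lambda>y. inverse c * (ca * y$1 + sa * y$2 - \<beta>)) has_derivative (\<lambda>h. inverse c * (ca * h$1 + sa * h$2))) (at y)"
        by (auto intro!: derivative_eq_intros dn)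
      then show ?thesis unfolding x_def[abs_def] by (simp add: divide_inverse mult.commute)
    qed
    have "x y \<in> I u0" using y \<Omega> by simp
    from has_derivative_compose[OF dx du[OF this, unfolded has_field_derivative_def]]
    have du': "((\<lambda>y. u u0 (x y)) has_derivative (\<lambda>h. tan (ang u0 (x y)) * ((ca * h$1 + sa * h$2) / c))) (at y)" .
    show ?thesis unfolding Ge[abs_def] G'_def
      by (auto intro!: derivative_eq_intros dn du')
  qed
  have 4: "continuous_on \<Omega> (\<lambda>y. G' y v)" for v
  proof -
    have "continuous_on (I u0) (\<lambda>t. tan (ang u0 t))"
    proof (intro continuous_at_imp_continuous_on ballI)
      fix t assume t: "t \<in> I u0"
      have "cos (ang u0 t) \<noteq> 0" using cos_angles[OF ang(1)[OF t]] by simp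
      then show "isCont (\<lambda>t. tan (ang u0 t)) t" using DERIV_isCont[OF d_ang[OF t]] by (intro isCont_tan') auto
    qed
    moreover have "continuous_on \<Omega> x" unfolding x_def[abs_def] using c by (intro continuous_intros) auto
    ultimately have "continuous_on \<Omega> (\<lambda>y. tan (ang u0 (x y)))"
      by (rule continuous_on_compose2) (use \<Omega> in auto)
    then show ?thesis unfolding G'_def by (intro continuous_intros)
  qed
  show "inj_on X M" by (rule graph_over_domain(1)[OF imm con compl ne frame_standard 1 0 2 3 4])
  have "X ` M = G ` \<Omega>" by (rule graph_over_domain(2)[OF imm con compl ne frame_standard 1 0 2 3 4])
  then show "X ` M = (\<lambda>y. lift3 y (model_height u0 \<beta> ca sa k y)) ` model_domain u0 \<beta> ca sa k" unfolding G_def[abs_def] \<Omega>_def .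
qed

lemma model_congruent:
  assumes cs: "ca\<^sup>2 + sa\<^sup>2 = 1"
  shows "horizontally_congruent ((\<lambda>y. lift3 y (model_height u0 \<beta> ca sa k y)) ` model_domain u0 \<beta> ca sa k)
    {vector [x * sqrt (1 + k\<^sup>2), y - u u0 x * k, u u0 x + y * k] | x y. x \<in> I u0}"
proof -
  define c where "c = sqrt (1 + k\<^sup>2)"
  have c: "c > 0" "c\<^sup>2 = 1 + k\<^sup>2" unfolding c_def by (simp_all add: add_pos_nonneg)
  obtain \<alpha> where \<alpha>: "ca = cos \<alpha>" "sa = sin \<alpha>" using sincos_total_2pi[OF cs] by blast
  define b where "b = (vector [\<beta> * ca, \<beta> * sa, 0] :: real^3)"
  let ?C = "{vector [x * c, y - u u0 x * k, u u0 x + y * k] :: real^3 | x y. x \<in> I u0}"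
  \<comment> \<open>Rotation by \<alpha> of the planar point (c x + \<beta>, t - k u). The relation
    between (x, t) and y serves both inclusions.\<close>
  have key: "b + rotate_z \<alpha> (vector [x * c, t - u u0 x * k, u u0 x + t * k]) = lift3 y (model_height u0 \<beta> ca sa k y) \<and> y \<in> model_domain u0 \<beta> ca sa k"
    if x: "x \<in> I u0" and y: "y$1 = ca * (c * x + \<beta>) - sa * (t - k * u u0 x)" "y$2 = sa * (c * x + \<beta>) + ca * (t - k * u u0 x)"
    for x t and y :: "real^2"
  proof -
    have l: "ca * y$1 + sa * y$2 = c * x + \<beta>"
    proof -
      have "ca * y$1 + sa * y$2 = (ca\<^sup>2 + sa\<^sup>2) * (c * x + \<beta>)" unfolding y by (simp add: power2_eq_square algebra_simps)
      then show ?thesis using cs by simp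
    qed
    have T: "ca * y$2 - sa * y$1 = t - k * u u0 x"
    proof -
      have "ca * y$2 - sa * y$1 = (ca\<^sup>2 + sa\<^sup>2) * (t - k * u u0 x)" unfolding y by (simp add: power2_eq_square algebra_simps)
      then show ?thesis using cs by simp
    qed
    have xx: "(ca * y$1 + sa * y$2 - \<beta>) / c = x" unfolding l using c by simp
    have h: "model_height u0 \<beta> ca sa k y = u u0 x + t * k"
      unfolding model_height_def c_def[symmetric] xx T c(2) by (simp add: power2_eq_square algebra_simps)
    have "y \<in> model_domain u0 \<beta> ca sa k" unfolding model_domain_def c_def[symmetric] using xx x by simp
    moreover have "b + rotate_z \<alpha> (vector [x * c, t - u u0 x * k, u u0 x + t * k]) = lift3 y (model_height u0 \<beta> ca sa k y)"
      unfolding h by (simp add: vec_eq_iff forall_3 b_def rotate_z_def \<alpha>[symmetric] y algebra_simps)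
    ultimately show ?thesis by simp
  qed
  have "(\<lambda>y. lift3 y (model_height u0 \<beta> ca sa k y)) ` model_domain u0 \<beta> ca sa k = (\<lambda>p. b + rotate_z \<alpha> p) ` ?C"
  proof (intro equalityI subsetI)
    fix p assume "p \<in> (\<lambda>y. lift3 y (model_height u0 \<beta> ca sa k y)) ` model_domain u0 \<beta> ca sa k"
    then obtain y where y: "y \<in> model_domain u0 \<beta> ca sa k" "p = lift3 y (model_height u0 \<beta> ca sa k y)" by blast
    define x where "x = (ca * y$1 + sa * y$2 - \<beta>) / c"
    define t where "t = (ca * y$2 - sa * y$1) + k * u u0 x"
    have x: "x \<in> I u0" using y(1) unfolding model_domain_def x_def c_def by simp
    have cx: "c * x + \<beta> = ca * y$1 + sa * y$2" unfolding x_def using c by simp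
    have tt: "t - k * u u0 x = ca * y$2 - sa * y$1" unfolding t_def by simp
    have "ca * (c * x + \<beta>) - sa * (t - k * u u0 x) = (ca\<^sup>2 + sa\<^sup>2) * y$1" "sa * (c * x + \<beta>) + ca * (t - k * u u0 x) = (ca\<^sup>2 + sa\<^sup>2) * y$2"
      unfolding cx tt by (simp_all add: power2_eq_square algebra_simps)
    then have "y$1 = ca * (c * x + \<beta>) - sa * (t - k * u u0 x)" "y$2 = sa * (c * x + \<beta>) + ca * (t - k * u u0 x)"
      using cs by simp_all
    from key[OF x this] have "p = b + rotate_z \<alpha> (vector [x * c, t - u u0 x * k, u u0 x + t * k])" using y(2) by simp
    then show "p \<in> (\<lambda>p. b + rotate_z \<alpha> p) ` ?C" using x by blast
  next
    fix p assume "p \<in> (\<lambda>p. b + rotate_z \<alpha> p) ` ?C"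
    then obtain x t where x: "x \<in> I u0" "p = b + rotate_z \<alpha> (vector [x * c, t - u u0 x * k, u u0 x + t * k])" by blast
    define y where "y = (vector [ca * (c * x + \<beta>) - sa * (t - k * u u0 x), sa * (c * x + \<beta>) + ca * (t - k * u u0 x)] :: real^2)"
    have "y$1 = ca * (c * x + \<beta>) - sa * (t - k * u u0 x)" "y$2 = sa * (c * x + \<beta>) + ca * (t - k * u u0 x)"
      unfolding y_def by simp_all
    from key[OF x(1) this] show "p \<in> (\<lambda>y. lift3 y (model_height u0 \<beta> ca sa k y)) ` model_domain u0 \<beta> ca sa k"
      using x(2) by blast
  qed
  moreover have "b \<bullet> e3 = 0" unfolding b_def e3_def by (simp add: inner_axis)
  ultimately show ?thesis unfolding horizontally_congruent_def c_def by blast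
qed

section \<open>The two cases of the classification\<close>

proposition classification_if_somewhere_nonvertical:
  assumes c: "chart D f w" and y: "y \<in> D"
  shows "inj_on X M \<and> (catenary_cylinder \<phi> (X ` M) \<or> tilted_catenary_cylinder \<phi> (X ` M))"
proof -
  obtain u0 \<beta> ca sa k where cs: "ca\<^sup>2 + sa\<^sup>2 = 1" and k: "k \<ge> 0"
    and cnt: "\<And>q. q \<in> M \<Longrightarrow> \<exists>D f w y. chart D f w \<and> y \<in> D \<and> f y = q \<and> contact u0 \<beta> ca sa k y (w y) (pd 1 w y) (pd 2 w y)"
    using everywhere_contact[OF c y] by metis
  have mg: "inj_on X M" "X ` M = (\<lambda>y. lift3 y (model_height u0 \<beta> ca sa k y)) ` model_domain u0 \<beta> ca sa k"
    by (rule model_graph[OF cnt]; assumption)+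
  have hc: "horizontally_congruent (X ` M) {vector [x * sqrt (1 + k\<^sup>2), y - u u0 x * k, u u0 x + y * k] | x y. x \<in> I u0}"
    unfolding mg(2) by (rule model_congruent[OF cs])
  show ?thesis
  proof (cases "k = 0")
    case True
    then have "catenary_cylinder \<phi> (X ` M)"
      using hc maximal_solution[of u0] unfolding catenary_cylinder_def by auto
    then show ?thesis using mg(1) by blast
  next
    case False
    \<comment> \<open>The angle whose tangent is the slope of the rulings; then 1 / cos \<theta> =
      sqrt(1 + k^2) is the dilation factor.\<close>
    define \<theta> where "\<theta> = arctan k"
    have \<theta>: "0 < \<theta>" "\<theta> < pi / 2" using False k arctan_ubound[of k] unfolding \<theta>_def by simp_all
    have t: "tan \<theta> = k" unfolding \<theta>_def by (rule tan_arctan)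
    have co: "x / cos \<theta> = x * sqrt (1 + k\<^sup>2)" for x unfolding \<theta>_def cos_arctan by simp
    have "tilted_catenary_cylinder \<phi> (X ` M)"
      unfolding tilted_catenary_cylinder_def
      by (rule exI[of _ u0], rule exI[of _ "I u0"], rule exI[of _ "u u0"], rule exI[of _ \<theta>])
        (use hc maximal_solution[of u0] \<theta> in \<open>simp add: t co\<close>)
    then show ?thesis using mg(1) by blast
  qed
qed

text \<open>The surface is compared with its own tangent plane at one point: contact with this plane
  is open since the gradient is locally constant, and closed by the limit lemma. All of it takes
  place in a frame containing e3, over a vertical plane.\<close>

proposition classification_if_everywhere_vertical:
  assumes no: "\<And>D f w. chart D f w \<Longrightarrow> D = {}"
  shows "inj_on X M \<and> vertical_plane (X ` M)"
proof -
  have horiz: "cross3 (partial 1 (X \<circ> F) x) (partial 2 (X \<circ> F) x) \<bullet> e3 = 0" if F: "regular_param M X V F" "x \<in> V" for V F x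
  proof (rule ccontr)
    assume "cross3 (partial 1 (X \<circ> F) x) (partial 2 (X \<circ> F) x) \<bullet> e3 \<noteq> 0"
    then obtain y r f w where r: "r > 0" "chart (ball y r) f w"
      using graph_chart_exists[OF frame_standard F, of thesis] unfolding e3_def by blast
    then show False using no[OF r(2)] by simp
  qed
  obtain q0 where q0: "q0 \<in> M" using ne by blast
  obtain V F x0 where F: "regular_param M X V F" "x0 \<in> V" "F x0 = q0"
    using imm q0 unfolding immersed_surface_def by (metis imageE)
  define \<nu> where "\<nu> = cross3 (partial 1 (X \<circ> F) x0) (partial 2 (X \<circ> F) x0)"
  have \<nu>: "\<nu> \<noteq> 0" "\<nu> \<bullet> e3 = 0" unfolding \<nu>_def using chart_normal_nonzero[OF F(1,2)] horiz[OF F(1,2)] by auto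
  define t3 where "t3 = sgn \<nu>"
  define t1 where "t1 = cross3 e3 t3"
  have t3: "t3 \<bullet> t3 = 1" "t3 \<bullet> e3 = 0" 
  proof -
    show "t3 \<bullet> t3 = 1" unfolding t3_def using \<nu>(1) by (metis norm_eq_1 norm_sgn)
    show "t3 \<bullet> e3 = 0" unfolding t3_def sgn_div_norm using \<nu>(2) by simp
  qed
  have e3: "e3 \<bullet> e3 = 1" unfolding e3_def by (simp add: inner_axis_axis)
  have fr: "frame t1 e3 t3"
  proof -
    have "frame e3 (cross3 t3 e3) t3" by (rule frame_of_normal) (use t3 e3 in \<open>auto simp: inner_commute\<close>)
    then show ?thesis
      unfolding frame_def t1_def using frame_inner(2)[OF \<open>frame e3 (cross3 t3 e3) t3\<close>] e3 t3
        Lagrange[of e3 e3 t3] cross_skew[of t3 e3] cross_skew[of "cross3 e3 t3" e3]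
      by (auto simp: dot_cross_self inner_commute)
  qed
  note fri = frame_inner[OF fr]
  \<comment> \<open>The vertical component of the normal is -\<open>pd 2 w\<close>, so it vanishes
    identically. The right side of the minimality equation then vanishes too, and only the second
    derivative in the horizontal direction t1 is left on the other side.\<close>
  have vert: "pd 2 w y = 0" "pd 1 (pd 1 w) y = 0" "pd 2 (pd 1 w) y = 0"
    if gc: "graph_chart t1 e3 t3 M X D f w" and y: "y \<in> D" for D f w y
  proof -
    note gD = graph_chartD[OF gc]
    have q0: "pd 2 w y = 0" if y: "y \<in> D" for y
    proof -
      have "cross3 (t1 + pd 1 w y *\<^sub>R t3) (e3 + pd 2 w y *\<^sub>R t3) \<bullet> e3 = 0"
        using horiz[OF gD(5) y] unfolding graph_chart_partial(1,2)[OF gc y] .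
      then show ?thesis
        by (simp add: cross_add_left cross_add_right cross_mult_left cross_mult_right frame_cross[OF fr] inner_add_left inner_diff_left fri)
    qed
    show "pd 2 w y = 0" by (rule q0[OF y])
    have z: "pd i (pd 2 w) y = 0" for i by (rule pd_const_on[OF gD(1) y q0])
    have "e3 \<bullet> (t3 - pd 1 w y *\<^sub>R t1 - pd 2 w y *\<^sub>R e3) = 0"
      using q0[OF y] by (simp add: inner_diff_right fri)
    then show "pd 1 (pd 1 w) y = 0"
      using graph_chart_pde(2)[OF fr gc y flat mini] z q0[OF y] by simp
    show "pd 2 (pd 1 w) y = 0" using pd_commute[OF gD(1,2) y, of 2 1] z by simp
  qed
  have "\<nu> \<bullet> t3 \<noteq> 0" unfolding t3_def using \<nu>(1) by (simp add: sgn_div_norm)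
  then obtain y0 r0 f0 w0 where c0: "r0 > 0" "graph_chart t1 e3 t3 M X (ball y0 r0) f0 w0" "f0 y0 = q0"
    using graph_chart_exists[OF fr F(1,2), of thesis] F(3) unfolding \<nu>_def by auto
  define p0 where "p0 = pd 1 w0 y0"
  \<comment> \<open>A normal of the tangent plane at q0, horizontal because t1 and t3 are; the plane
    itself is the level set of value \<open>c\<close>.\<close>
  define n0 where "n0 = t3 - p0 *\<^sub>R t1"
  define c where "c = n0 \<bullet> X q0"
  define St where "St D f w y \<longleftrightarrow> graph_chart t1 e3 t3 M X D f w \<and> y \<in> D \<and> n0 \<bullet> X (f y) = c \<and> pd 1 w y = p0" for D f w y
  define Z where "Z = {q. \<exists>D f w y. St D f w y \<and> f y = q}"
  have ZM: "Z \<subseteq> M" unfolding Z_def St_def using graph_chartD(4) by blast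
  have ZD: "n0 \<bullet> X q = c" "\<exists>D f w y. graph_chart t1 e3 t3 M X D f w \<and> y \<in> D \<and> f y = q" if q: "q \<in> Z" for q
  proof -
    obtain D f w y where "St D f w y" "f y = q" using q unfolding Z_def by blast
    then show "n0 \<bullet> X q = c" "\<exists>D f w y. graph_chart t1 e3 t3 M X D f w \<and> y \<in> D \<and> f y = q"
      unfolding St_def by blast+
  qed
  have "openin (top_of_set M) Z" unfolding openin_subopen[of _ Z]
  proof
    fix q assume "q \<in> Z"
    then obtain D f w y where gc: "graph_chart t1 e3 t3 M X D f w" "y \<in> D" and st: "n0 \<bullet> X (f y) = c" "pd 1 w y = p0" "f y = q"
      unfolding Z_def St_def by blast
    obtain r where r: "r > 0" "ball y r \<subseteq> D" using graph_chartD(1)[OF gc(1)] gc(2) openE by blast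
    define B where "B = ball y r"
    have gB: "graph_chart t1 e3 t3 M X B f w" unfolding B_def by (rule graph_chart_subset[OF gc(1) open_ball r(2)])
    have B: "open B" "convex B" "y \<in> B" unfolding B_def using r(1) by auto
    have p: "pd 1 w z = p0" if z: "z \<in> B" for z
      using pd_zero_imp_const[OF B(2,1) smooth_on_pd[OF graph_chartD(2)[OF gB]], of 1 2 1 z y] vert(2,3)[OF gB] z B(3) st(2) by simp
    have nX: "n0 \<bullet> X (f z) = w z - p0 * z$1" if "z \<in> B" for z
      unfolding n0_def graph_chartD(6)[OF gB that] by (simp add: inner_diff_left inner_add_right fri)
    have "n0 \<bullet> X (f z) = c" if z: "z \<in> B" for z
    proof -
      have "((\<lambda>z. w z - p0 * z$1) has_derivative (\<lambda>h. 0)) (at x)" if x: "x \<in> B" for x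
      proof -
        have "((\<lambda>z::real^2. z$1) has_derivative (\<lambda>h. h$1)) (at x)"
          by (intro bounded_linear_imp_has_derivative bounded_linear_vec_nth)
        from has_derivative_diff[OF pd_has_derivative[OF graph_chartD(2)[OF gB] x] has_derivative_mult_right[OF this, of p0]]
        show ?thesis using p[OF x] vert(1)[OF gB x] by (simp add: mult.commute)
      qed
      from has_derivative_zero_constant[OF B(2) has_derivative_at_withinI[OF this]]
      obtain d where "\<And>x. x \<in> B \<Longrightarrow> w x - p0 * x$1 = d" by blast
      then show ?thesis using nX[OF z] nX[OF B(3)] z B(3) st(1) by simp
    qed
    then have "f ` B \<subseteq> Z" unfolding Z_def St_def using gB p by blast
    moreover have "openin (top_of_set M) (f ` B)" by (rule graph_chartD(7)[OF gB B(1) order_refl])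
    ultimately show "\<exists>T. openin (top_of_set M) T \<and> q \<in> T \<and> T \<subseteq> Z" using st(3) B(3) by blast
  qed
  moreover have "closedin (top_of_set M) Z"
  proof -
    have "M \<inter> closure Z \<subseteq> Z"
    proof
      fix q assume q: "q \<in> M \<inter> closure Z"
      then have qM: "q \<in> M" by simp
      have "q \<in> closure Z" using q by simp
      then have "\<exists>\<sigma>. (\<forall>n::nat. \<sigma> n \<in> Z) \<and> \<sigma> \<longlonglongrightarrow> q" unfolding closure_sequential .
      then obtain \<sigma> where \<sigma>: "\<And>n::nat. \<sigma> n \<in> Z" "\<sigma> \<longlonglongrightarrow> q" by blast
      have jets: "\<exists>D f w. graph_chart t1 e3 t3 M X D f w \<and> coords t1 e3 (X (\<sigma> n)) \<in> D \<and> f (coords t1 e3 (X (\<sigma> n))) = \<sigma> n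
         \<and> pd 1 w (coords t1 e3 (X (\<sigma> n))) = p0 \<and> pd 2 w (coords t1 e3 (X (\<sigma> n))) = 0" for n
      proof -
        obtain D f w y where st: "graph_chart t1 e3 t3 M X D f w" "y \<in> D" "pd 1 w y = p0" "f y = \<sigma> n"
          using \<sigma>(1)[of n] unfolding Z_def St_def by blast
        moreover have "coords t1 e3 (X (\<sigma> n)) = y" using graph_chart_coords(1)[OF fr st(1,2)] st(4) by simp
        ultimately show ?thesis using vert(1)[OF st(1,2)] by auto
      qed
      obtain D f w y' where gc: "graph_chart t1 e3 t3 M X D f w" "y' \<in> D" "f y' = q" "pd 1 w y' = p0"
        by (rule graph_chart_limit[OF fr imm qM \<sigma>(2) jets tendsto_const tendsto_const])
      have \<sigma>M: "\<sigma> n \<in> M" for n using ZM \<sigma>(1)[of n] by blast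
      have "(\<lambda>n. X (\<sigma> n)) \<longlonglongrightarrow> X q"
        by (rule continuous_on_tendsto_compose[OF continuous_on_immersion[OF imm] \<sigma>(2) qM]) (use \<sigma>M in auto)
      then have "(\<lambda>n. n0 \<bullet> X (\<sigma> n)) \<longlonglongrightarrow> n0 \<bullet> X q" by (intro tendsto_intros)
      moreover have "n0 \<bullet> X (\<sigma> n) = c" for n by (rule ZD(1)[OF \<sigma>(1)])
      ultimately have "n0 \<bullet> X q = c" using LIMSEQ_unique[OF _ tendsto_const] by simp
      then show "q \<in> Z" unfolding Z_def St_def using gc by blast
    qed
    then have "Z = M \<inter> closure Z" using ZM closure_subset[of Z] by blast
    then show ?thesis by (metis closed_closure closedin_closed)
  qed
  moreover have "q0 \<in> Z"
  proof -
    have "y0 \<in> ball y0 r0" using c0(1) by simp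
    then have "St (ball y0 r0) f0 w0 y0" unfolding St_def p0_def c_def using c0(2,3) by simp
    then show ?thesis unfolding Z_def using c0(3) by blast
  qed
  ultimately have Z: "Z = M" using con unfolding connected_clopen by blast
  define G where "G y = y$1 *\<^sub>R t1 + y$2 *\<^sub>R e3 + (p0 * y$1 + c) *\<^sub>R t3" for y :: "real^2"
  define G' where "G' y v = v$1 *\<^sub>R t1 + v$2 *\<^sub>R e3 + (p0 * v$1) *\<^sub>R t3" for y v :: "real^2"
  have ch: "\<exists>D f w y. graph_chart t1 e3 t3 M X D f w \<and> y \<in> D \<and> f y = q" if "q \<in> M" for q
    using ZD(2) that unfolding Z by blast
  have nX: "n0 \<bullet> X q = c" if "q \<in> M" for q
    using ZD(1) that unfolding Z by blast
  have plane: "p = G (coords t1 e3 p)" if "n0 \<bullet> p = c" for p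
  proof -
    have "p \<bullet> t3 = p0 * (p \<bullet> t1) + c" using that unfolding n0_def by (simp add: inner_diff_right inner_commute[of _ p])
    then show ?thesis unfolding G_def using frame_expand[OF fr, of p] by simp
  qed
  have G2: "coords t1 e3 (X q) \<in> UNIV \<and> X q = G (coords t1 e3 (X q))" if "q \<in> M" for q
    using plane nX[OF that] by simp
  have dn: "((\<lambda>y. y $ m) has_derivative (\<lambda>h. h $ m)) (at (y::real^2))" for m y
    by (intro bounded_linear_imp_has_derivative bounded_linear_vec_nth)
  have G3: "(G has_derivative G' y) (at y)" for y
    unfolding G_def[abs_def] G'_def[abs_def] by (auto intro!: derivative_eq_intros dn)
  have G4: "continuous_on UNIV (\<lambda>y. G' y v)" for v unfolding G'_def by simp
  have res: "inj_on X M" "X ` M = range G"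
    by (rule graph_over_domain[OF imm con compl ne fr convex_UNIV ch G2 G3 G4]; assumption)+
  have "range G = {p. n0 \<bullet> p = c}"
  proof (intro equalityI subsetI)
    fix p assume "p \<in> range G"
    then show "p \<in> {p. n0 \<bullet> p = c}"
      unfolding G_def n0_def by (auto simp: inner_diff_left inner_add_right fri)
  next
    fix p assume "p \<in> {p. n0 \<bullet> p = c}"
    then show "p \<in> range G" using plane by blast
  qed
  moreover have "n0 \<bullet> t3 = 1" "n0 \<bullet> e3 = 0" unfolding n0_def by (simp_all add: inner_diff_left fri)
  ultimately have "vertical_plane (X ` M)"
    unfolding vertical_plane_def res(2) by (metis inner_zero_left zero_neq_one)
  then show ?thesis using res(1) by blast
qed

end

text \<open>Monotonicity gives only a non-negative derivative, as for the cube; that it does not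
  vanish comes from the chain rule applied to the differentiable inverse.\<close>

lemma velocity_of_diffeomorphism:
  assumes "strict_mono \<phi>" "diffeomorphism_real \<phi>"
  shows "velocity \<phi>"
proof
  have b: "bij \<phi>" and s: "smooth_on UNIV \<phi>" and si: "smooth_on UNIV (inv \<phi>)"
    using assms(2) unfolding diffeomorphism_real_def by auto
  show "smooth_on UNIV \<phi>" by fact
  show "surj \<phi>" using b by (rule bij_is_surj)
  fix z
  have d: "(\<phi> has_real_derivative deriv \<phi> z) (at z)" by (rule smooth_real_deriv(1)[OF s])
  have "((\<lambda>z. inv \<phi> (\<phi> z)) has_real_derivative deriv (inv \<phi>) (\<phi> z) * deriv \<phi> z) (at z)"
    by (rule DERIV_chain2[OF smooth_real_deriv(1)[OF si] d])
  moreover have "(\<lambda>z. inv \<phi> (\<phi> z)) = (\<lambda>z. z)" using b by (simp add: bij_is_inj)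
  ultimately have "deriv (inv \<phi>) (\<phi> z) * deriv \<phi> z = 1" using DERIV_unique[OF _ DERIV_ident] by metis
  then have "deriv \<phi> z \<noteq> 0" by auto
  moreover have "deriv \<phi> z \<ge> 0"
  proof (rule ccontr)
    assume "\<not> deriv \<phi> z \<ge> 0"
    then obtain e where e: "e > 0" "\<And>h. 0 < h \<Longrightarrow> h < e \<Longrightarrow> \<phi> z > \<phi> (z + h)"
      using DERIV_neg_dec_right[OF d] by force
    have "\<phi> z < \<phi> (z + e / 2)" using assms(1) e(1) by (simp add: strict_mono_less)
    then show False using e(2)[of "e / 2"] e(1) by simp
  qed
  ultimately show "deriv \<phi> z > 0" by simp
qed

theorem theorem3p7:
  fixes \<phi> :: "real \<Rightarrow> real"
    and M :: "('a::{t2_space, second_countable_topology}) set"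
    and X :: "'a \<Rightarrow> real^3"
  assumes "strict_mono \<phi>"
    and "diffeomorphism_real \<phi>"
    and "immersed_surface M X"
    and "M \<noteq> {}"
    and "connected M"
    and "complete_surface M X"
    and "flat_surface M X"
    and "phi_minimal \<phi> M X"
  shows "inj_on X M \<and>
    (vertical_plane (X ` M) \<or> catenary_cylinder \<phi> (X ` M) \<or> tilted_catenary_cylinder \<phi> (X ` M))"
proof -
  interpret soliton \<phi> M X
    by (intro soliton.intro soliton_axioms.intro velocity_of_diffeomorphism assms)
  show ?thesis
  proof (cases "\<exists>D f w y. chart D f w \<and> y \<in> D")
    case True
    then show ?thesis using classification_if_somewhere_nonvertical by blast
  next
    case False
    then have "D = {}" if "chart D f w" for D f w using that by blast
    then show ?thesis using classification_if_everywhere_vertical by blast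
  qed
qed

end
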